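(* Let $x=\{x_1,\ldots,x_n\}$ be indeterminates and let $I\subseteq\mathbb{Z}[x]$ be a pseudo-primary ideal with $\sqrt{I}=P$. Suppose $I=Q\cap J$ with ideals $Q,J\subseteq\mathbb{Z}[x]$ such that $Q$ is $P$-primary and $\operatorname{ht}(Q)<\operatorname{ht}(J)$. Assume $P\cap\mathbb{Z}=\langle p\rangle$ for some prime number $p$, and let $u\subset x$ be a maximal independent set of variables for $\overline{P}=P\mathbb{F}_p[x]$. Let $R:=\mathbb{Z}[u]_{\langle p\rangle}$. Then the following hold: (1) $I\,R[x\smallsetminus u]\cap\mathbb{Z}[x]=Q$. (2) Let $G$ be a strong Gröbner basis of $I$ with respect to a block ordering satisfying $x\smallsetminus u\gg u$. Then $G$ is a strong Gröbner basis of $I\,R[x\smallsetminus u]$ with respect to the induced ordering for the variables $x\smallsetminus u$. (3) Let $G=\{g_1,\ldots,g_k\}$ be a strong Gröbner basis of $I$ with respect to a block ordering satisfying $x\smallsetminus u\gg u$. Write $\operatorname{LT}_{R[x\smallsetminus u]}(g_i)=p^{\nu_i}a_i(x\smallsetminus u)^{\beta_i}$ with $a_i\in\mathbb{Z}[u]\smallsetminus\langle p\rangle$ for $i=1,\ldots,k$, and let $h=\operatorname{lcm}(a_1,\ldots,a_k)$. Then $I\,R[x\smallsetminus u]\cap\mathbb{Z}[x]=I:h^\infty$.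
   Context: An ideal is called pseudo-primary if its radical is prime. $\operatorname{ht}$ denotes the height of an ideal. $P\mathbb{F}_p[x]$ denotes the ideal of $\mathbb{F}_p[x]$ generated by the image of $P$ under reduction modulo $p$. A subset $u\subset x$ (possibly empty, possibly all of $x$) is a maximal independent set of variables for an ideal $\overline{P}\subseteq\mathbb{F}_p[x]$ if $\overline{P}\cap\mathbb{F}_p[u]=\langle 0\rangle$ and $\#u=\dim(\mathbb{F}_p[x]/\overline{P})$. $R=\mathbb{Z}[u]_{\langle p\rangle}$ is the localization of $\mathbb{Z}[u]$ at the prime ideal generated by $p$. $R[x\smallsetminus u]$ is the polynomial ring over $R$ in the variables of $x$ not in $u$. It contains $\mathbb{Z}[x]=\mathbb{Z}[u][x\smallsetminus u]$ as a subring. $I\,R[x\smallsetminus u]$ is the ideal generated by $I$ in $R[x\smallsetminus u]$. $(x\smallsetminus u)^{\beta}$ denotes a monomial in the variables $x\smallsetminus u$ with exponent vector $\beta$. A block ordering with $x\smallsetminus u\gg u$ is a (global) monomial ordering on $\mathbb{Z}[x]$ that compares two monomials first by their parts in the variables $x\smallsetminus u$, using a monomial ordering on these variables, and, in case of equality, by their parts in the variables $u$, using a monomial ordering on those. The induced ordering for the variables $x\smallsetminus u$ is the first of these two orderings. For a nonzero polynomial $f$ over a coefficient ring $A$, $\operatorname{LT}(f)$ denotes the leading term, i.e. the leading monomial together with its leading coefficient in $A$. $\operatorname{LT}_{R[x\smallsetminus u]}(f)$ is the leading term of $f$ viewed as a polynomial in $x\smallsetminus u$ with coefficients in $R$, with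 respect to the induced ordering. A (finite) subset $G$ of an ideal $\mathfrak{a}$ of a polynomial ring over $A$ (here $A=\mathbb{Z}$ with variables $x$, or $A=R$ with variables $x\smallsetminus u$) is a strong Gröbner basis of $\mathfrak{a}$ if for every nonzero $f\in\mathfrak{a}$ there exists $g\in G$ with $\operatorname{LT}(g)\mid\operatorname{LT}(f)$, where divisibility of terms includes divisibility of the coefficients in $A$. $\operatorname{lcm}(a_1,\ldots,a_k)$ is the least common multiple in $\mathbb{Z}[u]$. $I:h^\infty=\{f\in\mathbb{Z}[x] : h^m f\in I\text{ for some }m\in\mathbb{N}\}$. *)

theory Defs
  imports
    "HOL-Algebra.Indexed_Polynomials"
    "HOL-Algebra.IntRing"
    "HOL-Number_Theory.Residues"
    "HOL-Library.Extended_Nat"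
begin

section \<open>Multivariate polynomial rings\<close>

text \<open>
  As in \<^theory>\<open>HOL-Algebra.Indexed_Polynomials\<close>, a monomial is a multiset of variables
  and a polynomial is its coefficient function. That theory provides the carrier, the
  constants and the addition, but no multiplication; the multiplication below is the usual
  convolution, \<open>k\<close> running over the divisors of the monomial \<open>m\<close>.
  The variable set \<open>V\<close> is explicit, so that \<open>A[U]\<close> is literally a subset of \<open>A[V]\<close>
  whenever \<open>U \<subseteq> V\<close>.
\<close>

definition mpoly_ring :: "('a, 'b) ring_scheme \<Rightarrow> 'v set \<Rightarrow> ('v multiset \<Rightarrow> 'a) ring" where
  "mpoly_ring A V =
    \<lparr>carrier = ring.indexed_pset A V (carrier A),
     monoid.mult = (\<lambda>f g m. \<Oplus>\<^bsub>A\<^esub>k\<in>{k. k \<subseteq># m}. f k \<otimes>\<^bsub>A\<^esub> g (m - k)),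
     one = ring.indexed_const A \<one>\<^bsub>A\<^esub>,
     zero = ring.indexed_const A \<zero>\<^bsub>A\<^esub>,
     add = ring.indexed_padd A\<rparr>"

abbreviation int_mpoly :: "'v set \<Rightarrow> ('v multiset \<Rightarrow> int) ring" where
  "int_mpoly V \<equiv> mpoly_ring \<Z> V"

abbreviation int_const :: "int \<Rightarrow> ('v multiset \<Rightarrow> int)" where
  "int_const \<equiv> ring.indexed_const \<Z>"

text \<open>\<open>\<int>/p\<close> is represented by the residues \<open>0, \<dots>, p - 1\<close>.\<close>

definition reduce_mod :: "nat \<Rightarrow> ('v multiset \<Rightarrow> int) \<Rightarrow> ('v multiset \<Rightarrow> int)" where
  "reduce_mod p f = (\<lambda>m. f m mod int p)"

section \<open>Ideals, height and dimension\<close>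

definition radical :: "('a, 'b) ring_scheme \<Rightarrow> 'a set \<Rightarrow> 'a set" where
  "radical R I = {a \<in> carrier R. \<exists>n::nat. a [^]\<^bsub>R\<^esub> n \<in> I}"

definition pseudo_primary :: "('a, 'b) ring_scheme \<Rightarrow> 'a set \<Rightarrow> bool" where
  "pseudo_primary R I \<longleftrightarrow> ideal I R \<and> primeideal (radical R I) R"

definition primary_ideal :: "('a, 'b) ring_scheme \<Rightarrow> 'a set \<Rightarrow> bool" where
  "primary_ideal R Q \<longleftrightarrow>
     ideal Q R \<and> Q \<noteq> carrier R \<and>
     (\<forall>a\<in>carrier R. \<forall>b\<in>carrier R. a \<otimes>\<^bsub>R\<^esub> b \<in> Q \<longrightarrow> a \<in> Q \<or> b \<in> radical R Q)"

definition primary_to :: "('a, 'b) ring_scheme \<Rightarrow> 'a set \<Rightarrow> 'a set \<Rightarrow> bool" where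
  "primary_to R P Q \<longleftrightarrow> primary_ideal R Q \<and> radical R Q = P"

definition prime_chain :: "('a, 'b) ring_scheme \<Rightarrow> nat \<Rightarrow> (nat \<Rightarrow> 'a set) \<Rightarrow> bool" where
  "prime_chain R n C \<longleftrightarrow> (\<forall>i\<le>n. primeideal (C i) R) \<and> (\<forall>i<n. C i \<subset> C (Suc i))"

definition prime_height :: "('a, 'b) ring_scheme \<Rightarrow> 'a set \<Rightarrow> enat" where
  "prime_height R P = Sup {enat n | n. \<exists>C. prime_chain R n C \<and> C n = P}"

text \<open>The infimum over the empty set is \<open>\<infinity>\<close>, so the unit ideal has height \<open>\<infinity>\<close>.\<close>

definition ideal_height :: "('a, 'b) ring_scheme \<Rightarrow> 'a set \<Rightarrow> enat" where
  "ideal_height R I = Inf {prime_height R P | P. primeideal P R \<and> I \<subseteq> P}"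

text \<open>Krull dimension; the zero ring gets dimension \<open>0\<close> here, since \<open>enat\<close> has no \<open>-\<infinity>\<close>.\<close>

definition krull_dim :: "('a, 'b) ring_scheme \<Rightarrow> enat" where
  "krull_dim R = Sup {enat n | n. \<exists>C. prime_chain R n C}"

text \<open>
  The convention for the zero ring is harmless in the next definition: the unit ideal
  already violates the first condition.
\<close>

definition max_independent_set ::
    "('a, 'b) ring_scheme \<Rightarrow> 'v set \<Rightarrow> ('v multiset \<Rightarrow> 'a) set \<Rightarrow> 'v set \<Rightarrow> bool" where
  "max_independent_set K V I u \<longleftrightarrow>
     u \<subseteq> V \<and>
     I \<inter> carrier (mpoly_ring K u) = {\<zero>\<^bsub>mpoly_ring K u\<^esub>} \<and>
     enat (card u) = krull_dim (mpoly_ring K V Quot I)"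

definition saturation :: "('a, 'b) ring_scheme \<Rightarrow> 'a set \<Rightarrow> 'a \<Rightarrow> 'a set" where
  "saturation R I h = {f \<in> carrier R. \<exists>m::nat. h [^]\<^bsub>R\<^esub> m \<otimes>\<^bsub>R\<^esub> f \<in> I}"

text \<open>
  Least common multiples of families, extending the binary \<^const>\<open>islcm\<close>; as there, they
  are determined only up to units.
\<close>

definition is_lcm_of :: "('a, 'b) monoid_scheme \<Rightarrow> 'a set \<Rightarrow> 'a \<Rightarrow> bool" where
  "is_lcm_of M S h \<longleftrightarrow>
     h \<in> carrier M \<and> (\<forall>a\<in>S. a divides\<^bsub>M\<^esub> h) \<and>
     (\<forall>y\<in>carrier M. (\<forall>a\<in>S. a divides\<^bsub>M\<^esub> y) \<longrightarrow> h divides\<^bsub>M\<^esub> y)"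

section \<open>Localization\<close>

text \<open>
  The fraction \<open>a/s\<close>, as the class of all \<open>(b, t)\<close> with \<open>w (t a - s b) = 0\<close> for some
  \<open>w \<in> S\<close>. Sums and products are computed on representatives; for multiplicatively
  closed \<open>S\<close> all representatives give the same class, so the unions below consist of a
  single class.
\<close>

definition frac_class :: "('a, 'b) ring_scheme \<Rightarrow> 'a set \<Rightarrow> 'a \<Rightarrow> 'a \<Rightarrow> ('a \<times> 'a) set" where
  "frac_class A S a s =
     {(b, t). b \<in> carrier A \<and> t \<in> S \<and>
        (\<exists>w\<in>S. w \<otimes>\<^bsub>A\<^esub> (t \<otimes>\<^bsub>A\<^esub> a) = w \<otimes>\<^bsub>A\<^esub> (s \<otimes>\<^bsub>A\<^esub> b))}"

definition localization :: "('a, 'b) ring_scheme \<Rightarrow> 'a set \<Rightarrow> ('a \<times> 'a) set ring" where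
  "localization A S =
    \<lparr>carrier = {frac_class A S a s | a s. a \<in> carrier A \<and> s \<in> S},
     monoid.mult = (\<lambda>x y. \<Union>(a, s)\<in>x. \<Union>(b, t)\<in>y. frac_class A S (a \<otimes>\<^bsub>A\<^esub> b) (s \<otimes>\<^bsub>A\<^esub> t)),
     one = frac_class A S \<one>\<^bsub>A\<^esub> \<one>\<^bsub>A\<^esub>,
     zero = frac_class A S \<zero>\<^bsub>A\<^esub> \<one>\<^bsub>A\<^esub>,
     add = (\<lambda>x y. \<Union>(a, s)\<in>x. \<Union>(b, t)\<in>y.
              frac_class A S (t \<otimes>\<^bsub>A\<^esub> a \<oplus>\<^bsub>A\<^esub> s \<otimes>\<^bsub>A\<^esub> b) (s \<otimes>\<^bsub>A\<^esub> t))\<rparr>"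

definition localization_at :: "('a, 'b) ring_scheme \<Rightarrow> 'a set \<Rightarrow> ('a \<times> 'a) set ring" where
  "localization_at A P = localization A (carrier A - P)"

definition to_localization_at :: "('a, 'b) ring_scheme \<Rightarrow> 'a set \<Rightarrow> 'a \<Rightarrow> ('a \<times> 'a) set" where
  "to_localization_at A P a = frac_class A (carrier A - P) a \<one>\<^bsub>A\<^esub>"

abbreviation p_ideal :: "nat \<Rightarrow> 'v set \<Rightarrow> ('v multiset \<Rightarrow> int) set" where
  "p_ideal p u \<equiv> Idl\<^bsub>int_mpoly u\<^esub> {int_const (int p)}"

text \<open>\<open>coeff_ring p u\<close> is \<open>R = \<int>[u]\<^bsub>\<langle>p\<rangle>\<^esub>\<close>, and \<open>to_coeff_ring p u\<close> is the map \<open>\<int>[u] \<rightarrow> R\<close>.\<close>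

abbreviation coeff_ring ::
    "nat \<Rightarrow> 'v set \<Rightarrow> (('v multiset \<Rightarrow> int) \<times> ('v multiset \<Rightarrow> int)) set ring" where
  "coeff_ring p u \<equiv> localization_at (int_mpoly u) (p_ideal p u)"

abbreviation to_coeff_ring ::
    "nat \<Rightarrow> 'v set \<Rightarrow> ('v multiset \<Rightarrow> int) \<Rightarrow> (('v multiset \<Rightarrow> int) \<times> ('v multiset \<Rightarrow> int)) set" where
  "to_coeff_ring p u \<equiv> to_localization_at (int_mpoly u) (p_ideal p u)"

text \<open>
  \<open>nest u\<close> regards a polynomial as a polynomial in the variables outside \<open>u\<close>, with
  coefficients that are polynomials in \<open>u\<close>; \<open>embed p u\<close> is the resulting inclusion of
  \<open>\<int>[x] = \<int>[u][x - u]\<close> into \<open>R[x - u]\<close>.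
\<close>

definition nest :: "'v set \<Rightarrow> ('v multiset \<Rightarrow> int) \<Rightarrow> 'v multiset \<Rightarrow> 'v multiset \<Rightarrow> int" where
  "nest u f = (\<lambda>m k. if set_mset m \<inter> u = {} \<and> set_mset k \<subseteq> u then f (m + k) else 0)"

definition embed :: "nat \<Rightarrow> 'v set \<Rightarrow> ('v multiset \<Rightarrow> int) \<Rightarrow>
    'v multiset \<Rightarrow> (('v multiset \<Rightarrow> int) \<times> ('v multiset \<Rightarrow> int)) set" where
  "embed p u f = (\<lambda>m. to_coeff_ring p u (nest u f m))"

definition extended_ideal :: "nat \<Rightarrow> 'v set \<Rightarrow> 'v set \<Rightarrow> ('v multiset \<Rightarrow> int) set \<Rightarrow>
    ('v multiset \<Rightarrow> (('v multiset \<Rightarrow> int) \<times> ('v multiset \<Rightarrow> int)) set) set" where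
  "extended_ideal p V u I = Idl\<^bsub>mpoly_ring (coeff_ring p u) (V - u)\<^esub> (embed p u ` I)"

definition contracted_extension ::
    "nat \<Rightarrow> 'v set \<Rightarrow> 'v set \<Rightarrow> ('v multiset \<Rightarrow> int) set \<Rightarrow> ('v multiset \<Rightarrow> int) set" where
  "contracted_extension p V u I =
     {f \<in> carrier (int_mpoly V). embed p u f \<in> extended_ideal p V u I}"

section \<open>Monomial orderings and strong Groebner bases\<close>

definition monomials :: "'v set \<Rightarrow> 'v multiset set" where
  "monomials V = {m. set_mset m \<subseteq> V}"

text \<open>Global monomial orderings; \<open>(a, b) \<in> r\<close> means \<open>a \<le> b\<close>.\<close>

definition monomial_ordering :: "'v set \<Rightarrow> 'v multiset rel \<Rightarrow> bool" where
  "monomial_ordering V r \<longleftrightarrow>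
     linear_order_on (monomials V) r \<and>
     (\<forall>a b. \<forall>c\<in>monomials V. (a, b) \<in> r \<longrightarrow> (a + c, b + c) \<in> r) \<and>
     (\<forall>a\<in>monomials V. ({#}, a) \<in> r)"

text \<open>
  \<open>r\<close> is a block ordering on the monomials in \<open>V\<close> with \<open>V - u \<gg> u\<close>, whose induced ordering
  for the variables \<open>V - u\<close> is \<open>r\<^sub>1\<close>.
\<close>

definition block_ordering :: "'v set \<Rightarrow> 'v set \<Rightarrow> 'v multiset rel \<Rightarrow> 'v multiset rel \<Rightarrow> bool" where
  "block_ordering V u r r\<^sub>1 \<longleftrightarrow>
     monomial_ordering V r \<and> monomial_ordering (V - u) r\<^sub>1 \<and>
     (\<exists>r\<^sub>2. monomial_ordering u r\<^sub>2 \<and>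
       (\<forall>a\<in>monomials V. \<forall>b\<in>monomials V.
          (a, b) \<in> r \<longleftrightarrow>
          (if filter_mset (\<lambda>v. v \<notin> u) a \<noteq> filter_mset (\<lambda>v. v \<notin> u) b
           then (filter_mset (\<lambda>v. v \<notin> u) a, filter_mset (\<lambda>v. v \<notin> u) b) \<in> r\<^sub>1
           else (filter_mset (\<lambda>v. v \<in> u) a, filter_mset (\<lambda>v. v \<in> u) b) \<in> r\<^sub>2)))"

text \<open>The leading monomial is meaningful only for nonzero polynomials.\<close>

definition lead_monom ::
    "('a, 'b) ring_scheme \<Rightarrow> 'v multiset rel \<Rightarrow> ('v multiset \<Rightarrow> 'a) \<Rightarrow> 'v multiset" where
  "lead_monom A r f = (THE m. f m \<noteq> \<zero>\<^bsub>A\<^esub> \<and> (\<forall>k. f k \<noteq> \<zero>\<^bsub>A\<^esub> \<longrightarrow> (k, m) \<in> r))"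

text \<open>A term is a pair of a coefficient and a monomial.\<close>

definition lead_term ::
    "('a, 'b) ring_scheme \<Rightarrow> 'v multiset rel \<Rightarrow> ('v multiset \<Rightarrow> 'a) \<Rightarrow> 'a \<times> 'v multiset" where
  "lead_term A r f = (f (lead_monom A r f), lead_monom A r f)"

definition term_divides ::
    "('a, 'b) ring_scheme \<Rightarrow> 'a \<times> 'v multiset \<Rightarrow> 'a \<times> 'v multiset \<Rightarrow> bool" where
  "term_divides A s t \<longleftrightarrow> fst s divides\<^bsub>A\<^esub> fst t \<and> snd s \<subseteq># snd t"

definition strong_groebner_basis ::
    "('a, 'b) ring_scheme \<Rightarrow> 'v set \<Rightarrow> 'v multiset rel \<Rightarrow>
     ('v multiset \<Rightarrow> 'a) set \<Rightarrow> ('v multiset \<Rightarrow> 'a) set \<Rightarrow> bool" where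
  "strong_groebner_basis A V r I G \<longleftrightarrow>
     finite G \<and> G \<subseteq> I \<and>
     (\<forall>f\<in>I - {\<zero>\<^bsub>mpoly_ring A V\<^esub>}. \<exists>g\<in>G - {\<zero>\<^bsub>mpoly_ring A V\<^esub>}.
        term_divides A (lead_term A r g) (lead_term A r f))"

end

theory Submission
  imports Defs "HOL-Library.Poly_Mapping"
begin

text \<open>
  Let \<open>S = \<int>[u] - \<langle>p\<rangle>\<close>. The contraction of \<open>I R[x - u]\<close> is the set of all \<open>f\<close> with \<open>s f \<in> I\<close> for
  some \<open>s \<in> S\<close>. Independence of \<open>u\<close> gives \<open>P \<inter> S = \<emptyset>\<close>, so this set is \<open>Q\<close> once \<open>J\<close> meets \<open>S\<close>.
  The height condition gives \<open>J \<not>\<subseteq> P\<close>; if \<open>J + P\<close> missed \<open>S\<close>, some prime strictly above \<open>P\<close> would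
  still contract to \<open>\<langle>p\<rangle>\<close> in \<open>\<int>[u]\<close>. But a prime contracting to \<open>\<langle>p\<rangle>\<close> in \<open>\<int>[w, v]\<close> lies strictly below
  one contracting to \<open>\<langle>p\<rangle>\<close> in \<open>\<int>[w]\<close>; spending the variables of \<open>u\<close> one by one yields a chain of
  length \<open>#u + 1\<close> above \<open>P\<close>, contradicting the dimension of \<open>\<F>\<^sub>p[x]/P\<close>.

  For (2), let \<open>p\<^sup>\<nu> a\<close> be the leading coefficient of \<open>f \<in> I\<close> over \<open>\<int>[u]\<close>, with \<open>a \<in> S\<close>. Since some \<open>p\<^sup>N\<close>
  lies in \<open>I\<close>, a multiple of \<open>f\<close> by an element of \<open>\<int>[u]\<close> can be corrected within \<open>I\<close> so that \<open>a\<close> is replaced by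
  a polynomial whose integer leading coefficient is prime to \<open>p\<close>. Comparing \<open>p\<close>-adic valuations then turns
  divisibility of leading terms over \<open>\<int>\<close> into divisibility over \<open>R\<close>. For (3), multiplication by \<open>h\<close> makes one
  reduction step with \<open>G\<close> possible over \<open>\<int>[u]\<close>, and the reduction ends because monomial orderings are
  well-founded.
\<close>

section \<open>Ideals of subrings\<close>

text \<open>All rings \<open>zpolys W\<close> are subsets of one commutative ring type, so the
  contraction of an ideal is an intersection; \<open>lookup\<close> carries the results over to the
  records of the statement. No dimension formula enters: a lower bound for the dimension suffices,
  and an explicit chain of primes gives it. The obstacle is that going up fails, since the
  extensions are not integral: a prime above the contraction of \<open>P\<close> need not be the
  contraction of a prime above \<open>P\<close>. Lifting therefore works generically. Each extension
  names an element outside the contraction, every prime avoiding it lifts, and the larger prime one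
  level below is built so as to avoid it. In (2) the obstacle is that \<open>a \<in> S\<close>
  restricts only the content of \<open>a\<close>: its integer leading coefficient may still be
  divisible by \<open>p\<close>. The basis element found for \<open>f\<close> itself could then
  carry a higher power of \<open>p\<close> than the leading coefficient of \<open>f\<close> over
  \<open>R\<close>. This is why \<open>f\<close> is changed before the basis is applied.\<close>

definition unital_subring :: "'a::comm_ring_1 set \<Rightarrow> bool" where
  "unital_subring A \<longleftrightarrow> 1 \<in> A \<and> (\<forall>x\<in>A. \<forall>y\<in>A. x - y \<in> A \<and> x * y \<in> A)"

definition ideal_in :: "'a::comm_ring_1 set \<Rightarrow> 'a set \<Rightarrow> bool" where
  "ideal_in A K \<longleftrightarrow> K \<subseteq> A \<and> 0 \<in> K \<and> (\<forall>x\<in>K. \<forall>y\<in>K. x + y \<in> K) \<and> (\<forall>a\<in>A. \<forall>x\<in>K. a * x \<in> K)"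

definition prime_in :: "'a::comm_ring_1 set \<Rightarrow> 'a set \<Rightarrow> bool" where
  "prime_in A K \<longleftrightarrow> ideal_in A K \<and> 1 \<notin> K \<and> (\<forall>a\<in>A. \<forall>b\<in>A. a * b \<in> K \<longrightarrow> a \<in> K \<or> b \<in> K)"

lemma subring_closed:
  assumes "unital_subring A"
  shows subring_one: "1 \<in> A" and subring_zero: "0 \<in> A"
    and subring_diff: "\<And>x y. x \<in> A \<Longrightarrow> y \<in> A \<Longrightarrow> x - y \<in> A"
    and subring_mult: "\<And>x y. x \<in> A \<Longrightarrow> y \<in> A \<Longrightarrow> x * y \<in> A"
    and subring_uminus: "\<And>x. x \<in> A \<Longrightarrow> - x \<in> A"
    and subring_add: "\<And>x y. x \<in> A \<Longrightarrow> y \<in> A \<Longrightarrow> x + y \<in> A"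
proof -
  show 1: "1 \<in> A" and d: "\<And>x y. x \<in> A \<Longrightarrow> y \<in> A \<Longrightarrow> x - y \<in> A"
    and "\<And>x y. x \<in> A \<Longrightarrow> y \<in> A \<Longrightarrow> x * y \<in> A"
    using assms by (auto simp: unital_subring_def)
  show z: "0 \<in> A" using d[OF 1 1] by simp
  show m: "- x \<in> A" if "x \<in> A" for x using d[OF z that] by simp
  show "x + y \<in> A" if "x \<in> A" "y \<in> A" for x y using d[OF that(1) m[OF that(2)]] by simp
qed

lemma subring_power: "unital_subring A \<Longrightarrow> x \<in> A \<Longrightarrow> x ^ n \<in> A"
  by (induction n) (auto simp: subring_one subring_mult)

lemma ideal_inD:
  assumes "ideal_in A K"
  shows ideal_in_subset: "K \<subseteq> A" and ideal_in_zero: "0 \<in> K"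
    and ideal_in_add: "\<And>x y. x \<in> K \<Longrightarrow> y \<in> K \<Longrightarrow> x + y \<in> K"
    and ideal_in_mult: "\<And>a x. a \<in> A \<Longrightarrow> x \<in> K \<Longrightarrow> a * x \<in> K"
  using assms by (auto simp: ideal_in_def)

lemma ideal_in_uminus:
  assumes "unital_subring A" "ideal_in A K" "x \<in> K"
  shows "- x \<in> K"
  using ideal_in_mult[OF assms(2) subring_uminus[OF assms(1) subring_one[OF assms(1)]] assms(3)]
  by simp

lemma ideal_in_diff:
  assumes "unital_subring A" "ideal_in A K" "x \<in> K" "y \<in> K"
  shows "x - y \<in> K"
  using ideal_in_add[OF assms(2,3) ideal_in_uminus[OF assms(1,2,4)]] by simp

lemma ideal_in_add_cancel:
  assumes "unital_subring A" "ideal_in A K" "x + y \<in> K" "y \<in> K"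
  shows "x \<in> K"
  using ideal_in_diff[OF assms] by simp

lemma ideal_in_diff_cancel:
  assumes "unital_subring A" "ideal_in A K" "x - y \<in> K"
  shows "x \<in> K \<longleftrightarrow> y \<in> K"
  using ideal_in_add[OF assms(2,3), of y] ideal_in_diff[OF assms(1,2) _ assms(3), of x] by auto

lemma ideal_in_sum:
  assumes "ideal_in A I" "ideal_in A J" and A: "unital_subring A"
  shows "ideal_in A {i + j | i j. i \<in> I \<and> j \<in> J}"
  unfolding ideal_in_def
proof (intro conjI ballI)
  show "{i + j | i j. i \<in> I \<and> j \<in> J} \<subseteq> A"
    using assms by (auto simp: ideal_in_def subring_add subsetD)
  show "0 \<in> {i + j | i j. i \<in> I \<and> j \<in> J}"
    using assms by (auto simp: ideal_in_def intro!: exI[of _ 0])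
next
  fix x y assume "x \<in> {i + j | i j. i \<in> I \<and> j \<in> J}" "y \<in> {i + j | i j. i \<in> I \<and> j \<in> J}"
  then obtain i j i' j' where "x = i + j" "y = i' + j'" "i \<in> I" "j \<in> J" "i' \<in> I" "j' \<in> J"
    by auto
  moreover from this have "x + y = (i + i') + (j + j')" by (simp add: algebra_simps)
  ultimately show "x + y \<in> {i + j | i j. i \<in> I \<and> j \<in> J}"
    using assms by (blast intro: ideal_in_add)
next
  fix a x assume "a \<in> A" "x \<in> {i + j | i j. i \<in> I \<and> j \<in> J}"
  then obtain i j where "x = i + j" "i \<in> I" "j \<in> J" "a \<in> A" by auto
  moreover from this have "a * x = a * i + a * j" by (simp add: algebra_simps)
  ultimately show "a * x \<in> {i + j | i j. i \<in> I \<and> j \<in> J}"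
    using assms by (blast intro: ideal_in_mult)
qed

lemma ideal_in_sum_upper:
  assumes "ideal_in A I" "ideal_in A J"
  shows "I \<subseteq> {i + j | i j. i \<in> I \<and> j \<in> J}" "J \<subseteq> {i + j | i j. i \<in> I \<and> j \<in> J}"
proof -
  have "i + 0 \<in> {i + j | i j. i \<in> I \<and> j \<in> J}" if "i \<in> I" for i
    using that ideal_in_zero[OF assms(2)] by blast
  then show "I \<subseteq> {i + j | i j. i \<in> I \<and> j \<in> J}" by auto
  have "0 + j \<in> {i + j | i j. i \<in> I \<and> j \<in> J}" if "j \<in> J" for j
    using that ideal_in_zero[OF assms(1)] by blast
  then show "J \<subseteq> {i + j | i j. i \<in> I \<and> j \<in> J}" by auto
qed

lemma ideal_in_principal:
  assumes A: "unital_subring A" and "b \<in> A"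
  shows "ideal_in A {b * y | y. y \<in> A}"
  unfolding ideal_in_def
proof (intro conjI ballI)
  show "{b * y | y. y \<in> A} \<subseteq> A" using assms by (auto intro: subring_mult)
  show "0 \<in> {b * y | y. y \<in> A}" using subring_zero[OF A] by (auto intro!: exI[of _ 0])
next
  fix x y assume "x \<in> {b * y | y. y \<in> A}" "y \<in> {b * y | y. y \<in> A}"
  then obtain s t where "x = b * s" "y = b * t" "s \<in> A" "t \<in> A" by auto
  then show "x + y \<in> {b * y | y. y \<in> A}"
    using subring_add[OF A] by (auto simp: distrib_left[symmetric])
next
  fix a x assume "a \<in> A" "x \<in> {b * y | y. y \<in> A}"
  then obtain s where "x = b * s" "s \<in> A" "a \<in> A" by auto
  then show "a * x \<in> {b * y | y. y \<in> A}"
    using subring_mult[OF A] by (auto simp: mult.left_commute intro!: exI[of _ "a * s"])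
qed

lemma principal_self: "unital_subring A \<Longrightarrow> b \<in> {b * y | y. y \<in> A}"
  using subring_one[of A] by (auto intro!: exI[of _ 1])

lemma prime_inD:
  assumes "prime_in A K"
  shows prime_in_ideal: "ideal_in A K" and prime_in_one: "1 \<notin> K"
    and prime_in_mult: "\<And>a b. a \<in> A \<Longrightarrow> b \<in> A \<Longrightarrow> a * b \<in> K \<Longrightarrow> a \<in> K \<or> b \<in> K"
  using assms by (auto simp: prime_in_def)

lemma prime_in_power:
  assumes "prime_in A K" "unital_subring A" "a \<in> A" "a ^ n \<in> K"
  shows "a \<in> K"
  using assms(4)
  by (induction n)
    (use prime_inD[OF assms(1)] subring_power[OF assms(2,3)] assms(3) in auto)

lemma prime_in_restrict:
  assumes "prime_in B K" "unital_subring A" "A \<subseteq> B"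
  shows "prime_in A (K \<inter> A)"
  using assms subring_closed[OF assms(2)] by (auto simp: prime_in_def ideal_in_def subset_iff)

text \<open>By Zorn, an ideal maximal among those above \<open>K\<close> that miss the
  multiplicative set \<open>M\<close> is prime. Taking \<open>M\<close> as the complement of a prime
  in a subring controls the contraction of \<open>q\<close> to that subring.\<close>

lemma exists_prime_in:
  assumes A: "unital_subring A" and K: "ideal_in A K"
    and M: "1 \<in> M" "M \<subseteq> A" "\<And>s t. s \<in> M \<Longrightarrow> t \<in> M \<Longrightarrow> s * t \<in> M" "K \<inter> M = {}"
  obtains q where "prime_in A q" "K \<subseteq> q" "q \<inter> M = {}"
proof -
  let ?S = "{q. ideal_in A q \<and> K \<subseteq> q \<and> q \<inter> M = {}}"
  have "\<exists>q\<in>?S. \<forall>Z\<in>?S. q \<subseteq> Z \<longrightarrow> Z = q"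
  proof (rule subset_Zorn_nonempty)
    show "?S \<noteq> {}" using K M(4) by auto
  next
    fix C assume C: "C \<noteq> {}" "subset.chain ?S C"
    then have CS: "\<And>q. q \<in> C \<Longrightarrow> ideal_in A q \<and> K \<subseteq> q \<and> q \<inter> M = {}"
      and ch: "\<And>q q'. q \<in> C \<Longrightarrow> q' \<in> C \<Longrightarrow> q \<subseteq> q' \<or> q' \<subseteq> q"
      by (auto simp: subset_chain_def)
    have "ideal_in A (\<Union>C)"
      unfolding ideal_in_def
    proof (intro conjI ballI)
      show "\<Union>C \<subseteq> A" using CS ideal_in_subset by blast
      show "0 \<in> \<Union>C" using CS C(1) ideal_in_zero by blast
    next
      fix x y assume "x \<in> \<Union>C" "y \<in> \<Union>C"
      then obtain q q' where "x \<in> q" "y \<in> q'" "q \<in> C" "q' \<in> C" by auto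
      then show "x + y \<in> \<Union>C"
        using ch[of q q'] CS by (metis UnionI ideal_in_add subsetD)
    next
      fix a x assume "a \<in> A" "x \<in> \<Union>C"
      then show "a * x \<in> \<Union>C" using CS by (meson UnionE UnionI ideal_in_mult)
    qed
    then show "\<Union>C \<in> ?S" using CS C(1) by blast
  qed
  then obtain q where q: "ideal_in A q" "K \<subseteq> q" "q \<inter> M = {}"
    and max: "\<And>Z. ideal_in A Z \<Longrightarrow> Z \<inter> M = {} \<Longrightarrow> q \<subseteq> Z \<Longrightarrow> Z = q"
    by (smt (verit) mem_Collect_eq subset_trans)
  \<comment> \<open>Maximality: \<open>q + aA\<close> is strictly larger than \<open>q\<close>, so
    it meets \<open>M\<close>.\<close>
  have step: "\<exists>i\<in>q. \<exists>y\<in>A. i + a * y \<in> M" if a: "a \<in> A" "a \<notin> q" for a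
  proof (rule ccontr)
    assume n: "\<not> ?thesis"
    let ?X = "{i + j | i j. i \<in> q \<and> j \<in> {a * y | y. y \<in> A}}"
    have id: "ideal_in A ?X"
      by (rule ideal_in_sum[OF q(1) ideal_in_principal[OF A a(1)] A])
    note sub = ideal_in_sum_upper[OF q(1) ideal_in_principal[OF A a(1)]]
    have "?X \<inter> M = {}" using n by blast
    then have "?X = q" using max[OF id _ sub(1)] by blast
    moreover have "a \<in> ?X" using sub(2) principal_self[OF A] by blast
    ultimately show False using a by simp
  qed
  have "prime_in A q"
    unfolding prime_in_def
  proof (intro conjI ballI impI)
    show "ideal_in A q" by fact
    show "1 \<notin> q" using q M by auto
    fix a b assume ab: "a \<in> A" "b \<in> A" "a * b \<in> q"
    show "a \<in> q \<or> b \<in> q"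
    proof (rule ccontr)
      assume "\<not> ?thesis"
      then obtain i y j z where iy: "i \<in> q" "y \<in> A" "i + a * y \<in> M" "j \<in> q" "z \<in> A" "j + b * z \<in> M"
        using step[OF ab(1)] step[OF ab(2)] by blast
      have A': "i \<in> A" "j \<in> A" using iy q(1) ideal_in_subset by blast+
      \<comment> \<open>The product of two elements of \<open>M\<close> stays in \<open>M\<close>,
        while every term of its expansion lies in \<open>q\<close> as soon as \<open>a * b\<close>
        does.\<close>
      have "(i + a * y) * (j + b * z) = (j + b * z) * i + (a * y) * j + (y * z) * (a * b)"
        by (simp add: algebra_simps)
      also have "\<dots> \<in> q"
        using iy A' ab subring_mult[OF A] subring_add[OF A]
        by (intro ideal_in_add[OF q(1)]) (auto intro: ideal_in_mult[OF q(1)])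
      finally show False using M(3)[OF iy(3,6)] q(3) by blast
    qed
  qed
  then show thesis using that q by blast
qed

lemma prime_in_complement_mult:
  assumes "prime_in A q" "unital_subring A"
  shows "1 \<in> A - q" "\<And>s t. s \<in> A - q \<Longrightarrow> t \<in> A - q \<Longrightarrow> s * t \<in> A - q"
  using assms prime_inD[OF assms(1)] subring_closed[OF assms(2)] by auto

section \<open>Lifting primes along a simple transcendental extension\<close>

text \<open>Polynomials in \<open>x\<close> of degree below \<open>n\<close> with coefficients in
  \<open>S\<close>. The strict bound makes \<open>l + a * x ^ n\<close> a polynomial with its top
  term split off, the form on which the inductions run. \<open>S\<close> may be an ideal
  \<open>q\<close> as well as the ring \<open>A\<close>.\<close>

primrec poly_span :: "'a::comm_ring_1 set \<Rightarrow> 'a \<Rightarrow> nat \<Rightarrow> 'a set" where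
  "poly_span S x 0 = {0}"
| "poly_span S x (Suc n) = {l + a * x ^ n | l a. l \<in> poly_span S x n \<and> a \<in> S}"

definition poly_ext :: "'a::comm_ring_1 set \<Rightarrow> 'a \<Rightarrow> 'a set" where
  "poly_ext S x = (\<Union>n. poly_span S x n)"

text \<open>\<open>free\<close> expresses transcendence of \<open>x\<close> over \<open>A\<close>
  through top coefficients alone; the vanishing of the lower ones follows by repetition.\<close>

locale simple_ext =
  fixes A :: "'a::comm_ring_1 set" and x :: 'a
  assumes A: "unital_subring A"
    and free: "\<And>n l a. l \<in> poly_span A x n \<Longrightarrow> a \<in> A \<Longrightarrow> l + a * x ^ n = 0 \<Longrightarrow> a = 0"
begin

abbreviation "B \<equiv> poly_ext A x"

lemma ideal_self: "ideal_in A A"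
  using subring_closed[OF A] by (auto simp: ideal_in_def)

lemma span_SucI: "l \<in> poly_span q x n \<Longrightarrow> a \<in> q \<Longrightarrow> l + a * x ^ n \<in> poly_span q x (Suc n)"
  by auto

lemma span_zero: "ideal_in A q \<Longrightarrow> 0 \<in> poly_span q x n"
  by (induction n) (auto dest: ideal_in_zero intro!: exI[of _ 0])

lemma span_Suc: "ideal_in A q \<Longrightarrow> poly_span q x n \<subseteq> poly_span q x (Suc n)"
  using span_SucI[of _ q n 0] ideal_in_zero[of A q] by (auto simp del: poly_span.simps)

lemma span_mono:
  assumes "ideal_in A q" "m \<le> n"
  shows "poly_span q x m \<subseteq> poly_span q x n"
  using lift_Suc_mono_le[of "poly_span q x", OF span_Suc[OF assms(1)] assms(2)] .

lemma span_coeff_mono: "q \<subseteq> q' \<Longrightarrow> poly_span q x n \<subseteq> poly_span q' x n"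
  by (induction n) auto

lemma span_add:
  assumes q: "ideal_in A q"
  shows "l \<in> poly_span q x n \<Longrightarrow> l' \<in> poly_span q x n \<Longrightarrow> l + l' \<in> poly_span q x n"
proof (induction n arbitrary: l l')
  case (Suc n)
  then obtain k a k' a' where "l = k + a * x ^ n" "l' = k' + a' * x ^ n"
    "k \<in> poly_span q x n" "k' \<in> poly_span q x n" "a \<in> q" "a' \<in> q" by auto
  moreover from this have "l + l' = (k + k') + (a + a') * x ^ n" by (simp add: algebra_simps)
  ultimately show ?case using Suc.IH[of k k'] ideal_in_add[OF q, of a a'] span_SucI by metis
qed simp

lemma span_scale:
  assumes q: "ideal_in A q" and a: "a \<in> A"
  shows "l \<in> poly_span q x n \<Longrightarrow> a * l \<in> poly_span q x n"
proof (induction n arbitrary: l)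
  case (Suc n)
  then obtain k b where "l = k + b * x ^ n" "k \<in> poly_span q x n" "b \<in> q" by auto
  moreover from this have "a * l = a * k + (a * b) * x ^ n" by (simp add: algebra_simps)
  ultimately show ?case using Suc.IH ideal_in_mult[OF q a] by auto
qed simp

lemma span_uminus: "ideal_in A q \<Longrightarrow> l \<in> poly_span q x n \<Longrightarrow> - l \<in> poly_span q x n"
  using span_scale[of q "-1"] subring_closed[OF A] by simp

lemma span_diff:
  "ideal_in A q \<Longrightarrow> l \<in> poly_span q x n \<Longrightarrow> l' \<in> poly_span q x n \<Longrightarrow> l - l' \<in> poly_span q x n"
  using span_add[of q l n "- l'"] span_uminus[of q l' n] by simp

lemma span_shift1: "l \<in> poly_span q x n \<Longrightarrow> ideal_in A q \<Longrightarrow> x * l \<in> poly_span q x (Suc n)"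
proof (induction n arbitrary: l)
  case 0
  then show ?case using span_zero[of q 1] by simp
next
  case (Suc n)
  then obtain k b where "l = k + b * x ^ n" "k \<in> poly_span q x n" "b \<in> q" by auto
  moreover from this have "x * l = x * k + b * x ^ Suc n" by (simp add: algebra_simps)
  ultimately show ?case using Suc.IH[of k] Suc.prems by auto
qed

lemma span_shift: "ideal_in A q \<Longrightarrow> l \<in> poly_span q x n \<Longrightarrow> x ^ k * l \<in> poly_span q x (k + n)"
  by (induction k) (auto simp del: poly_span.simps simp: mult.assoc intro: span_shift1)

lemma span_monom: "a \<in> q \<Longrightarrow> ideal_in A q \<Longrightarrow> a * x ^ n \<in> poly_span q x (Suc n)"
  using span_SucI[OF span_zero, of q a n] by simp

lemma span_const: "a \<in> A \<Longrightarrow> 0 < n \<Longrightarrow> a \<in> poly_span A x n"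
  using span_monom[OF _ ideal_self, of a 0] span_mono[OF ideal_self, of "Suc 0" n] by (auto simp del: poly_span.simps)

lemma span_mult:
  assumes q: "ideal_in A q"
  shows "b \<in> poly_span A x m \<Longrightarrow> l \<in> poly_span q x n \<Longrightarrow> b * l \<in> poly_span q x (m + n)"
proof (induction m arbitrary: b)
  case 0
  then show ?case using span_zero[OF q, of n] by simp
next
  case (Suc m)
  then obtain k a where b: "b = k + a * x ^ m" "k \<in> poly_span A x m" "a \<in> A" by auto
  have "k * l + a * (x ^ m * l) \<in> poly_span q x (m + n)"
    using span_add[OF q Suc.IH[OF b(2) Suc.prems(2)] span_scale[OF q b(3) span_shift[OF q Suc.prems(2)]]] .
  then show ?case using b span_Suc[OF q, of "m + n"] by (auto simp: algebra_simps simp del: poly_span.simps)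
qed

lemma ext_common:
  assumes "ideal_in A q" "y \<in> poly_ext q x" "z \<in> poly_ext q x"
  obtains n where "y \<in> poly_span q x n" "z \<in> poly_span q x n"
proof -
  from assms obtain m n where "y \<in> poly_span q x m" "z \<in> poly_span q x n"
    by (auto simp: poly_ext_def)
  then show thesis using that[of "max m n"] span_mono[OF assms(1)]
    by (meson max.cobounded1 max.cobounded2 subsetD)
qed

lemma B_subring: "unital_subring B"
  unfolding unital_subring_def
proof (intro conjI ballI)
  have "1 \<in> poly_span A x (Suc 0)" using span_monom[of 1 A 0] subring_one[OF A] ideal_self by simp
  then show "1 \<in> B" unfolding poly_ext_def by blast
next
  fix y z assume y: "y \<in> B" "z \<in> B"
  then obtain n where "y \<in> poly_span A x n" "z \<in> poly_span A x n" using ext_common[OF ideal_self] by blast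
  then have "y - z \<in> poly_span A x n" "y * z \<in> poly_span A x (n + n)"
    using span_diff[OF ideal_self] span_mult[OF ideal_self] by auto
  then show "y - z \<in> B" "y * z \<in> B" unfolding poly_ext_def by blast+
qed

lemma span_subset_ext: "poly_span q x n \<subseteq> poly_ext q x"
  by (auto simp: poly_ext_def)

lemma coeff_in_ext: "ideal_in A q \<Longrightarrow> q \<subseteq> poly_ext q x"
  using span_monom[of _ q 0] span_subset_ext[of q "Suc 0"] by (auto simp del: poly_span.simps)

lemma A_subset_B: "A \<subseteq> B"
  by (rule coeff_in_ext[OF ideal_self])

lemma x_in_B: "x \<in> B"
  using span_monom[of 1 A 1] subring_one[OF A] ideal_self span_subset_ext[of A 2]
  by (auto simp del: poly_span.simps simp: numeral_2_eq_2)

lemma ext_ideal: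
  assumes q: "ideal_in A q"
  shows "ideal_in B (poly_ext q x)"
  unfolding ideal_in_def
proof (intro conjI ballI)
  show "poly_ext q x \<subseteq> B"
    using span_coeff_mono[OF ideal_in_subset[OF q]] by (auto simp: poly_ext_def)
  show "0 \<in> poly_ext q x" using span_zero[OF q] unfolding poly_ext_def by blast
next
  fix y z assume y: "y \<in> poly_ext q x" "z \<in> poly_ext q x"
  then obtain n where "y \<in> poly_span q x n" "z \<in> poly_span q x n" using ext_common[OF q] by blast
  then show "y + z \<in> poly_ext q x" using span_add[OF q] unfolding poly_ext_def by blast
next
  fix y z assume y: "y \<in> B" "z \<in> poly_ext q x"
  then obtain m n where "y \<in> poly_span A x m" "z \<in> poly_span q x n" by (auto simp: poly_ext_def)
  then show "y * z \<in> poly_ext q x" using span_mult[OF q] unfolding poly_ext_def by blast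
qed

section \<open>Leading coefficients modulo an extended ideal\<close>

lemma top_coeff_unique:
  assumes "l \<in> poly_span A x n" "a \<in> A" "l' \<in> poly_span A x n" "a' \<in> A" "l + a * x ^ n = l' + a' * x ^ n"
  shows "a = a'"
proof -
  have "(l - l') + (a - a') * x ^ n = 0" using assms by (simp add: algebra_simps)
  then show ?thesis using free[OF span_diff[OF ideal_self assms(1,3)] subring_diff[OF A assms(2,4)]]
    by simp
qed

text \<open>The top exponent \<open>m\<close> of a representation with coefficients in
  \<open>q\<close> is compared with \<open>n\<close>. A smaller one forces \<open>a = 0\<close>, an
  equal one identifies \<open>a\<close> with a coefficient in \<open>q\<close>, and a larger one has
  coefficient \<open>0\<close>, so the representation can be shortened.\<close>

lemma top_coeff_in:
  assumes q: "ideal_in A q" and l: "l \<in> poly_span A x n" and a: "a \<in> A"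
    and "l + a * x ^ n \<in> poly_ext q x"
  shows "a \<in> q"
proof -
  have sub: "poly_span q x k \<subseteq> poly_span A x k" for k
    using span_coeff_mono[OF ideal_in_subset[OF q]] .
  have "a \<in> q" if "l + a * x ^ n \<in> poly_span q x m" for m
    using that
  proof (induction m)
    case 0
    then show ?case using free[OF l a] ideal_in_zero[OF q] by simp
  next
    case (Suc m)
    then obtain k b where k: "l + a * x ^ n = k + b * x ^ m" "k \<in> poly_span q x m" "b \<in> q" by auto
    have bA: "b \<in> A" "k \<in> poly_span A x m" using k ideal_in_subset[OF q] sub by blast+
    consider "m < n" | "m = n" | "n < m" by linarith
    then show ?case
    proof cases
      case 1
      then have "Suc m \<le> n" by simp
      then have "l + a * x ^ n \<in> poly_span A x n"
        using Suc.prems span_mono[OF ideal_self, of "Suc m" n] sub by blast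
      then have "a = 0" using top_coeff_unique[OF l a, of "l + a * x ^ n" 0] subring_zero[OF A] by simp
      then show ?thesis using ideal_in_zero[OF q] by simp
    next
      case 2
      then show ?thesis using top_coeff_unique[OF l a, of k b] k bA by simp
    next
      case 3
      have "l + a * x ^ n \<in> poly_span A x (Suc n)" using l a by auto
      then have "l + a * x ^ n \<in> poly_span A x m" using span_mono[OF ideal_self, of "Suc n" m] 3 by auto
      moreover have "k + b * x ^ m = (l + a * x ^ n) + 0 * x ^ m" unfolding k(1) by simp
      ultimately have "b = 0" using top_coeff_unique[OF bA(2,1) _ subring_zero[OF A]] by blast
      then show ?thesis using k Suc.IH by simp
    qed
  qed
  then show ?thesis using assms(4) by (auto simp: poly_ext_def)
qed

lemma const_in:
  assumes q: "ideal_in A q" and "a \<in> A" "a \<in> poly_ext q x"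
  shows "a \<in> q"
  using top_coeff_in[OF q, of 0 0 a] assms by simp

text \<open>Terms whose coefficient lies in \<open>q\<close> are discarded from the top until one
  does not; what remains shows the degree and the leading coefficient of \<open>g\<close> over
  \<open>A / q\<close>.\<close>

lemma top_coeff_exists:
  assumes q: "ideal_in A q" and "g \<in> poly_span A x n" "g \<notin> poly_ext q x"
  obtains m a l where "m < n" "a \<in> A - q" "l \<in> poly_span A x m" "g - (l + a * x ^ m) \<in> poly_ext q x"
proof -
  have "\<exists>m a l. m < n \<and> a \<in> A - q \<and> l \<in> poly_span A x m \<and> g - (l + a * x ^ m) \<in> poly_ext q x"
    using assms(2,3)
  proof (induction n arbitrary: g)
    case 0
    then show ?case using ideal_in_zero[OF ext_ideal[OF q]] by simp
  next
    case (Suc n)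
    then obtain l a where l: "g = l + a * x ^ n" "l \<in> poly_span A x n" "a \<in> A" by auto
    show ?case
    proof (cases "a \<in> q")
      case False
      then show ?thesis using l ideal_in_zero[OF ext_ideal[OF q]] by (intro exI[of _ n] exI[of _ a] exI[of _ l]) auto
    next
      case True
      then have t: "a * x ^ n \<in> poly_ext q x" using span_monom[OF True q] span_subset_ext by blast
      then have "l \<notin> poly_ext q x" using ideal_in_add[OF ext_ideal[OF q], of l "a * x ^ n"] Suc.prems l(1) by blast
      then obtain m a' l' where m: "m < n" "a' \<in> A - q" "l' \<in> poly_span A x m" "l - (l' + a' * x ^ m) \<in> poly_ext q x"
        using Suc.IH[OF l(2)] by blast
      have "g - (l' + a' * x ^ m) = (l - (l' + a' * x ^ m)) + a * x ^ n" using l(1) by (simp add: algebra_simps)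
      then have "g - (l' + a' * x ^ m) \<in> poly_ext q x"
        using ideal_in_add[OF ext_ideal[OF q] m(4) t] by metis
      then show ?thesis using m by (metis less_SucI)
    qed
  qed
  then show thesis using that by blast
qed

lemma top_mult:
  assumes "l \<in> poly_span A x m" "a \<in> A" "k \<in> poly_span A x n" "b \<in> A"
  obtains r where "r \<in> poly_span A x (m + n)" "(l + a * x ^ m) * (k + b * x ^ n) = r + (a * b) * x ^ (m + n)"
proof
  have "b * (x ^ n * l) \<in> poly_span A x (n + m)"
    using assms by (intro span_scale span_shift ideal_self)
  then show "l * k + a * (x ^ m * k) + b * (x ^ n * l) \<in> poly_span A x (m + n)"
    using assms span_mult[OF ideal_self assms(1,3)] span_shift[OF ideal_self assms(3), of m]
    by (auto simp: add.commute intro!: span_add span_scale ideal_self)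
  show "(l + a * x ^ m) * (k + b * x ^ n) = l * k + a * (x ^ m * k) + b * (x ^ n * l) + (a * b) * x ^ (m + n)"
    by (simp add: algebra_simps power_add)
qed

text \<open>Leading coefficients multiply over the domain \<open>A / q\<close>, so degrees add
  modulo \<open>q[x]\<close>. This carries both Gauss' lemma \<open>ext_prime\<close> and the degree
  argument in \<open>larger_prime\<close>.\<close>

lemma top_mult_notin:
  assumes q: "prime_in A q"
    and l: "l \<in> poly_span A x m" "a \<in> A - q" and k: "k \<in> poly_span A x n" "b \<in> A - q"
    and y: "y - (l + a * x ^ m) \<in> poly_ext q x" and z: "z - (k + b * x ^ n) \<in> poly_ext q x"
    and B: "y \<in> B" "z \<in> B"
  obtains r c where "c \<in> A - q" "r \<in> poly_span A x (m + n)"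
    "y * z - (r + c * x ^ (m + n)) \<in> poly_ext q x"
proof -
  note qi = prime_in_ideal[OF q]
  obtain r where r: "r \<in> poly_span A x (m + n)"
    "(l + a * x ^ m) * (k + b * x ^ n) = r + (a * b) * x ^ (m + n)"
    using top_mult[of l m a k n b] l k by blast
  have lB: "l + a * x ^ m \<in> B"
    using l span_subset_ext[of A "Suc m"] by auto
  have "y * z - (r + (a * b) * x ^ (m + n)) = z * (y - (l + a * x ^ m)) + (l + a * x ^ m) * (z - (k + b * x ^ n))"
    unfolding r(2)[symmetric] by (simp add: algebra_simps)
  also have "\<dots> \<in> poly_ext q x"
    by (intro ideal_in_add[OF ext_ideal[OF qi]] ideal_in_mult[OF ext_ideal[OF qi]] B y z lB)
  finally show thesis
    using that[of "a * b" r] r(1) l k prime_in_complement_mult[OF q A] by blast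
qed

lemma ext_prime:
  assumes q: "prime_in A q"
  shows "prime_in B (poly_ext q x)"
  unfolding prime_in_def
proof (intro conjI ballI impI)
  note qi = prime_in_ideal[OF q]
  show "ideal_in B (poly_ext q x)" by (rule ext_ideal[OF qi])
  show "1 \<notin> poly_ext q x" using const_in[OF qi subring_one[OF A]] prime_in_one[OF q] by blast
  fix y z assume yz: "y \<in> B" "z \<in> B" "y * z \<in> poly_ext q x"
  show "y \<in> poly_ext q x \<or> z \<in> poly_ext q x"
  proof (rule ccontr)
    assume neg: "\<not> ?thesis"
    obtain m a l n b k where *: "a \<in> A - q" "l \<in> poly_span A x m" "y - (l + a * x ^ m) \<in> poly_ext q x"
      "b \<in> A - q" "k \<in> poly_span A x n" "z - (k + b * x ^ n) \<in> poly_ext q x"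
    proof -
      obtain m n where mn: "y \<in> poly_span A x m" "z \<in> poly_span A x n"
        using yz(1,2) by (auto simp: poly_ext_def)
      show ?thesis
        using top_coeff_exists[OF qi mn(1)] top_coeff_exists[OF qi mn(2)] neg that by metis
    qed
    obtain r c where r: "c \<in> A - q" "r \<in> poly_span A x (m + n)"
      "y * z - (r + c * x ^ (m + n)) \<in> poly_ext q x"
      using top_mult_notin[OF q *(2,1,5,4,3,6) yz(1,2)] by blast
    have "r + c * x ^ (m + n) \<in> poly_ext q x"
      using ideal_in_diff_cancel[OF B_subring ext_ideal[OF qi] r(3)] yz(3) by simp
    then show False using top_coeff_in[OF qi r(2)] r(1) by blast
  qed
qed

text \<open>Long division by a divisor whose leading coefficient \<open>c\<close> need not be a
  unit: each cancellation of a top term costs one factor \<open>c\<close>.\<close>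

lemma pseudo_division:
  assumes l': "l' \<in> poly_span A x m" "c \<in> A"
  shows "g \<in> poly_span A x n \<Longrightarrow> m \<le> n \<Longrightarrow>
    \<exists>N h. h \<in> poly_span A x (n - m) \<and> c ^ N * g - (l' + c * x ^ m) * h \<in> poly_span A x m"
proof (induction n arbitrary: g)
  case 0
  then show ?case by (auto intro!: exI[of _ 0])
next
  case (Suc n)
  show ?case
  proof (cases "m = Suc n")
    case True
    then show ?thesis using Suc.prems by (intro exI[of _ 0]) auto
  next
    case False
    then have mn: "m \<le> n" using Suc.prems by simp
    from Suc.prems obtain l a where g: "g = l + a * x ^ n" "l \<in> poly_span A x n" "a \<in> A" by auto
    \<comment> \<open>This is \<open>c * g\<close> minus \<open>a * x ^ (n - m)\<close> times the
      divisor; the terms of degree \<open>n\<close> cancel.\<close>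
    define y where "y = c * l - a * (x ^ (n - m) * l')"
    have "x ^ (n - m) * l' \<in> poly_span A x n" using span_shift[OF ideal_self l'(1), of "n - m"] mn by simp
    then have "y \<in> poly_span A x n"
      unfolding y_def using span_diff[OF ideal_self span_scale[OF ideal_self l'(2) g(2)] span_scale[OF ideal_self g(3)]] by blast
    then obtain N h where h: "h \<in> poly_span A x (n - m)" "c ^ N * y - (l' + c * x ^ m) * h \<in> poly_span A x m"
      using Suc.IH mn by blast
    have xn: "x ^ n = x ^ m * x ^ (n - m)" using mn by (simp flip: power_add)
    have "h + (c ^ N * a) * x ^ (n - m) \<in> poly_span A x (Suc n - m)"
        using span_SucI[OF h(1) subring_mult[OF A subring_power[OF A l'(2)] g(3)]] mn
        by (simp only: Suc_diff_le)
    moreover have "c ^ Suc N * g - (l' + c * x ^ m) * (h + (c ^ N * a) * x ^ (n - m)) = c ^ N * y - (l' + c * x ^ m) * h"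
      unfolding y_def g(1) xn by (simp add: algebra_simps)
    ultimately show ?thesis using h(2) by metis
  qed
qed

text \<open>Peels off top terms: a top coefficient lies in \<open>q\<close> by the assumption on
  degrees below \<open>d\<close>, and since \<open>q \<subseteq> K\<close> the rest stays in
  \<open>K\<close>.\<close>

lemma lower_span_in:
  assumes "\<And>m l a. m < d \<Longrightarrow> l \<in> poly_span A x m \<Longrightarrow> a \<in> A \<Longrightarrow> l + a * x ^ m \<in> K \<Longrightarrow> a \<in> q"
    and K: "ideal_in B K" and q: "q \<subseteq> K"
  shows "n \<le> d \<Longrightarrow> l \<in> poly_span A x n \<Longrightarrow> l \<in> K \<Longrightarrow> l \<in> poly_span q x n"
proof (induction n arbitrary: l)
  case (Suc n)
  then obtain k a where l: "l = k + a * x ^ n" "k \<in> poly_span A x n" "a \<in> A" by auto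
  then have a: "a \<in> q" using assms(1)[of n k a] Suc.prems by auto
  have "x ^ n * a \<in> K"
    using ideal_in_mult[OF K subring_power[OF B_subring x_in_B]] a q by blast
  then have "k \<in> K" using ideal_in_add_cancel[OF B_subring K, of k "a * x ^ n"] l Suc.prems by (simp add: mult.commute)
  then show ?case using Suc l a by auto
qed simp

text \<open>
  If \<open>x\<close> is transcendental modulo \<open>K\<close>, then \<open>K = P[x]\<close> and \<open>q[x]\<close> is the required prime. Otherwise
  choose an algebraic relation \<open>c x\<^sup>d + \<dots> \<in> K\<close> of minimal degree with \<open>c \<notin> P\<close>: after inverting \<open>c\<close>,
  \<open>B / K\<close> is free over \<open>A / P\<close> with basis \<open>1, \<dots>, x\<^sup>d\<^sup>-\<^sup>1\<close>, so \<open>q B + K\<close> contracts to \<open>q\<close>. To avoid \<open>b\<close>,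
  it suffices to avoid an element \<open>e\<close> of \<open>(b B + K) \<inter> A\<close> outside \<open>P\<close>.
\<close>

lemma lift_prime:
  assumes K: "prime_in B K" and b: "b \<in> B - K"
  obtains a where "a \<in> A - K"
    "\<And>q. prime_in A q \<Longrightarrow> K \<inter> A \<subseteq> q \<Longrightarrow> a \<notin> q \<Longrightarrow>
       \<exists>q'. prime_in B q' \<and> K \<subseteq> q' \<and> q' \<inter> A = q \<and> b \<notin> q'"
proof -
  define P where "P = K \<inter> A"
  have P: "prime_in A P" unfolding P_def by (rule prime_in_restrict[OF K A A_subset_B])
  note Pi = prime_in_ideal[OF P] and Ki = prime_in_ideal[OF K]
  have PK: "poly_ext P x \<subseteq> K"
  proof -
    have "poly_span P x n \<subseteq> K" for n
    proof (induction n)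
      case (Suc n)
      have "a * x ^ n \<in> K" if "a \<in> P" for a
        using ideal_in_mult[OF Ki subring_power[OF B_subring x_in_B, of n], of a] that
        by (simp add: P_def mult.commute)
      then show ?case using Suc ideal_in_add[OF Ki] by auto
    qed (use ideal_in_zero[OF Ki] in auto)
    then show ?thesis by (auto simp: poly_ext_def)
  qed
  show thesis
  proof (cases "\<exists>n l a. l \<in> poly_span A x n \<and> a \<in> A - P \<and> l + a * x ^ n \<in> K")
    case False
    have "K \<subseteq> poly_ext P x"
    proof
      fix y assume "y \<in> K"
      then obtain n where y: "y \<in> poly_span A x n" using ideal_in_subset[OF Ki] by (auto simp: poly_ext_def)
      show "y \<in> poly_ext P x"
      proof (rule ccontr)
        assume "y \<notin> poly_ext P x"
        then obtain m a l where "a \<in> A - P" "l \<in> poly_span A x m" "y - (l + a * x ^ m) \<in> poly_ext P x"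
          using top_coeff_exists[OF Pi y] by blast
        then show False using False \<open>y \<in> K\<close> PK ideal_in_diff_cancel[OF B_subring Ki] by blast
      qed
    qed
    then have KP: "K = poly_ext P x" using PK by blast
    obtain n where bn: "b \<in> poly_span A x n" using b by (auto simp: poly_ext_def)
    \<comment> \<open>The leading coefficient \<open>a\<close> of \<open>b\<close> modulo
      \<open>P[x]\<close> is the element to avoid: if \<open>a\<close> is outside \<open>q\<close>,
      then \<open>b\<close> is outside \<open>q[x]\<close>.\<close>
    obtain m a l where a: "a \<in> A - P" "l \<in> poly_span A x m" "b - (l + a * x ^ m) \<in> poly_ext P x"
      using top_coeff_exists[OF Pi bn] b KP by blast
    show thesis
    proof (rule that)
      show "a \<in> A - K" using a by (auto simp: P_def)
      fix q assume q: "prime_in A q" "K \<inter> A \<subseteq> q" "a \<notin> q"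
      note qi = prime_in_ideal[OF q(1)]
      have Pq: "P \<subseteq> q" using q(2) by (simp add: P_def)
      have sub: "poly_ext P x \<subseteq> poly_ext q x" using span_coeff_mono[OF Pq] by (auto simp: poly_ext_def)
      have "b \<notin> poly_ext q x"
      proof
        assume "b \<in> poly_ext q x"
        then have "l + a * x ^ m \<in> poly_ext q x"
          using a(3) sub ideal_in_diff_cancel[OF B_subring ext_ideal[OF qi]] by blast
        then show False using top_coeff_in[OF qi a(2)] a(1) q(3) by blast
      qed
      moreover have "poly_ext q x \<inter> A = q"
        using const_in[OF qi] coeff_in_ext[OF qi] ideal_in_subset[OF qi] by blast
      ultimately show "\<exists>q'. prime_in B q' \<and> K \<subseteq> q' \<and> q' \<inter> A = q \<and> b \<notin> q'"
        using ext_prime[OF q(1)] sub KP by blast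
    qed
  next
    case True
    define d where "d = (LEAST n. \<exists>l a. l \<in> poly_span A x n \<and> a \<in> A - P \<and> l + a * x ^ n \<in> K)"
    have "\<exists>l a. l \<in> poly_span A x d \<and> a \<in> A - P \<and> l + a * x ^ d \<in> K"
      unfolding d_def by (rule LeastI_ex[OF True])
    then obtain l c where c: "l \<in> poly_span A x d" "c \<in> A - P" "l + c * x ^ d \<in> K" by blast
    have dmin: "a \<in> P" if "n < d" "l \<in> poly_span A x n" "a \<in> A" "l + a * x ^ n \<in> K" for n l a
      using not_less_Least[of n "\<lambda>n. \<exists>l a. l \<in> poly_span A x n \<and> a \<in> A - P \<and> l + a * x ^ n \<in> K"] that
      unfolding d_def by blast
    have "P \<subseteq> K" by (simp add: P_def)
    have Kd: "k \<in> poly_span P x n" if "n \<le> d" "k \<in> poly_span A x n" "k \<in> K" for n k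
      by (rule lower_span_in[of d K P, OF _ Ki \<open>P \<subseteq> K\<close> that]) (rule dmin)
    \<comment> \<open>Needed later so that an element of \<open>A\<close> counts as a polynomial of
      degree below \<open>d\<close>.\<close>
    have d0: "d \<noteq> 0"
    proof
      assume "d = 0"
      then show False using c by (simp add: P_def)
    qed
    have c': "c \<in> A" "c \<notin> K" using c by (auto simp: P_def)
    \<comment> \<open>Pseudo-division by the minimal relation: up to a power of \<open>c\<close>,
      every element of \<open>B\<close> has degree below \<open>d\<close> modulo
      \<open>K\<close>.\<close>
    have red: "\<exists>N s. s \<in> poly_span A x d \<and> c ^ N * g - s \<in> K" if "g \<in> B" for g
    proof -
      from that obtain n where "g \<in> poly_span A x n" by (auto simp: poly_ext_def)
      then have "g \<in> poly_span A x (n + d)" using span_mono[OF ideal_self, of n "n + d"] by auto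
      then obtain N h where h: "h \<in> poly_span A x (n + d - d)" "c ^ N * g - (l + c * x ^ d) * h \<in> poly_span A x d"
        using pseudo_division[OF c(1) c'(1), of g "n + d"] by auto
      have "(l + c * x ^ d) * h \<in> K"
        using ideal_in_mult[OF Ki _ c(3), of h] h span_subset_ext by (metis mult.commute subsetD)
      then show ?thesis using h(2) by (intro exI[of _ N] exI[of _ "c ^ N * g - (l + c * x ^ d) * h"]) auto
    qed
    \<comment> \<open>A multiple of \<open>b\<close> that is nonzero in the domain
      \<open>B / K\<close> has to be found in the image of \<open>A\<close>. The candidate is an
      element of least degree in \<open>I' = K + b B\<close> with leading coefficient outside
      \<open>P\<close>; this degree turns out to be \<open>0\<close>.\<close>
    have "\<exists>e\<in>A - P. \<exists>y\<in>B. e - b * y \<in> K"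
    proof -
      define I' where "I' = {i + j | i j. i \<in> K \<and> j \<in> {b * y | y. y \<in> B}}"
      have I'i: "ideal_in B I'"
        unfolding I'_def using b by (intro ideal_in_sum[OF Ki ideal_in_principal[OF B_subring]] B_subring) auto
      have bB: "b \<in> B" using b by blast
      note up = ideal_in_sum_upper[OF Ki ideal_in_principal[OF B_subring bB], folded I'_def]
      have KI: "K \<subseteq> I'" and bI: "b \<in> I'" using up principal_self[OF B_subring] by blast+
      obtain N s where s: "s \<in> poly_span A x d" "c ^ N * b - s \<in> K" using red b by blast
      have cB: "c ^ N \<in> B" using subring_power[OF B_subring] c' A_subset_B by blast
      have "c ^ N \<notin> K" using prime_in_power[OF K B_subring] c' A_subset_B by blast
      then have "c ^ N * b \<notin> K" using prime_in_mult[OF K cB] b by blast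
      then have sK: "s \<notin> K" using ideal_in_diff_cancel[OF B_subring Ki s(2)] by blast
      have "c ^ N * b \<in> I'" using ideal_in_mult[OF I'i cB bI] .
      then have sI: "s \<in> I'" using ideal_in_diff_cancel[OF B_subring I'i, of "c ^ N * b" s] s(2) KI by blast
      obtain m0 a0 l0 where m0: "m0 < d" "a0 \<in> A - P" "l0 \<in> poly_span A x m0" "s - (l0 + a0 * x ^ m0) \<in> poly_ext P x"
        using top_coeff_exists[OF Pi s(1)] sK PK by blast
      have "l0 + a0 * x ^ m0 \<in> I'"
        using ideal_in_diff_cancel[OF B_subring I'i, of s] m0(4) PK KI sI by blast
      then have ex: "\<exists>l a. l \<in> poly_span A x m0 \<and> a \<in> A - P \<and> l + a * x ^ m0 \<in> I'" using m0 by blast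
      define m where "m = (LEAST n. \<exists>l a. l \<in> poly_span A x n \<and> a \<in> A - P \<and> l + a * x ^ n \<in> I')"
      have "\<exists>l a. l \<in> poly_span A x m \<and> a \<in> A - P \<and> l + a * x ^ m \<in> I'"
        unfolding m_def by (rule LeastI[where k = m0 and P = "\<lambda>n. \<exists>l a. l \<in> poly_span A x n \<and> a \<in> A - P \<and> l + a * x ^ n \<in> I'", OF ex])
      then obtain r' e where e: "r' \<in> poly_span A x m" "e \<in> A - P" "r' + e * x ^ m \<in> I'" by blast
      have md: "m < d" using Least_le[where k = m0 and P = "\<lambda>n. \<exists>l a. l \<in> poly_span A x n \<and> a \<in> A - P \<and> l + a * x ^ n \<in> I'", OF ex] m0(1) unfolding m_def by simp
      have mmin: "a \<in> P" if "n < m" "l \<in> poly_span A x n" "a \<in> A" "l + a * x ^ n \<in> I'" for n l a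
        using not_less_Least[of n "\<lambda>n. \<exists>l a. l \<in> poly_span A x n \<and> a \<in> A - P \<and> l + a * x ^ n \<in> I'"] that
        unfolding m_def by blast
      have PI: "P \<subseteq> I'" using \<open>P \<subseteq> K\<close> KI by blast
      have Im: "k \<in> poly_span P x n" if "n \<le> m" "k \<in> poly_span A x n" "k \<in> I'" for n k
        by (rule lower_span_in[of m I' P, OF _ I'i PI that]) (rule mmin)
      \<comment> \<open>Otherwise the relation \<open>l + c * x ^ d\<close> is divided by
        \<open>r\<close>. The remainder lies in \<open>I'\<close> below degree \<open>m\<close>,
        hence in \<open>P[x]\<close>, so \<open>r * h \<in> K\<close> and \<open>h \<in> K\<close>.
        As \<open>m > 0\<close>, \<open>h\<close> has degree below \<open>d\<close> and lies in
        \<open>P[x]\<close> too. Then so does \<open>e ^ N\<close> times the relation, although its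
        leading coefficient \<open>e ^ N * c\<close> is outside \<open>P\<close>.\<close>
      have "m = 0"
      proof (rule ccontr)
        assume "m \<noteq> 0"
        define r where "r = r' + e * x ^ m"
        have rB: "r \<in> B" using ideal_in_subset[OF I'i] e unfolding r_def by blast
        have rK: "r \<notin> K" using dmin[OF md e(1)] e unfolding r_def by blast
        have f: "l + c * x ^ d \<in> poly_span A x (Suc d)" using c c' by auto
        obtain N h where h: "h \<in> poly_span A x (Suc d - m)" "e ^ N * (l + c * x ^ d) - r * h \<in> poly_span A x m"
          using pseudo_division[OF e(1) _ f, of e] e(2) md unfolding r_def by auto
        have hB: "h \<in> B" using h span_subset_ext by blast
        have eA: "e ^ N \<in> A" using subring_power[OF A] e by blast
        have eB: "e ^ N \<in> B" using eA A_subset_B by blast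
        have ef: "e ^ N * (l + c * x ^ d) \<in> K" using ideal_in_mult[OF Ki eB c(3)] .
        have "h * r \<in> I'" using ideal_in_mult[OF I'i hB e(3)] unfolding r_def .
        then have "e ^ N * (l + c * x ^ d) - r * h \<in> I'"
          using ideal_in_diff[OF B_subring I'i] ef KI by (simp add: mult.commute subsetD)
        then have s1: "e ^ N * (l + c * x ^ d) - r * h \<in> poly_ext P x"
          using Im[OF order_refl h(2)] span_subset_ext by blast
        then have "r * h \<in> K" using ideal_in_diff_cancel[OF B_subring Ki] PK ef by blast
        then have hK: "h \<in> K" using prime_in_mult[OF K rB hB] rK by blast
        have "h \<in> poly_span A x d" using h(1) span_mono[OF ideal_self, of "Suc d - m" d] \<open>m \<noteq> 0\<close> by (cases m) auto
        then have "h \<in> poly_ext P x" using Kd[OF order_refl _ hK] span_subset_ext by blast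
        then have "r * h \<in> poly_ext P x" using ideal_in_mult[OF ext_ideal[OF Pi] rB] by blast
        then have "e ^ N * l + (e ^ N * c) * x ^ d \<in> poly_ext P x"
          using ideal_in_diff_cancel[OF B_subring ext_ideal[OF Pi] s1] by (simp add: algebra_simps)
        then have "e ^ N * c \<in> P"
          using top_coeff_in[OF Pi span_scale[OF ideal_self eA c(1)] subring_mult[OF A eA c'(1)]] by blast
        then show False using prime_in_mult[OF P eA c'(1)] c e prime_in_power[OF P A, of e N] by blast
      qed
      then have "e \<in> I'" "e \<in> A - P" using e by auto
      then obtain i y where y: "e = i + b * y" "i \<in> K" "y \<in> B" unfolding I'_def by blast
      then have "e - b * y \<in> K" by simp
      then show ?thesis using y \<open>e \<in> A - P\<close> by blast
    qed
    then obtain e y where e: "e \<in> A - P" "y \<in> B" "e - b * y \<in> K" by blast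
    show thesis
    proof (rule that)
      \<comment> \<open>A prime that avoids \<open>c * e\<close> avoids both factors:
        \<open>c\<close> so that powers of \<open>c\<close> can be cancelled after a reduction
        modulo \<open>K\<close>, and \<open>e\<close>, a multiple of \<open>b\<close> modulo
        \<open>K\<close>, so that \<open>b\<close> is kept out.\<close>
      show "c * e \<in> A - K"
        using prime_in_complement_mult(2)[OF P A, of c e] c e by (auto simp: P_def)
      fix q assume q: "prime_in A q" "K \<inter> A \<subseteq> q" "c * e \<notin> q"
      note qi = prime_in_ideal[OF q(1)]
      have cq: "c \<notin> q" "e \<notin> q"
        using q(3) ideal_in_mult[OF qi, of e c] ideal_in_mult[OF qi, of c e] c'(1) e(1)
        by (auto simp: mult.commute)
      have Pq: "P \<subseteq> q" using q(2) by (simp add: P_def)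
      let ?I = "{i + j | i j. i \<in> poly_ext q x \<and> j \<in> K}"
      have Ii: "ideal_in B ?I" by (rule ideal_in_sum[OF ext_ideal[OF qi] Ki B_subring])
      \<comment> \<open>Suppose \<open>t = i + k\<close> lies in \<open>A\<close>. Up to a power of
        \<open>c\<close>, \<open>i\<close> reduces to some \<open>s\<close> of degree below
        \<open>d\<close> with coefficients in \<open>q\<close>. Then \<open>c ^ N * t - s\<close> is
        an element of \<open>K\<close> of degree below \<open>d\<close>, so its coefficients lie in
        \<open>P \<subseteq> q\<close>, and the constant \<open>c ^ N * t\<close> lies in
        \<open>q\<close>.\<close>
      have Iq: "?I \<inter> (A - q) = {}"
      proof (rule ccontr)
        assume "\<not> ?thesis"
        then obtain t i k where t: "t \<in> A" "t \<notin> q" "t = i + k" "i \<in> poly_ext q x" "k \<in> K" by blast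
        then obtain n where i: "i \<in> poly_span q x n" by (auto simp: poly_ext_def)
        \<comment> \<open>Only the powers \<open>x ^ n\<close> are reduced, by \<open>red\<close>;
          multiplying the result by a coefficient in \<open>q\<close> brings all its coefficients
          into \<open>q\<close>.\<close>
        have "\<exists>N s. s \<in> poly_span q x d \<and> c ^ N * i - s \<in> K" using i
        proof (induction n arbitrary: i)
          case 0
          then show ?case using span_zero[OF qi] ideal_in_zero[OF Ki] by (intro exI[of _ 0] exI[of _ 0]) auto
        next
          case (Suc n)
          then obtain i' a where i': "i = i' + a * x ^ n" "i' \<in> poly_span q x n" "a \<in> q" by auto
          then obtain N s where N: "s \<in> poly_span q x d" "c ^ N * i' - s \<in> K" using Suc.IH by blast
          have "x ^ n \<in> B" using subring_power[OF B_subring x_in_B] .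
          then obtain M u where M: "u \<in> poly_span A x d" "c ^ M * x ^ n - u \<in> K" using red by blast
          have aA: "a \<in> A" using i' ideal_in_subset[OF qi] by blast
          have au: "a * u \<in> poly_span q x d" using M(1)
          proof (induction d arbitrary: u)
            case (Suc d)
            then obtain u' v where "u = u' + v * x ^ d" "u' \<in> poly_span A x d" "v \<in> A" by auto
            moreover from this have "a * u = a * u' + (v * a) * x ^ d" by (simp add: algebra_simps)
            ultimately show ?case using Suc.IH ideal_in_mult[OF qi _ i'(3)] by auto
          qed simp
          have cA: "c ^ k \<in> A" for k using subring_power[OF A c'(1)] .
          have cB: "c ^ k \<in> B" for k using cA A_subset_B by blast
          have "c ^ M * s + c ^ N * (a * u) \<in> poly_span q x d"
            by (intro span_add[OF qi] span_scale[OF qi] cA N au)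
          moreover have "c ^ (N + M) * i - (c ^ M * s + c ^ N * (a * u))
              = c ^ M * (c ^ N * i' - s) + (c ^ N * a) * (c ^ M * x ^ n - u)"
            unfolding i'(1) by (simp add: algebra_simps power_add)
          moreover have "\<dots> \<in> K"
            using cB A_subset_B aA N M
            by (intro ideal_in_add[OF Ki] ideal_in_mult[OF Ki] subring_mult[OF B_subring]) auto
          ultimately show ?case by metis
        qed
        then obtain N s where N: "s \<in> poly_span q x d" "c ^ N * i - s \<in> K" by blast
        have cA: "c ^ N \<in> A" using subring_power[OF A c'(1)] .
        have ctA: "c ^ N * t \<in> A" using subring_mult[OF A cA t(1)] .
        have "c ^ N * t - s = (c ^ N * i - s) + c ^ N * k" unfolding t(3) by (simp add: algebra_simps)
        also have "\<dots> \<in> K" using N t(5) cA A_subset_B by (intro ideal_in_add[OF Ki] ideal_in_mult[OF Ki]) auto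
        finally have ctK: "c ^ N * t - s \<in> K" .
        have "c ^ N * t \<in> poly_span A x d" using span_const[OF ctA] d0 by blast
        moreover have "s \<in> poly_span A x d" using N span_coeff_mono[OF ideal_in_subset[OF qi]] by blast
        ultimately have "c ^ N * t - s \<in> poly_span A x d" using span_diff[OF ideal_self] by blast
        then have "c ^ N * t - s \<in> poly_span P x d" using Kd[OF order_refl _ ctK] by blast
        then have "c ^ N * t - s \<in> poly_span q x d" using span_coeff_mono[OF Pq] by blast
        then have "c ^ N * t \<in> poly_ext q x" using span_add[OF qi _ N(1)] span_subset_ext by force
        then have "c ^ N * t \<in> q" using const_in[OF qi ctA] by blast
        then show False using prime_in_mult[OF q(1) cA t(1)] t(2) prime_in_power[OF q(1) A c'(1)] cq by blast
      qed
      obtain q' where q': "prime_in B q'" "?I \<subseteq> q'" "q' \<inter> (A - q) = {}"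
      proof (rule exists_prime_in[OF B_subring Ii, of "A - q"])
        show "1 \<in> A - q" by (rule prime_in_complement_mult(1)[OF q(1) A])
        show "A - q \<subseteq> B" using A_subset_B by blast
        show "s * t \<in> A - q" if "s \<in> A - q" "t \<in> A - q" for s t
          by (rule prime_in_complement_mult(2)[OF q(1) A that])
        show "?I \<inter> (A - q) = {}" by (rule Iq)
      qed
      note up = ideal_in_sum_upper[OF ext_ideal[OF qi] Ki]
      have Kq': "K \<subseteq> q'" and qq': "q \<subseteq> q'" using up q'(2) coeff_in_ext[OF qi] by blast+
      have "b \<notin> q'"
      proof
        assume "b \<in> q'"
        then have "y * b \<in> q'" using ideal_in_mult[OF prime_in_ideal[OF q'(1)] e(2)] by blast
        then have "e \<in> q'"
          using ideal_in_diff_cancel[OF B_subring prime_in_ideal[OF q'(1)], of e "b * y"] e(3) Kq'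
          by (auto simp: mult.commute)
        then show False using q'(3) e(1) cq by blast
      qed
      moreover have "q' \<inter> A = q" using q'(3) qq' ideal_in_subset[OF qi] by blast
      ultimately show "\<exists>q'. prime_in B q' \<and> K \<subseteq> q' \<and> q' \<inter> A = q \<and> b \<notin> q'"
        using q'(1) Kq' by blast
    qed
  qed
qed

text \<open>
  A prime containing \<open>z = 1 + x b\<close> and contracting to \<open>P\<close> avoids \<open>b\<close>, because \<open>x b\<close> is a unit
  modulo \<open>z\<close>; degrees in \<open>x\<close> show that \<open>z B\<close> meets \<open>A\<close> only inside \<open>P\<close>.
\<close>

lemma larger_prime:
  assumes P: "prime_in A P" and b: "b \<in> B" "b \<notin> poly_ext P x"
  obtains q where "prime_in B q" "poly_ext P x \<subset> q" "q \<inter> A = P" "b \<notin> q"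
proof -
  note Pi = prime_in_ideal[OF P]
  note PE = ext_prime[OF P] and PEi = ext_ideal[OF Pi]
  define z where "z = 1 + x * b"
  have zB: "z \<in> B"
    unfolding z_def by (intro subring_add[OF B_subring] subring_mult[OF B_subring] subring_one[OF B_subring] x_in_B b)
  obtain n where bn: "b \<in> poly_span A x n" using b by (auto simp: poly_ext_def)
  obtain i \<beta> l where be: "\<beta> \<in> A - P" "l \<in> poly_span A x i" "b - (l + \<beta> * x ^ i) \<in> poly_ext P x"
    using top_coeff_exists[OF Pi bn b(2)] by blast
  have zl: "1 + x * l \<in> poly_span A x (Suc i)"
  proof -
    show ?thesis
      by (rule span_add[OF ideal_self span_const[OF subring_one[OF A]] span_shift1[OF be(2) ideal_self]]) simp
  qed
  have zt: "z - ((1 + x * l) + \<beta> * x ^ Suc i) \<in> poly_ext P x"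
    using ideal_in_mult[OF PEi x_in_B be(3)] by (simp add: z_def algebra_simps)
  have noc: "t \<in> P" if tA: "t \<in> A" and tz: "t - z * h \<in> poly_ext P x" and hB: "h \<in> B" for t h
  proof (cases "h \<in> poly_ext P x")
    case True
    then have "z * h \<in> poly_ext P x" using ideal_in_mult[OF PEi zB] by blast
    then have "t \<in> poly_ext P x" using ideal_in_diff_cancel[OF B_subring PEi tz] by blast
    then show ?thesis using const_in[OF Pi tA] by blast
  next
    case False
    obtain k where k: "h \<in> poly_span A x k" using \<open>h \<in> B\<close> by (auto simp: poly_ext_def)
    obtain j \<gamma> r where ga: "\<gamma> \<in> A - P" "r \<in> poly_span A x j" "h - (r + \<gamma> * x ^ j) \<in> poly_ext P x"
      using top_coeff_exists[OF Pi k False] by blast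
    obtain s c where s: "c \<in> A - P" "s \<in> poly_span A x (Suc i + j)" "z * h - (s + c * x ^ (Suc i + j)) \<in> poly_ext P x"
      using top_mult_notin[OF P zl be(1) ga(2,1) zt ga(3) zB hB] by blast
    have "s - t \<in> poly_span A x (Suc i + j)"
      by (rule span_diff[OF ideal_self s(2) span_const[OF tA]]) simp
    moreover have "(s - t) + c * x ^ (Suc i + j) \<in> poly_ext P x"
      using ideal_in_uminus[OF B_subring PEi ideal_in_add[OF PEi tz s(3)]] by (simp add: algebra_simps)
    ultimately have "c \<in> P" using top_coeff_in[OF Pi] s(1) by blast
    then show ?thesis using s(1) by blast
  qed
  let ?I = "{i + j | i j. i \<in> poly_ext P x \<and> j \<in> {z * y | y. y \<in> B}}"
  \<comment> \<open>Powers of \<open>b\<close> are included besides \<open>A - P\<close>, so that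
    one application of \<open>exists_prime_in\<close> controls both the contraction and
    \<open>b\<close>.\<close>
  let ?M = "{t * b ^ k | t k. t \<in> A - P}"
  have Ii: "ideal_in B ?I" by (rule ideal_in_sum[OF PEi ideal_in_principal[OF B_subring zB] B_subring])
  have "1 = 1 * b ^ 0" by simp
  then have M1: "1 \<in> ?M" using prime_in_complement_mult(1)[OF P A] by blast
  have MB: "?M \<subseteq> B" using A_subset_B subring_mult[OF B_subring] subring_power[OF B_subring b(1)] by blast
  have MM: "s * t \<in> ?M" if "s \<in> ?M" "t \<in> ?M" for s t
  proof -
    from that obtain s' k t' k' where "s = s' * b ^ k" "t = t' * b ^ k'" "s' \<in> A - P" "t' \<in> A - P" by blast
    moreover from this have "s * t = (s' * t') * b ^ (k + k')" by (simp add: algebra_simps power_add)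
    ultimately show ?thesis using prime_in_complement_mult(2)[OF P A] by blast
  qed
  have IM: "?I \<inter> ?M = {}"
  proof (rule ccontr)
    assume "\<not> ?thesis"
    then obtain e where e: "e \<in> ?I" "e \<in> ?M" by blast
    obtain t k where "t \<in> A" "t \<notin> P" "e = t * b ^ k" using e(2) by blast
    moreover obtain i y where "e = i + z * y" "i \<in> poly_ext P x" "y \<in> B" using e(1) by blast
    ultimately obtain t k i y where t: "t \<in> A" "t \<notin> P" "t * b ^ k = i + z * y" "i \<in> poly_ext P x" "y \<in> B" by blast
    \<comment> \<open>\<open>- (x * b)\<close> is \<open>1 - z\<close>, hence \<open>1\<close>
      modulo \<open>z\<close>. Multiplying \<open>t * b ^ k\<close> by \<open>(- x) ^ k\<close>
      therefore gives \<open>t\<close> modulo \<open>z\<close>, and \<open>noc\<close> puts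
      \<open>t\<close> into \<open>P\<close>.\<close>
    have "\<exists>w\<in>B. (- (x * b)) ^ k = 1 + z * w"
    proof (induction k)
      case 0
      then show ?case using subring_zero[OF B_subring] by (intro bexI[of _ 0]) auto
    next
      case (Suc k)
      then obtain w where w: "w \<in> B" "(- (x * b)) ^ k = 1 + z * w" by blast
      have "(- (x * b)) ^ Suc k = (1 + z * w) * (1 - z)" using w by (simp add: z_def)
      also have "\<dots> = 1 + z * (w - 1 - z * w)" by (simp add: algebra_simps)
      finally have "(- (x * b)) ^ Suc k = 1 + z * (w - 1 - z * w)" .
      moreover have "w - 1 - z * w \<in> B"
        by (intro subring_diff[OF B_subring] subring_mult[OF B_subring] subring_one[OF B_subring] w zB)
      ultimately show ?case by blast
    qed
    then obtain w where w: "w \<in> B" "(- (x * b)) ^ k = 1 + z * w" by blast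
    have xk: "(- x) ^ k \<in> B" using subring_power[OF B_subring] subring_uminus[OF B_subring x_in_B] by blast
    have "(- (x * b)) ^ k = (- x) ^ k * b ^ k" by (simp flip: power_mult_distrib)
    then have "t + z * (t * w) = (- x) ^ k * (i + z * y)"
      using w(2) t(3)[symmetric] by (simp add: algebra_simps)
    then have "t - z * ((- x) ^ k * y - t * w) = (- x) ^ k * i" by (simp add: algebra_simps)
    also have "\<dots> \<in> poly_ext P x" using ideal_in_mult[OF PEi xk t(4)] .
    finally have "t - z * ((- x) ^ k * y - t * w) \<in> poly_ext P x" .
    moreover have "(- x) ^ k * y - t * w \<in> B"
      using t(1) A_subset_B by (intro subring_diff[OF B_subring] subring_mult[OF B_subring] xk t(5) w(1)) blast
    ultimately show False using noc[OF t(1)] t(2) by blast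
  qed
  obtain q where q: "prime_in B q" "?I \<subseteq> q" "q \<inter> ?M = {}"
    by (rule exists_prime_in[OF B_subring Ii M1 MB MM IM])
  note up = ideal_in_sum_upper[OF PEi ideal_in_principal[OF B_subring zB]]
  have sub: "poly_ext P x \<subseteq> q" by (rule order_trans[OF up(1) q(2)])
  have zq: "z \<in> q" by (rule subsetD[OF order_trans[OF up(2) q(2)] principal_self[OF B_subring]])
  have zP: "z \<notin> poly_ext P x"
  proof
    assume "z \<in> poly_ext P x"
    then have "(1 + x * l) + \<beta> * x ^ Suc i \<in> poly_ext P x"
      using ideal_in_diff_cancel[OF B_subring PEi zt] by blast
    then show False using top_coeff_in[OF Pi zl] be(1) by blast
  qed
  have "t \<in> ?M" if "t \<in> A - P" for t
  proof -
    have "t = t * b ^ 0" by simp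
    then show ?thesis using that by blast
  qed
  then have qA: "q \<inter> A = P" using q(3) sub coeff_in_ext[OF Pi] ideal_in_subset[OF Pi] by blast
  have "b = 1 * b ^ 1" by simp
  then have "b \<in> ?M" using prime_in_complement_mult(1)[OF P A] by blast
  then have "b \<notin> q" using q(3) by blast
  then show thesis using that[OF q(1)] sub zq zP qA by blast
qed

end

section \<open>Multivariate polynomial rings and localizations\<close>

lemma finite_submultisets [simp]: "finite {k. k \<subseteq># m}"
proof (induction m)
  case (add x m)
  have "{k. k \<subseteq># add_mset x m} \<subseteq> {k. k \<subseteq># m} \<union> add_mset x ` {k. k \<subseteq># m}"
  proof
    fix k assume "k \<in> {k. k \<subseteq># add_mset x m}"
    then have k: "k \<subseteq># add_mset x m" by simp
    show "k \<in> {k. k \<subseteq># m} \<union> add_mset x ` {k. k \<subseteq># m}"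
    proof (cases "x \<in># k")
      case True
      then obtain l where "k = add_mset x l" by (meson multi_member_split)
      then show ?thesis using k by auto
    next
      case False
      then have "k \<subseteq># m" using k
        by (metis diff_single_trivial subset_eq_diff_conv add_mset_add_single)
      then show ?thesis by simp
    qed
  qed
  then show ?case using add finite_subset by blast
qed simp

section \<open>Convolution and the ring axioms\<close>

context cring
begin

lemma finsum_Sigma:
  assumes "finite S" "\<And>s. s \<in> S \<Longrightarrow> finite (T s)"
    and "\<And>s t. s \<in> S \<Longrightarrow> t \<in> T s \<Longrightarrow> f s t \<in> carrier R"
  shows "finsum R (\<lambda>s. finsum R (f s) (T s)) S = finsum R (\<lambda>(s, t). f s t) (Sigma S T)"
  using assms
proof (induction S rule: finite_induct)
  case (insert s S)
  have eq: "Sigma (insert s S) T = Pair s ` T s \<union> Sigma S T" by auto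
  have "finsum R (\<lambda>(s, t). f s t) (Sigma (insert s S) T)
      = finsum R (\<lambda>(s, t). f s t) (Pair s ` T s) \<oplus> finsum R (\<lambda>(s, t). f s t) (Sigma S T)"
    unfolding eq using insert by (intro finsum_Un_disjoint) auto
  also have "finsum R (\<lambda>(s, t). f s t) (Pair s ` T s) = finsum R (f s) (T s)"
    using insert by (subst finsum_reindex) (auto intro: inj_onI)
  finally show ?case using insert by (subst finsum_insert) auto
qed simp

lemma finsum_single:
  assumes "finite S" "i \<in> S" "f i \<in> carrier R" "\<And>j. j \<in> S \<Longrightarrow> j \<noteq> i \<Longrightarrow> f j = \<zero>"
  shows "finsum R f S = f i"
proof -
  have "finsum R f (insert i (S - {i})) = f i \<oplus> finsum R f (S - {i})"
    using assms by (intro finsum_insert) (auto simp: Pi_iff)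
  moreover have "finsum R f (S - {i}) = \<zero>"
    using assms(4) by (intro add.finprod_one_eqI) auto
  ultimately show ?thesis using assms(2,3) by (simp add: insert_absorb)
qed

abbreviation conv :: "('v multiset \<Rightarrow> 'a) \<Rightarrow> ('v multiset \<Rightarrow> 'a) \<Rightarrow> 'v multiset \<Rightarrow> 'a" where
  "conv f g \<equiv> (\<lambda>m. finsum R (\<lambda>k. f k \<otimes> g (m - k)) {k. k \<subseteq># m})"

lemma conv_comm:
  fixes f g :: "'v multiset \<Rightarrow> 'a"
  assumes "\<And>m. f m \<in> carrier R" "\<And>m. g m \<in> carrier R"
  shows "conv f g = conv g f"
proof
  fix m :: "'v multiset"
  have inj: "inj_on (\<lambda>k. m - k) {k. k \<subseteq># m}"
    by (rule inj_onI) (metis diff_diff_cancel mem_Collect_eq subset_mset.diff_diff_right subset_mset.diff_add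
      add_diff_cancel_left' subset_mset.add_diff_inverse)
  have im: "(\<lambda>k. m - k) ` {k. k \<subseteq># m} = {k. k \<subseteq># m}"
  proof
    show "{k. k \<subseteq># m} \<subseteq> (\<lambda>k. m - k) ` {k. k \<subseteq># m}"
    proof
      fix k assume "k \<in> {k. k \<subseteq># m}"
      then have "k = m - (m - k)" "m - k \<subseteq># m"
        by (auto simp: subset_mset.diff_diff_right)
      then show "k \<in> (\<lambda>k. m - k) ` {k. k \<subseteq># m}" by blast
    qed
  qed auto
  have "conv f g m = finsum R (\<lambda>k. f k \<otimes> g (m - k)) ((\<lambda>k. m - k) ` {k. k \<subseteq># m})" by (simp only: im)
  also have "\<dots> = finsum R (\<lambda>k. f (m - k) \<otimes> g (m - (m - k))) {k. k \<subseteq># m}"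
    using assms inj by (subst finsum_reindex) auto
  also have "\<dots> = conv g f m"
    using assms by (intro finsum_cong') (auto simp: m_comm subset_mset.diff_diff_right)
  finally show "conv f g m = conv g f m" .
qed

lemma conv_assoc:
  fixes f g h :: "'v multiset \<Rightarrow> 'a"
  assumes f: "\<And>m. f m \<in> carrier R" and g: "\<And>m. g m \<in> carrier R" and h: "\<And>m. h m \<in> carrier R"
  shows "conv (conv f g) h = conv f (conv g h)"
proof
  fix m :: "'v multiset"
  let ?S = "SIGMA k:{k. k \<subseteq># m}. {l. l \<subseteq># k}" and ?T = "SIGMA l:{l. l \<subseteq># m}. {j. j \<subseteq># m - l}"
  have "conv (conv f g) h m = finsum R (\<lambda>k. finsum R (\<lambda>l. f l \<otimes> g (k - l) \<otimes> h (m - k)) {l. l \<subseteq># k}) {k. k \<subseteq># m}"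
    using f g h by (intro finsum_cong' finsum_ldistr) auto
  also have "\<dots> = finsum R (\<lambda>(k, l). f l \<otimes> g (k - l) \<otimes> h (m - k)) ?S"
    using f g h by (intro finsum_Sigma) auto
  \<comment> \<open>Both bracketings sum over the ways to write \<open>m\<close> as a sum of three
    monomials; the pair (partial sum, first part) is traded for (first part, second part).\<close>
  also have "?S = (\<lambda>(l, j). (l + j, l)) ` ?T"
  proof
    show "(\<lambda>(l, j). (l + j, l)) ` ?T \<subseteq> ?S"
      by (auto simp: subset_mset.le_diff_conv2 add.commute)
    show "?S \<subseteq> (\<lambda>(l, j). (l + j, l)) ` ?T"
    proof
      fix z assume "z \<in> ?S"
      then obtain k l where z: "z = (k, l)" "k \<subseteq># m" "l \<subseteq># k" by auto
      then have "l \<subseteq># m" by (blast intro: subset_mset.order_trans)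
      then have "k - l \<subseteq># m - l" using z by (simp add: subset_eq_diff_conv subset_mset.diff_add)
      then have "z = (\<lambda>(l, j). (l + j, l)) (l, k - l)" "(l, k - l) \<in> ?T"
        using z \<open>l \<subseteq># m\<close> by auto
      then show "z \<in> (\<lambda>(l, j). (l + j, l)) ` ?T" by blast
    qed
  qed
  also have "finsum R (\<lambda>(k, l). f l \<otimes> g (k - l) \<otimes> h (m - k)) ((\<lambda>(l, j). (l + j, l)) ` ?T)
      = finsum R (\<lambda>(l, j). f l \<otimes> (g j \<otimes> h (m - l - j))) ?T"
    using f g h
    by (subst finsum_reindex) (auto intro!: inj_onI finsum_cong' simp: m_assoc diff_diff_add)
  also have "\<dots> = finsum R (\<lambda>l. finsum R (\<lambda>j. f l \<otimes> (g j \<otimes> h (m - l - j))) {j. j \<subseteq># m - l}) {l. l \<subseteq># m}"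
    using f g h by (intro finsum_Sigma[symmetric]) auto
  also have "\<dots> = conv f (conv g h) m"
    using f g h by (intro finsum_cong' finsum_rdistr[symmetric]) auto
  finally show "conv (conv f g) h m = conv f (conv g h) m" .
qed

lemma monomial_in_indexed_pset:
  assumes "c \<in> carrier R" "set_mset m \<subseteq> V"
  shows "(\<lambda>k. if k = m then c else \<zero>) \<in> (carrier R [\<X>\<^bsub>V\<^esub>])"
  using assms(2)
proof (induction m)
  case empty
  have "(\<lambda>k. if k = {#} then c else \<zero>) = indexed_const c" by (auto simp: indexed_const_def)
  then show ?case using indexed_pset.indexed_const[OF assms(1), of V] by metis
next
  case (add x m)
  have "(\<lambda>k. if k = add_mset x m then c else \<zero>) = indexed_pmult (\<lambda>k. if k = m then c else \<zero>) x"
    by (auto simp: indexed_pmult_def fun_eq_iff dest: multi_member_split)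
  then show ?case using indexed_pset.indexed_pmult[of _ V "carrier R" x] add by auto
qed

text \<open>Turns membership in the inductively generated carrier into finite support inside the
  monomials over \<open>V\<close>, a form that can be checked coefficientwise. Conversely, such a
  function is assembled one monomial at a time.\<close>

lemma in_indexed_pset_iff:
  fixes f :: "'v multiset \<Rightarrow> 'a"
  shows "f \<in> (carrier R [\<X>\<^bsub>V\<^esub>]) \<longleftrightarrow>
    (\<forall>m. f m \<in> carrier R) \<and> finite {m. f m \<noteq> \<zero>} \<and> (\<forall>m. f m \<noteq> \<zero> \<longrightarrow> set_mset m \<subseteq> V)"
proof
  assume "f \<in> (carrier R [\<X>\<^bsub>V\<^esub>])"
  then show "(\<forall>m. f m \<in> carrier R) \<and> finite {m. f m \<noteq> \<zero>} \<and> (\<forall>m. f m \<noteq> \<zero> \<longrightarrow> set_mset m \<subseteq> V)"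
  proof induction
    case (indexed_const k)
    have "{m. indexed_const k m \<noteq> \<zero>} \<subseteq> {{#}}" by (auto simp: indexed_const_def)
    then have "finite {m. indexed_const k m \<noteq> \<zero>}" by (rule finite_subset) simp
    then show ?case using indexed_const by (auto simp: indexed_const_def)
  next
    case (indexed_padd P Q)
    have "{m. indexed_padd P Q m \<noteq> \<zero>} \<subseteq> {m. P m \<noteq> \<zero>} \<union> {m. Q m \<noteq> \<zero>}"
      by (auto simp: indexed_padd_def)
    then have "finite {m. indexed_padd P Q m \<noteq> \<zero>}" by (rule finite_subset) (use indexed_padd in simp)
    moreover have "set_mset m \<subseteq> V" if "indexed_padd P Q m \<noteq> \<zero>" for m
      using that indexed_padd unfolding indexed_padd_def by (metis r_zero zero_closed)
    ultimately show ?case using indexed_padd.IH by (auto simp: indexed_padd_def)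
  next
    case (indexed_pmult P i)
    have "{m. indexed_pmult P i m \<noteq> \<zero>} \<subseteq> add_mset i ` {m. P m \<noteq> \<zero>}"
    proof
      fix m assume "m \<in> {m. indexed_pmult P i m \<noteq> \<zero>}"
      then have "i \<in># m" "P (m - {#i#}) \<noteq> \<zero>" by (auto simp: indexed_pmult_def split: if_splits)
      then show "m \<in> add_mset i ` {m. P m \<noteq> \<zero>}" by (intro image_eqI[of _ _ "m - {#i#}"]) auto
    qed
    moreover from this have "set_mset m \<subseteq> V" if nz: "indexed_pmult P i m \<noteq> \<zero>" for m
    proof -
      obtain k where "m = add_mset i k" "P k \<noteq> \<zero>" using nz calculation by blast
      then show ?thesis using indexed_pmult by auto
    qed
    moreover have "finite {m. indexed_pmult P i m \<noteq> \<zero>}"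
      by (rule finite_subset[OF calculation(1)]) (use indexed_pmult in simp)
    moreover have "indexed_pmult P i m \<in> carrier R" for m
      using indexed_pmult by (simp add: indexed_pmult_def)
    ultimately show ?case by blast
  qed
next
  assume *: "(\<forall>m. f m \<in> carrier R) \<and> finite {m. f m \<noteq> \<zero>} \<and> (\<forall>m. f m \<noteq> \<zero> \<longrightarrow> set_mset m \<subseteq> V)"
  have "g \<in> (carrier R [\<X>\<^bsub>V\<^esub>])"
    if "finite S" "\<And>m. g m \<in> carrier R" "\<And>m. g m \<noteq> \<zero> \<Longrightarrow> m \<in> S" "\<And>m. m \<in> S \<Longrightarrow> set_mset m \<subseteq> V" for g and S :: "'v multiset set"
    using that
  proof (induction S arbitrary: g rule: finite_induct)
    case empty
    then have "g = indexed_const \<zero>" by (auto simp: indexed_const_def)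
    then show ?case using indexed_pset.indexed_const[of \<zero> "carrier R" V] by simp
  next
    case (insert s S)
    have "g(s := \<zero>) \<in> (carrier R [\<X>\<^bsub>V\<^esub>])"
    proof (rule insert.IH)
      show "(g(s := \<zero>)) m \<in> carrier R" for m using insert.prems(1) by simp
      show "m \<in> S" if "(g(s := \<zero>)) m \<noteq> \<zero>" for m
        using that insert.prems(2)[of m] by (auto split: if_splits)
      show "set_mset m \<subseteq> V" if "m \<in> S" for m using that insert.prems(3) by blast
    qed
    moreover have "(\<lambda>k. if k = s then g s else \<zero>) \<in> (carrier R [\<X>\<^bsub>V\<^esub>])"
      using insert by (intro monomial_in_indexed_pset) auto
    moreover have "g = indexed_padd (g(s := \<zero>)) (\<lambda>k. if k = s then g s else \<zero>)"
      using insert.prems by (auto simp: indexed_padd_def)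
    ultimately show ?case using indexed_pset.indexed_padd by metis
  qed
  from this[of "{m. f m \<noteq> \<zero>}" f] * show "f \<in> (carrier R [\<X>\<^bsub>V\<^esub>])" by auto
qed

lemma mpoly_ring_simps:
  shows carrier_mpoly_ring: "f \<in> carrier (mpoly_ring R V) \<longleftrightarrow>
      (\<forall>m. f m \<in> carrier R) \<and> finite {m. f m \<noteq> \<zero>} \<and> (\<forall>m. f m \<noteq> \<zero> \<longrightarrow> set_mset m \<subseteq> V)"
    and mult_mpoly_ring: "f \<otimes>\<^bsub>mpoly_ring R V\<^esub> g = conv f g"
    and one_mpoly_ring: "\<one>\<^bsub>mpoly_ring R V\<^esub> = (\<lambda>m. if m = {#} then \<one> else \<zero>)"
    and zero_mpoly_ring: "\<zero>\<^bsub>mpoly_ring R V\<^esub> = (\<lambda>m. \<zero>)"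
    and add_mpoly_ring: "f \<oplus>\<^bsub>mpoly_ring R V\<^esub> g = (\<lambda>m. f m \<oplus> g m)"
  by (auto simp: mpoly_ring_def in_indexed_pset_iff indexed_const_def indexed_padd_def)

lemma conv_supp:
  assumes "\<And>m. f m \<in> carrier R" "\<And>m. g m \<in> carrier R"
  shows "{m. conv f g m \<noteq> \<zero>} \<subseteq> (\<lambda>(k, l). k + l) ` ({k. f k \<noteq> \<zero>} \<times> {l. g l \<noteq> \<zero>})"
proof
  fix m assume "m \<in> {m. conv f g m \<noteq> \<zero>}"
  then have "conv f g m \<noteq> \<zero>" by simp
  then obtain k where "k \<subseteq># m" "f k \<otimes> g (m - k) \<noteq> \<zero>"
    using add.finprod_one_eqI[of "{k. k \<subseteq># m}" "\<lambda>k. f k \<otimes> g (m - k)"] by auto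
  then have "f k \<noteq> \<zero>" "g (m - k) \<noteq> \<zero>" "m = k + (m - k)"
    using assms by auto
  then show "m \<in> (\<lambda>(k, l). k + l) ` ({k. f k \<noteq> \<zero>} \<times> {l. g l \<noteq> \<zero>})" by (intro image_eqI[of _ _ "(k, m - k)"]) auto
qed

lemma conv_one:
  assumes "\<And>m. f m \<in> carrier R"
  shows "conv (\<lambda>m. if m = {#} then \<one> else \<zero>) f = f"
proof
  fix m
  show "conv (\<lambda>m. if m = {#} then \<one> else \<zero>) f m = f m"
    using finsum_single[of "{k. k \<subseteq># m}" "{#}" "\<lambda>k. (if k = {#} then \<one> else \<zero>) \<otimes> f (m - k)"] assms by simp
qed

text \<open>Asks only for a commutative coefficient ring, so that it serves the integers, the
  residues modulo \<open>p\<close> and the localization alike.\<close>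

lemma mpoly_ring_cring: "cring (mpoly_ring R V)"
proof (rule cringI)
  show "abelian_group (mpoly_ring R V)"
  proof (rule abelian_groupI)
    fix f g assume "f \<in> carrier (mpoly_ring R V)" "g \<in> carrier (mpoly_ring R V)"
    moreover have "{m. f m \<oplus> g m \<noteq> \<zero>} \<subseteq> {m. f m \<noteq> \<zero>} \<union> {m. g m \<noteq> \<zero>}" by auto
    moreover have "finite ({m. f m \<noteq> \<zero>} \<union> {m. g m \<noteq> \<zero>})"
      using calculation(1,2) by (simp add: mpoly_ring_simps)
    moreover have "f m \<noteq> \<zero> \<or> g m \<noteq> \<zero>" if "f m \<oplus> g m \<noteq> \<zero>" for m using that by auto
    ultimately show "f \<oplus>\<^bsub>mpoly_ring R V\<^esub> g \<in> carrier (mpoly_ring R V)"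
      unfolding mpoly_ring_simps by (blast intro: finite_subset a_closed)
  next
    fix f assume f: "f \<in> carrier (mpoly_ring R V)"
    have e: "{m. \<ominus> f m \<noteq> \<zero>} \<subseteq> {m. f m \<noteq> \<zero>}" by auto
    then have "(\<lambda>m. \<ominus> f m) \<in> carrier (mpoly_ring R V)"
      using f finite_subset[OF e] unfolding mpoly_ring_simps by auto
    moreover have "(\<lambda>m. \<ominus> f m) \<oplus>\<^bsub>mpoly_ring R V\<^esub> f = \<zero>\<^bsub>mpoly_ring R V\<^esub>"
      using f by (auto simp: mpoly_ring_simps l_neg)
    ultimately show "\<exists>g\<in>carrier (mpoly_ring R V). g \<oplus>\<^bsub>mpoly_ring R V\<^esub> f = \<zero>\<^bsub>mpoly_ring R V\<^esub>" by blast
  next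
    fix f g assume "f \<in> carrier (mpoly_ring R V)" "g \<in> carrier (mpoly_ring R V)"
    then show "f \<oplus>\<^bsub>mpoly_ring R V\<^esub> g = g \<oplus>\<^bsub>mpoly_ring R V\<^esub> f"
      by (auto simp: mpoly_ring_simps a_comm)
  qed (auto simp: mpoly_ring_simps a_assoc)
  show "comm_monoid (mpoly_ring R V)"
  proof (rule comm_monoidI)
    fix f g assume fg: "f \<in> carrier (mpoly_ring R V)" "g \<in> carrier (mpoly_ring R V)"
    then have c: "\<And>m. f m \<in> carrier R" "\<And>m. g m \<in> carrier R" by (auto simp: mpoly_ring_simps)
    show "f \<otimes>\<^bsub>mpoly_ring R V\<^esub> g = g \<otimes>\<^bsub>mpoly_ring R V\<^esub> f"
      unfolding mpoly_ring_simps by (rule conv_comm[OF c])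
    have "finite ((\<lambda>(k, l). k + l) ` ({k. f k \<noteq> \<zero>} \<times> {l. g l \<noteq> \<zero>}))"
      using fg by (auto simp: mpoly_ring_simps)
    then have "finite {m. conv f g m \<noteq> \<zero>}" by (rule finite_subset[OF conv_supp[of f g, OF c]])
    moreover have "set_mset m \<subseteq> V" if "conv f g m \<noteq> \<zero>" for m
    proof -
      have "m \<in> (\<lambda>(k, l). k + l) ` ({k. f k \<noteq> \<zero>} \<times> {l. g l \<noteq> \<zero>})"
        using that conv_supp[of f g, OF c] by blast
      then obtain k l where kl: "m = k + l" "f k \<noteq> \<zero>" "g l \<noteq> \<zero>" by auto
      then have "set_mset k \<subseteq> V" "set_mset l \<subseteq> V" using fg by (simp_all add: mpoly_ring_simps)
      then show ?thesis using kl(1) by simp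
    qed
    ultimately show "f \<otimes>\<^bsub>mpoly_ring R V\<^esub> g \<in> carrier (mpoly_ring R V)"
      unfolding mpoly_ring_simps using c by auto
  next
    fix f g h assume "f \<in> carrier (mpoly_ring R V)" "g \<in> carrier (mpoly_ring R V)" "h \<in> carrier (mpoly_ring R V)"
    then show "f \<otimes>\<^bsub>mpoly_ring R V\<^esub> g \<otimes>\<^bsub>mpoly_ring R V\<^esub> h = f \<otimes>\<^bsub>mpoly_ring R V\<^esub> (g \<otimes>\<^bsub>mpoly_ring R V\<^esub> h)"
      unfolding mpoly_ring_simps by (intro conv_assoc) auto
  next
    have "{m. (if m = {#} then \<one> else \<zero>) \<noteq> \<zero>} \<subseteq> {{#}}" by auto
    then show "\<one>\<^bsub>mpoly_ring R V\<^esub> \<in> carrier (mpoly_ring R V)"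
      unfolding mpoly_ring_simps by (auto intro: finite_subset)
  next
    fix f assume "f \<in> carrier (mpoly_ring R V)"
    then show "\<one>\<^bsub>mpoly_ring R V\<^esub> \<otimes>\<^bsub>mpoly_ring R V\<^esub> f = f"
      unfolding mpoly_ring_simps by (intro conv_one) auto
  qed
next
  fix f g h assume "f \<in> carrier (mpoly_ring R V)" "g \<in> carrier (mpoly_ring R V)" "h \<in> carrier (mpoly_ring R V)"
  then have c: "\<And>m. f m \<in> carrier R" "\<And>m. g m \<in> carrier R" "\<And>m. h m \<in> carrier R" by (auto simp: mpoly_ring_simps)
  show "(f \<oplus>\<^bsub>mpoly_ring R V\<^esub> g) \<otimes>\<^bsub>mpoly_ring R V\<^esub> h
      = f \<otimes>\<^bsub>mpoly_ring R V\<^esub> h \<oplus>\<^bsub>mpoly_ring R V\<^esub> g \<otimes>\<^bsub>mpoly_ring R V\<^esub> h"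
    unfolding mpoly_ring_simps
  proof
    fix m
    have "finsum R (\<lambda>k. (f k \<oplus> g k) \<otimes> h (m - k)) {k. k \<subseteq># m}
        = finsum R (\<lambda>k. f k \<otimes> h (m - k) \<oplus> g k \<otimes> h (m - k)) {k. k \<subseteq># m}"
      using c by (intro finsum_cong') (auto simp: l_distr)
    also have "\<dots> = conv f h m \<oplus> conv g h m" using c by (intro finsum_addf) auto
    finally show "conv (\<lambda>m. f m \<oplus> g m) h m = conv f h m \<oplus> conv g h m" .
  qed
qed

end

section \<open>Fractions with respect to a multiplicative set\<close>

locale cring_mult_set = cring +
  fixes S :: "'a set"
  assumes S_carrier: "S \<subseteq> carrier R" and S_one: "\<one> \<in> S"
    and S_mult: "\<And>s t. s \<in> S \<Longrightarrow> t \<in> S \<Longrightarrow> s \<otimes> t \<in> S"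
begin

lemma S_closed [simp]: "s \<in> S \<Longrightarrow> s \<in> carrier R"
  using S_carrier by blast

abbreviation "fr \<equiv> frac_class R S"

lemma mem_frac: "(b, t) \<in> fr a s \<longleftrightarrow>
    b \<in> carrier R \<and> t \<in> S \<and> (\<exists>w\<in>S. w \<otimes> (t \<otimes> a) = w \<otimes> (s \<otimes> b))"
  by (auto simp: frac_class_def)

lemma frac_refl: "a \<in> carrier R \<Longrightarrow> s \<in> S \<Longrightarrow> (a, s) \<in> fr a s"
  using S_one by (auto simp: mem_frac)

text \<open>The middle denominator \<open>t\<close> enters the witness
  \<open>w \<otimes> w' \<otimes> t\<close>, because zero divisors may prevent cancelling
  it.\<close>

lemma frac_trans:
  assumes "a \<in> carrier R" "s \<in> S" "(b, t) \<in> fr a s" "(c, r) \<in> fr b t"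
  shows "(c, r) \<in> fr a s"
proof -
  from assms obtain w w' where w: "w \<in> S" "w \<otimes> (t \<otimes> a) = w \<otimes> (s \<otimes> b)"
    "w' \<in> S" "w' \<otimes> (r \<otimes> b) = w' \<otimes> (t \<otimes> c)"
    and c: "b \<in> carrier R" "t \<in> S" "c \<in> carrier R" "r \<in> S" by (auto simp: mem_frac)
  have "(w \<otimes> w' \<otimes> t) \<otimes> (r \<otimes> a) = (w' \<otimes> r) \<otimes> (w \<otimes> (t \<otimes> a))"
    using c w(1,3) assms(1,2) by (simp add: m_ac)
  also have "\<dots> = (w \<otimes> s) \<otimes> (w' \<otimes> (r \<otimes> b))" unfolding w(2) using c w(1,3) assms(1,2) by (simp add: m_ac)
  also have "\<dots> = (w \<otimes> w' \<otimes> t) \<otimes> (s \<otimes> c)" unfolding w(4) using c w(1,3) assms(1,2) by (simp add: m_ac)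
  finally show ?thesis using c w S_mult by (auto simp: mem_frac)
qed

lemma frac_sym:
  assumes "a \<in> carrier R" "s \<in> S" "(b, t) \<in> fr a s"
  shows "(a, s) \<in> fr b t"
  using assms by (auto simp: mem_frac) metis

lemma frac_eq_iff:
  assumes "a \<in> carrier R" "s \<in> S" "b \<in> carrier R" "t \<in> S"
  shows "fr a s = fr b t \<longleftrightarrow> (\<exists>w\<in>S. w \<otimes> (t \<otimes> a) = w \<otimes> (s \<otimes> b))"
proof
  assume "fr a s = fr b t"
  then have "(b, t) \<in> fr a s" using frac_refl[OF assms(3,4)] by simp
  then show "\<exists>w\<in>S. w \<otimes> (t \<otimes> a) = w \<otimes> (s \<otimes> b)" by (simp add: mem_frac)
next
  assume "\<exists>w\<in>S. w \<otimes> (t \<otimes> a) = w \<otimes> (s \<otimes> b)"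
  then have "(b, t) \<in> fr a s" using assms by (simp add: mem_frac)
  then have "(c, r) \<in> fr a s \<longleftrightarrow> (c, r) \<in> fr b t" for c r
    using frac_trans[OF assms(1,2)] frac_trans[OF assms(3,4)] frac_sym[OF assms(1,2)] by blast
  then show "fr a s = fr b t" by auto
qed

lemma frac_eqI:
  assumes "a \<in> carrier R" "s \<in> S" "b \<in> carrier R" "t \<in> S" "t \<otimes> a = s \<otimes> b"
  shows "fr a s = fr b t"
  using assms S_one by (subst frac_eq_iff) auto

lemma frac_cancel:
  assumes "a \<in> carrier R" "s \<in> S" "t \<in> S"
  shows "fr (t \<otimes> a) (t \<otimes> s) = fr a s"
  using assms S_mult by (intro frac_eqI) (auto simp: m_ac)

lemma carrier_localization: "x \<in> carrier (localization R S) \<longleftrightarrow> (\<exists>a s. a \<in> carrier R \<and> s \<in> S \<and> x = fr a s)"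
  by (auto simp: localization_def)

lemma frac_carrier [simp]: "a \<in> carrier R \<Longrightarrow> s \<in> S \<Longrightarrow> fr a s \<in> carrier (localization R S)"
  by (auto simp: carrier_localization)

lemma frac_mult:
  assumes "a \<in> carrier R" "s \<in> S" "b \<in> carrier R" "t \<in> S"
  shows "fr a s \<otimes>\<^bsub>localization R S\<^esub> fr b t = fr (a \<otimes> b) (s \<otimes> t)"
proof -
  have "fr (a' \<otimes> b') (s' \<otimes> t') = fr (a \<otimes> b) (s \<otimes> t)"
    if "(a', s') \<in> fr a s" "(b', t') \<in> fr b t" for a' s' b' t'
  proof -
    from that obtain w w' where w: "w \<in> S" "w \<otimes> (s' \<otimes> a) = w \<otimes> (s \<otimes> a')"
      "w' \<in> S" "w' \<otimes> (t' \<otimes> b) = w' \<otimes> (t \<otimes> b')"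
      and c: "a' \<in> carrier R" "s' \<in> S" "b' \<in> carrier R" "t' \<in> S" by (auto simp: mem_frac)
    have "(w \<otimes> w') \<otimes> ((s \<otimes> t) \<otimes> (a' \<otimes> b')) = (w \<otimes> (s \<otimes> a')) \<otimes> (w' \<otimes> (t \<otimes> b'))"
      using w(1,3) c assms by (simp add: m_ac)
    also have "\<dots> = (w \<otimes> w') \<otimes> ((s' \<otimes> t') \<otimes> (a \<otimes> b))"
      unfolding w(2,4)[symmetric] using w(1,3) c assms by (simp add: m_ac)
    finally show ?thesis using w(1,3) c assms S_mult by (subst frac_eq_iff) auto
  qed
  then have "(\<Union>(a', s')\<in>fr a s. \<Union>(b', t')\<in>fr b t. fr (a' \<otimes> b') (s' \<otimes> t'))
      = (\<Union>(a', s')\<in>fr a s. \<Union>(b', t')\<in>fr b t. fr (a \<otimes> b) (s \<otimes> t))"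
    by (intro SUP_cong refl) (auto split: prod.splits intro!: SUP_cong)
  also have "\<dots> = fr (a \<otimes> b) (s \<otimes> t)"
    using frac_refl[OF assms(1,2)] frac_refl[OF assms(3,4)] by auto
  finally show ?thesis by (simp add: localization_def)
qed

lemma frac_add:
  assumes "a \<in> carrier R" "s \<in> S" "b \<in> carrier R" "t \<in> S"
  shows "fr a s \<oplus>\<^bsub>localization R S\<^esub> fr b t = fr (t \<otimes> a \<oplus> s \<otimes> b) (s \<otimes> t)"
proof -
  have "fr (t' \<otimes> a' \<oplus> s' \<otimes> b') (s' \<otimes> t') = fr (t \<otimes> a \<oplus> s \<otimes> b) (s \<otimes> t)"
    if "(a', s') \<in> fr a s" "(b', t') \<in> fr b t" for a' s' b' t'
  proof -
    from that obtain w w' where w: "w \<in> S" "w \<otimes> (s' \<otimes> a) = w \<otimes> (s \<otimes> a')"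
      "w' \<in> S" "w' \<otimes> (t' \<otimes> b) = w' \<otimes> (t \<otimes> b')"
      and c: "a' \<in> carrier R" "s' \<in> S" "b' \<in> carrier R" "t' \<in> S" by (auto simp: mem_frac)
    have "(w \<otimes> w') \<otimes> ((s \<otimes> t) \<otimes> (t' \<otimes> a' \<oplus> s' \<otimes> b'))
        = (w' \<otimes> t \<otimes> t') \<otimes> (w \<otimes> (s \<otimes> a')) \<oplus> (w \<otimes> s \<otimes> s') \<otimes> (w' \<otimes> (t \<otimes> b'))"
      using w(1,3) c assms by (simp add: m_ac r_distr)
    also have "\<dots> = (w \<otimes> w') \<otimes> ((s' \<otimes> t') \<otimes> (t \<otimes> a \<oplus> s \<otimes> b))"
      unfolding w(2,4)[symmetric] using w(1,3) c assms by (simp add: m_ac r_distr)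
    finally show ?thesis using w(1,3) c assms S_mult by (subst frac_eq_iff) auto
  qed
  then have "(\<Union>(a', s')\<in>fr a s. \<Union>(b', t')\<in>fr b t. fr (t' \<otimes> a' \<oplus> s' \<otimes> b') (s' \<otimes> t'))
      = (\<Union>(a', s')\<in>fr a s. \<Union>(b', t')\<in>fr b t. fr (t \<otimes> a \<oplus> s \<otimes> b) (s \<otimes> t))"
    by (intro SUP_cong refl) (auto split: prod.splits intro!: SUP_cong)
  also have "\<dots> = fr (t \<otimes> a \<oplus> s \<otimes> b) (s \<otimes> t)"
    using frac_refl[OF assms(1,2)] frac_refl[OF assms(3,4)] by auto
  finally show ?thesis by (simp add: localization_def)
qed

lemma localization_one: "\<one>\<^bsub>localization R S\<^esub> = fr \<one> \<one>"
  and localization_zero: "\<zero>\<^bsub>localization R S\<^esub> = fr \<zero> \<one>"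
  by (auto simp: localization_def)

lemma localization_cring: "cring (localization R S)"
proof (rule cringI)
  let ?L = "localization R S"
  note S' = S_mult S_one
  show "abelian_group ?L"
  proof (rule abelian_groupI)
    fix x y assume "x \<in> carrier ?L" "y \<in> carrier ?L"
    then obtain a s b t where xy: "x = fr a s" "y = fr b t" "a \<in> carrier R" "b \<in> carrier R" "s \<in> S" "t \<in> S"
      by (auto simp: carrier_localization)
    then show "x \<oplus>\<^bsub>?L\<^esub> y \<in> carrier ?L" using S' by (simp add: frac_add)
    show "x \<oplus>\<^bsub>?L\<^esub> y = y \<oplus>\<^bsub>?L\<^esub> x" using xy S' by (simp add: frac_add m_comm a_comm)
  next
    fix x y z assume "x \<in> carrier ?L" "y \<in> carrier ?L" "z \<in> carrier ?L"
    then obtain a s b t c r where xy: "x = fr a s" "y = fr b t" "z = fr c r"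
      "a \<in> carrier R" "b \<in> carrier R" "c \<in> carrier R" "s \<in> S" "t \<in> S" "r \<in> S"
      by (auto simp: carrier_localization)
    then show "x \<oplus>\<^bsub>?L\<^esub> y \<oplus>\<^bsub>?L\<^esub> z = x \<oplus>\<^bsub>?L\<^esub> (y \<oplus>\<^bsub>?L\<^esub> z)" using S'
      by (simp add: frac_add r_distr m_ac a_ac)
  next
    fix x assume "x \<in> carrier ?L"
    then obtain a s where x: "x = fr a s" "a \<in> carrier R" "s \<in> S" by (auto simp: carrier_localization)
    then show "\<zero>\<^bsub>?L\<^esub> \<oplus>\<^bsub>?L\<^esub> x = x" using S' by (simp add: frac_add localization_zero)
    have "fr (\<ominus> a) s \<oplus>\<^bsub>?L\<^esub> x = \<zero>\<^bsub>?L\<^esub>"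
    proof -
      have "fr (s \<otimes> \<ominus> a \<oplus> s \<otimes> a) (s \<otimes> s) = fr \<zero> \<one>"
        by (rule frac_eqI) (use x S' in \<open>auto simp: r_minus l_neg\<close>)
      then show ?thesis using x by (simp add: frac_add localization_zero)
    qed
    then show "\<exists>y\<in>carrier ?L. y \<oplus>\<^bsub>?L\<^esub> x = \<zero>\<^bsub>?L\<^esub>" using x by (meson a_inv_closed frac_carrier)
  qed (simp add: localization_zero S')
  show "comm_monoid ?L"
  proof (rule comm_monoidI)
    fix x y assume "x \<in> carrier ?L" "y \<in> carrier ?L"
    then obtain a s b t where xy: "x = fr a s" "y = fr b t" "a \<in> carrier R" "b \<in> carrier R" "s \<in> S" "t \<in> S"
      by (auto simp: carrier_localization)
    then show "x \<otimes>\<^bsub>?L\<^esub> y \<in> carrier ?L" using S' by (simp add: frac_mult)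
    show "x \<otimes>\<^bsub>?L\<^esub> y = y \<otimes>\<^bsub>?L\<^esub> x" using xy S' by (simp add: frac_mult m_comm)
  next
    fix x y z assume "x \<in> carrier ?L" "y \<in> carrier ?L" "z \<in> carrier ?L"
    then obtain a s b t c r where xy: "x = fr a s" "y = fr b t" "z = fr c r"
      "a \<in> carrier R" "b \<in> carrier R" "c \<in> carrier R" "s \<in> S" "t \<in> S" "r \<in> S"
      by (auto simp: carrier_localization)
    then show "x \<otimes>\<^bsub>?L\<^esub> y \<otimes>\<^bsub>?L\<^esub> z = x \<otimes>\<^bsub>?L\<^esub> (y \<otimes>\<^bsub>?L\<^esub> z)" using S'
      by (simp add: frac_mult m_assoc)
  next
    fix x assume "x \<in> carrier ?L"
    then obtain a s where x: "x = fr a s" "a \<in> carrier R" "s \<in> S" by (auto simp: carrier_localization)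
    then show "\<one>\<^bsub>?L\<^esub> \<otimes>\<^bsub>?L\<^esub> x = x" using S' by (simp add: frac_mult localization_one)
  qed (simp add: localization_one S')
  fix x y z assume "x \<in> carrier ?L" "y \<in> carrier ?L" "z \<in> carrier ?L"
  then obtain a s b t c r where xy: "x = fr a s" "y = fr b t" "z = fr c r"
    "a \<in> carrier R" "b \<in> carrier R" "c \<in> carrier R" "s \<in> S" "t \<in> S" "r \<in> S"
    by (auto simp: carrier_localization)
  \<comment> \<open>The two sides of distributivity come with the denominators \<open>s t r\<close>
    and \<open>s r t r\<close>; they agree after expanding the first fraction by
    \<open>r\<close>.\<close>
  have "r \<otimes> ((t \<otimes> a \<oplus> s \<otimes> b) \<otimes> c) = t \<otimes> r \<otimes> (a \<otimes> c) \<oplus> s \<otimes> r \<otimes> (b \<otimes> c)"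
    using xy S' by (simp add: m_ac r_distr l_distr)
  moreover have "r \<otimes> (s \<otimes> t \<otimes> r) = s \<otimes> r \<otimes> (t \<otimes> r)" using xy S' by (simp add: m_ac)
  ultimately show "(x \<oplus>\<^bsub>?L\<^esub> y) \<otimes>\<^bsub>?L\<^esub> z = x \<otimes>\<^bsub>?L\<^esub> z \<oplus>\<^bsub>?L\<^esub> y \<otimes>\<^bsub>?L\<^esub> z"
    using xy S' frac_cancel[of "(t \<otimes> a \<oplus> s \<otimes> b) \<otimes> c" "s \<otimes> t \<otimes> r" r]
    by (simp add: frac_mult frac_add)
qed

end

section \<open>Polynomials with integer coefficients\<close>

type_synonym 'v zpoly = "'v multiset \<Rightarrow>\<^sub>0 int"

abbreviation "lookup \<equiv> Poly_Mapping.lookup"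

definition zpolys :: "'v set \<Rightarrow> 'v zpoly set" where
  "zpolys W = {t. \<forall>m. lookup t m \<noteq> 0 \<longrightarrow> set_mset m \<subseteq> W}"

text \<open>\<open>D\<close> is meant to be an ideal of the integers: all integers give
  \<open>zpolys W\<close>, \<open>{0}\<close> gives the zero ideal and the multiples of
  \<open>p\<close> give \<open>pmult p W\<close>, so that facts for general \<open>D\<close> serve
  all three.\<close>

definition coeffs_in :: "int set \<Rightarrow> 'v set \<Rightarrow> 'v zpoly set" where
  "coeffs_in D W = {t \<in> zpolys W. \<forall>m. lookup t m \<in> D}"

abbreviation zvar :: "'v \<Rightarrow> 'v zpoly" where
  "zvar v \<equiv> Poly_Mapping.single {#v#} 1"

text \<open>Brings the product of \<open>Poly_Mapping\<close> into the convolution form of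
  \<open>mpoly_ring\<close>: for given \<open>m\<close> and \<open>k\<close>, the second factor can
  only be \<open>m - k\<close>.\<close>

lemma lookup_times:
  fixes s t :: "'v zpoly"
  shows "lookup (s * t) m = (\<Sum>k | k \<subseteq># m. lookup s k * lookup t (m - k))"
proof -
  have "(\<Sum>q. lookup t q when m = k + q) = (lookup t (m - k) when k \<subseteq># m)" for k
  proof (cases "k \<subseteq># m")
    case True
    then have "(\<lambda>q. lookup t q when m = k + q) = (\<lambda>q. lookup t q when m - k = q)"
      by (auto simp: fun_eq_iff when_def subset_mset.add_diff_inverse)
    then show ?thesis using True by (simp only: Sum_any_when_equal' when_simps)
  next
    case False
    then have "(\<lambda>q. lookup t q when m = k + q) = (\<lambda>q. 0)"
      by (auto simp: fun_eq_iff when_def)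
    then show ?thesis using False by (simp only: Sum_any.neutral when_simps simp_thms)
  qed
  then have "lookup (s * t) m = (\<Sum>k. lookup s k * (lookup t (m - k) when k \<subseteq># m))"
    by (simp add: lookup_mult)
  also have "\<dots> = (\<Sum>k | k \<subseteq># m. lookup s k * (lookup t (m - k) when k \<subseteq># m))"
    by (rule Sum_any.expand_superset) (auto simp: when_def)
  also have "\<dots> = (\<Sum>k | k \<subseteq># m. lookup s k * lookup t (m - k))"
    by (intro sum.cong) auto
  finally show ?thesis .
qed

lemma lookup_times_single:
  fixes t :: "'v zpoly"
  shows "lookup (t * Poly_Mapping.single n c) m = (if n \<subseteq># m then lookup t (m - n) * c else 0)"
proof -
  have "lookup (Poly_Mapping.single n c * t) m
      = (\<Sum>k | k \<subseteq># m. if k = n then c * lookup t (m - n) else 0)"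
    unfolding lookup_times by (intro sum.cong) (auto simp: lookup_single when_def)
  also have "\<dots> = (if n \<subseteq># m then c * lookup t (m - n) else 0)"
    by simp
  finally show ?thesis by (simp add: mult.commute)
qed

lemma lookup_times_single':
  fixes t :: "'v zpoly"
  shows "lookup (t * Poly_Mapping.single n c) (n + m) = lookup t m * c"
  by (simp add: lookup_times_single)

lemma zvar_power: "zvar v ^ n = Poly_Mapping.single (replicate_mset n v) 1"
  by (induction n) (auto simp: mult_single)

lemma zpolys_mono: "W \<subseteq> W' \<Longrightarrow> zpolys W \<subseteq> zpolys W'"
  by (auto simp: zpolys_def)

lemma lookup_times_nonzero:
  fixes s t :: "'v zpoly"
  assumes "lookup (s * t) m \<noteq> 0"
  obtains k l where "m = k + l" "lookup s k \<noteq> 0" "lookup t l \<noteq> 0"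
proof -
  have "(\<Sum>k | k \<subseteq># m. lookup s k * lookup t (m - k)) \<noteq> 0" using assms by (simp add: lookup_times)
  then obtain k where "k \<subseteq># m" "lookup s k * lookup t (m - k) \<noteq> 0"
    by (rule sum.not_neutral_contains_not_neutral) auto
  then show thesis using that[of k "m - k"] by auto
qed

lemma zpolys_subring: "unital_subring (zpolys W)"
  unfolding unital_subring_def
proof (intro conjI ballI)
  show "1 \<in> zpolys W" by (auto simp: zpolys_def lookup_one when_def)
  fix s t :: "'a zpoly" assume st: "s \<in> zpolys W" "t \<in> zpolys W"
  have "lookup s m \<noteq> 0 \<or> lookup t m \<noteq> 0" if "lookup (s - t) m \<noteq> 0" for m
    using that by (auto simp: lookup_minus)
  then show "s - t \<in> zpolys W" using st by (auto simp: zpolys_def)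
  show "s * t \<in> zpolys W"
    unfolding zpolys_def
  proof (intro CollectI allI impI)
    fix m assume "lookup (s * t) m \<noteq> 0"
    then show "set_mset m \<subseteq> W"
      by (rule lookup_times_nonzero) (use st in \<open>auto simp: zpolys_def\<close>)
  qed
qed

lemmas zpolys_closed = subring_zero[OF zpolys_subring] subring_one[OF zpolys_subring]
  subring_add[OF zpolys_subring] subring_diff[OF zpolys_subring] subring_mult[OF zpolys_subring]
  subring_uminus[OF zpolys_subring] subring_power[OF zpolys_subring]

lemma single_in_zpolys: "set_mset m \<subseteq> W \<Longrightarrow> Poly_Mapping.single m c \<in> zpolys W"
  by (auto simp: zpolys_def lookup_single when_def split: if_splits)

lemma coeffs_in_ideal:
  assumes D: "ideal_in UNIV D"
  shows "ideal_in (zpolys W) (coeffs_in D W)"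
  unfolding ideal_in_def
proof (intro conjI ballI)
  show "0 \<in> coeffs_in D W" using zpolys_closed ideal_in_zero[OF D] by (auto simp: coeffs_in_def)
  show "s + t \<in> coeffs_in D W" if "s \<in> coeffs_in D W" "t \<in> coeffs_in D W" for s t
    using that zpolys_closed(3) ideal_in_add[OF D] by (auto simp: coeffs_in_def lookup_add)
  have sum: "sum f S \<in> D" if "\<And>k. k \<in> S \<Longrightarrow> f k \<in> D" for f and S :: "'v multiset set"
    using that by (induction S rule: infinite_finite_induct) (auto intro: ideal_in_add[OF D] ideal_in_zero[OF D])
  show "s * t \<in> coeffs_in D W" if "s \<in> zpolys W" "t \<in> coeffs_in D W" for s t
    using that zpolys_closed(5) by (auto simp: coeffs_in_def lookup_times intro!: sum ideal_in_mult[OF D])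
qed (auto simp: coeffs_in_def)

text \<open>Coefficients in \<open>zpolys W\<close> do not involve \<open>x\<close>, so the
  multiplicity of \<open>x\<close> in a monomial is its degree in \<open>zvar x\<close>. This yields
  the transcendence of \<open>zvar x\<close>.\<close>

lemma poly_span_count:
  assumes "l \<in> poly_span (zpolys W) (zvar x) n" "x \<notin> W" "lookup l m \<noteq> 0"
  shows "count m x < n"
  using assms
proof (induction n arbitrary: l)
  case (Suc n)
  then obtain l' a where l: "l = l' + a * zvar x ^ n" "l' \<in> poly_span (zpolys W) (zvar x) n" "a \<in> zpolys W"
    by auto
  show ?case
  proof (cases "lookup l' m = 0")
    case False
    then show ?thesis using Suc.IH[OF l(2)] assms(2) by simp
  next
    case True
    then have "lookup (a * zvar x ^ n) m \<noteq> 0" using Suc.prems l(1) by (simp add: lookup_add)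
    then have "replicate_mset n x \<subseteq># m" "lookup a (m - replicate_mset n x) \<noteq> 0"
      by (auto simp: zvar_power lookup_times_single split: if_splits)
    then have "x \<notin># m - replicate_mset n x" using l(3) assms(2) by (auto simp: zpolys_def)
    then show ?thesis by (simp add: not_in_iff)
  qed
qed simp

lemma simple_ext_zpolys:
  assumes "x \<notin> W"
  shows "simple_ext (zpolys W) (zvar x)"
proof
  show "unital_subring (zpolys W)" by (rule zpolys_subring)
  fix n l a assume l: "l \<in> poly_span (zpolys W) (zvar x) n" and a: "a \<in> zpolys W"
    and 0: "l + a * zvar x ^ n = 0"
  show "a = 0"
  proof (rule poly_mapping_eqI, rule ccontr)
    fix k assume k: "lookup a k \<noteq> lookup 0 k"
    then have "x \<notin># k" using a assms by (auto simp: zpolys_def)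
    have "lookup l (replicate_mset n x + k) + lookup a k = 0"
      using arg_cong[OF 0, of "\<lambda>t. lookup t (replicate_mset n x + k)"]
      by (simp add: lookup_add zvar_power lookup_times_single')
    then have "lookup l (replicate_mset n x + k) \<noteq> 0" using k by simp
    from poly_span_count[OF l assms this] \<open>x \<notin># k\<close> show False by (simp add: not_in_iff)
  qed
qed

lemma zpoly_sum_monomials: "t = (\<Sum>k\<in>{k. lookup t k \<noteq> 0}. Poly_Mapping.single k (lookup t k))"
  for t :: "'v zpoly"
proof (rule poly_mapping_eqI)
  fix m
  have "(\<Sum>k\<in>{k. lookup t k \<noteq> 0}. lookup t k when k = m)
      = (\<Sum>k\<in>{k. lookup t k \<noteq> 0}. if k = m then lookup t m else 0)"
    by (intro sum.cong) (auto simp: when_def)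
  also have "\<dots> = lookup t m" by simp
  finally show "lookup t m = lookup (\<Sum>k\<in>{k. lookup t k \<noteq> 0}. Poly_Mapping.single k (lookup t k)) m"
    by (simp add: lookup_sum lookup_single)
qed

text \<open>A monomial splits into its power of \<open>x\<close> and the rest, so adjoining
  \<open>zvar x\<close> amounts to adding a variable. This lets the results on a simple extension be
  repeated over a finite set of variables.\<close>

lemma poly_ext_coeffs_in:
  assumes x: "x \<notin> W" and D: "ideal_in UNIV D"
  shows "poly_ext (coeffs_in D W) (zvar x) = coeffs_in D (insert x W)"
proof
  interpret simple_ext "zpolys W" "zvar x" by (rule simple_ext_zpolys[OF x])
  note Wi = coeffs_in_ideal[OF D, of W] and Ei = coeffs_in_ideal[OF D, of "insert x W"]
  note XI = ext_ideal[OF Wi]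
  have "poly_span (coeffs_in D W) (zvar x) n \<subseteq> coeffs_in D (insert x W)" for n
  proof (induction n)
    case 0
    then show ?case using ideal_in_zero[OF Ei] by simp
  next
    case (Suc n)
    have "zvar x ^ n * a \<in> coeffs_in D (insert x W)" if "a \<in> coeffs_in D W" for a
    proof (rule ideal_in_mult[OF Ei])
      show "zvar x ^ n \<in> zpolys (insert x W)"
        by (intro zpolys_closed single_in_zpolys) simp
      show "a \<in> coeffs_in D (insert x W)" using that zpolys_mono[of W "insert x W"] by (auto simp: coeffs_in_def)
    qed
    then show ?case using Suc ideal_in_add[OF Ei] by (auto simp: mult.commute)
  qed
  then show "poly_ext (coeffs_in D W) (zvar x) \<subseteq> coeffs_in D (insert x W)"
    by (auto simp: poly_ext_def)
  have mono: "Poly_Mapping.single m c \<in> poly_ext (coeffs_in D W) (zvar x)" if "c \<in> D" "set_mset m \<subseteq> insert x W" for m c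
  proof -
    define n where "n = count m x"
    define m' where "m' = filter_mset (\<lambda>v. v \<noteq> x) m"
    have m: "m = m' + replicate_mset n x"
      unfolding n_def m'_def by (rule multiset_eqI) auto
    have "set_mset m' \<subseteq> W" using that(2) by (auto simp: m'_def)
    then have "Poly_Mapping.single m' c \<in> coeffs_in D W"
      using that(1) ideal_in_zero[OF D] single_in_zpolys[of m' W c] by (auto simp: coeffs_in_def lookup_single when_def)
    from span_monom[OF this Wi, of n] have "Poly_Mapping.single m' c * zvar x ^ n \<in> poly_ext (coeffs_in D W) (zvar x)"
      using span_subset_ext by blast
    then show ?thesis unfolding m by (simp add: zvar_power mult_single)
  qed
  show "coeffs_in D (insert x W) \<subseteq> poly_ext (coeffs_in D W) (zvar x)"
  proof
    fix t assume t: "t \<in> coeffs_in D (insert x W)"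
    have "(\<Sum>k\<in>S. Poly_Mapping.single k (lookup t k)) \<in> poly_ext (coeffs_in D W) (zvar x)"
      if "S \<subseteq> {k. lookup t k \<noteq> 0}" for S
      using that
    proof (induction S rule: infinite_finite_induct)
      case (insert k S)
      then have "Poly_Mapping.single k (lookup t k) \<in> poly_ext (coeffs_in D W) (zvar x)"
        using t by (intro mono) (auto simp: coeffs_in_def zpolys_def)
      then show ?case using insert ideal_in_add[OF XI] by simp
    qed (use ideal_in_zero[OF XI] in auto)
    from this[OF order_refl] show "t \<in> poly_ext (coeffs_in D W) (zvar x)"
      by (simp flip: zpoly_sum_monomials)
  qed
qed

lemma UNIV_ideal: "ideal_in UNIV (UNIV :: int set)"
  by (auto simp: ideal_in_def)

lemma coeffs_in_UNIV: "coeffs_in UNIV W = zpolys W"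
  by (auto simp: coeffs_in_def)

lemma poly_ext_zpolys: "x \<notin> W \<Longrightarrow> poly_ext (zpolys W) (zvar x) = zpolys (insert x W)"
  using poly_ext_coeffs_in[OF _ UNIV_ideal, of x W] by (simp add: coeffs_in_UNIV)

text \<open>Gauss' lemma \<open>ext_prime\<close>, applied once per variable; without variables only
  constants remain, and primality is that of \<open>D\<close>.\<close>

lemma coeffs_in_prime:
  assumes D: "prime_in UNIV D" and "finite W"
  shows "prime_in (zpolys W) (coeffs_in D W)"
  using assms(2)
proof (induction W rule: finite_induct)
  case empty
  have t0: "lookup t m = 0" if "t \<in> zpolys {}" "m \<noteq> {#}" for t :: "'a zpoly" and m
    using that by (auto simp: zpolys_def)
  have in0: "t \<in> coeffs_in D {} \<longleftrightarrow> lookup t {#} \<in> D" if "t \<in> zpolys {}" for t :: "'a zpoly"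
    using t0[OF that] that ideal_in_zero[OF prime_in_ideal[OF D]]
    by (auto simp: coeffs_in_def) metis
  show ?case
    unfolding prime_in_def
  proof (intro conjI ballI impI)
    show "ideal_in (zpolys {}) (coeffs_in D {})" by (rule coeffs_in_ideal[OF prime_in_ideal[OF D]])
    show "1 \<notin> coeffs_in D {}" using prime_in_one[OF D] by (auto simp: coeffs_in_def lookup_one when_def)
    fix s t :: "'a zpoly" assume st: "s \<in> zpolys {}" "t \<in> zpolys {}" "s * t \<in> coeffs_in D {}"
    then have "lookup s {#} * lookup t {#} \<in> D"
      using in0[OF zpolys_closed(5)[OF st(1,2)]] by (simp add: lookup_times)
    then show "s \<in> coeffs_in D {} \<or> t \<in> coeffs_in D {}"
      using prime_in_mult[OF D] in0 st by blast
  qed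
next
  case (insert x W)
  interpret simple_ext "zpolys W" "zvar x" by (rule simple_ext_zpolys[OF insert(2)])
  show ?case
    using ext_prime[OF insert(3)] poly_ext_coeffs_in[OF insert(2) prime_in_ideal[OF D]] poly_ext_zpolys[OF insert(2)]
    by simp
qed

lemma zpolys_no_zero_divisors:
  assumes "finite W" "s \<in> zpolys W" "t \<in> zpolys W" "s * t = 0"
  shows "s = 0 \<or> t = 0"
proof -
  have "prime_in UNIV {0::int}" by (auto simp: prime_in_def ideal_in_def)
  from coeffs_in_prime[OF this assms(1)] have p: "prime_in (zpolys W) (coeffs_in {0} W)" .
  have "coeffs_in {0} W = {0}"
    using zpolys_closed(1) by (auto simp: coeffs_in_def intro!: poly_mapping_eqI)
  then show ?thesis using prime_in_mult[OF p assms(2,3)] assms(4) by auto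
qed

text \<open>The ideal \<open>p \<int>[W]\<close>, described by coefficients so that membership can
  be tested termwise; \<open>p_ideal_eq\<close> identifies it with the generated ideal.\<close>

definition pmult :: "nat \<Rightarrow> 'v set \<Rightarrow> 'v zpoly set" where
  "pmult p W = {t \<in> zpolys W. \<forall>m. int p dvd lookup t m}"

lemma pmult_coeffs_in: "pmult p W = coeffs_in {c. int p dvd c} W"
  by (auto simp: pmult_def coeffs_in_def)

lemma pmult_prime:
  assumes "Factorial_Ring.prime p" "finite W"
  shows "prime_in (zpolys W) (pmult p W)"
  unfolding pmult_coeffs_in
proof (rule coeffs_in_prime[OF _ assms(2)])
  show "prime_in UNIV {c. int p dvd c}"
    using assms(1) by (auto simp: prime_in_def ideal_in_def prime_dvd_mult_iff)
qed

lemma poly_ext_pmult: "x \<notin> W \<Longrightarrow> poly_ext (pmult p W) (zvar x) = pmult p (insert x W)"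
  unfolding pmult_coeffs_in by (rule poly_ext_coeffs_in) (auto simp: ideal_in_def)

section \<open>Chains of primes in polynomial rings\<close>

text \<open>The variables of \<open>F\<close> are removed one at a time. The induction closes
  because \<open>lift_prime\<close> also keeps a given element out: the element \<open>a'\<close>
  that the extension by \<open>x\<close> asks to avoid becomes the \<open>b\<close> of the remaining
  extensions.\<close>

lemma lift_prime_zpolys:
  assumes "finite F" "F \<inter> W = {}" "prime_in (zpolys (W \<union> F)) P" "b \<in> zpolys (W \<union> F) - P"
  shows "\<exists>a\<in>zpolys W - P. \<forall>q. prime_in (zpolys W) q \<longrightarrow> P \<inter> zpolys W \<subseteq> q \<longrightarrow> a \<notin> q \<longrightarrow>
    (\<exists>q'. prime_in (zpolys (W \<union> F)) q' \<and> P \<subseteq> q' \<and> q' \<inter> zpolys W = q \<and> b \<notin> q')"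
  using assms
proof (induction F arbitrary: P b rule: finite_induct)
  case empty
  then have "P \<subseteq> zpolys W" using ideal_in_subset[OF prime_in_ideal] by auto
  then show ?case using empty
  proof (intro bexI[of _ b] allI impI)
    fix q assume q: "prime_in (zpolys W) q" "P \<inter> zpolys W \<subseteq> q" "b \<notin> q"
    moreover have "q \<subseteq> zpolys W" using ideal_in_subset[OF prime_in_ideal[OF q(1)]] .
    ultimately show "\<exists>q'. prime_in (zpolys (W \<union> {})) q' \<and> P \<subseteq> q' \<and> q' \<inter> zpolys W = q \<and> b \<notin> q'"
      using \<open>P \<subseteq> zpolys W\<close> by (intro exI[of _ q]) auto
  qed auto
next
  case (insert x F)
  have x: "x \<notin> W \<union> F" using insert by auto
  interpret simple_ext "zpolys (W \<union> F)" "zvar x" by (rule simple_ext_zpolys[OF x])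
  have B: "B = zpolys (W \<union> insert x F)" using poly_ext_zpolys[OF x] by simp
  have WF: "zpolys W \<subseteq> zpolys (W \<union> F)" by (rule zpolys_mono) auto
  obtain a' where a': "a' \<in> zpolys (W \<union> F) - P"
    "\<And>q. prime_in (zpolys (W \<union> F)) q \<Longrightarrow> P \<inter> zpolys (W \<union> F) \<subseteq> q \<Longrightarrow> a' \<notin> q \<Longrightarrow>
       \<exists>q'. prime_in B q' \<and> P \<subseteq> q' \<and> q' \<inter> zpolys (W \<union> F) = q \<and> b \<notin> q'"
    using lift_prime[of P b] insert.prems unfolding B by metis
  have "prime_in (zpolys (W \<union> F)) (P \<inter> zpolys (W \<union> F))"
    by (rule prime_in_restrict[OF _ zpolys_subring zpolys_mono]) (use insert.prems in auto)
  then obtain a where a: "a \<in> zpolys W - P \<inter> zpolys (W \<union> F)"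
    "\<And>q. prime_in (zpolys W) q \<Longrightarrow> P \<inter> zpolys (W \<union> F) \<inter> zpolys W \<subseteq> q \<Longrightarrow> a \<notin> q \<Longrightarrow>
    \<exists>q'. prime_in (zpolys (W \<union> F)) q' \<and> P \<inter> zpolys (W \<union> F) \<subseteq> q' \<and> q' \<inter> zpolys W = q \<and> a' \<notin> q'"
    using insert.IH[of "P \<inter> zpolys (W \<union> F)" a'] insert.prems a'(1) by (metis (no_types, lifting) DiffE DiffI IntE Int_insert_left insert_disjoint(1))
  show ?case
  proof (intro bexI[of _ a] allI impI)
    show "a \<in> zpolys W - P" using a(1) WF by auto
    fix q assume q: "prime_in (zpolys W) q" "P \<inter> zpolys W \<subseteq> q" "a \<notin> q"
    then obtain q1 where q1: "prime_in (zpolys (W \<union> F)) q1" "P \<inter> zpolys (W \<union> F) \<subseteq> q1" "q1 \<inter> zpolys W = q" "a' \<notin> q1"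
      using a(2)[of q] by blast
    obtain q' where q': "prime_in B q'" "P \<subseteq> q'" "q' \<inter> zpolys (W \<union> F) = q1" "b \<notin> q'"
      using a'(2)[OF q1(1,2,4)] by blast
    moreover have "q' \<inter> zpolys W = q" using q'(3) q1(3) WF by blast
    ultimately show "\<exists>q'. prime_in (zpolys (W \<union> insert x F)) q' \<and> P \<subseteq> q' \<and> q' \<inter> zpolys W = q \<and> b \<notin> q'"
      unfolding B by blast
  qed
qed

text \<open>The contraction of \<open>P\<close> to \<open>\<int>[u, v]\<close> is the extension of
  \<open>pmult p u\<close>, so \<open>larger_prime\<close> enlarges it without changing the
  contraction to \<open>\<int>[u]\<close>. The enlarged prime must avoid the element
  \<open>a\<close> in order to lift to all variables.\<close>

lemma larger_prime_zpolys:
  assumes p: "Factorial_Ring.prime p" and V: "finite V" "insert v u \<subseteq> V" "v \<notin> u"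
    and P: "prime_in (zpolys V) P" "P \<inter> zpolys (insert v u) = pmult p (insert v u)"
  obtains P' where "prime_in (zpolys V) P'" "P \<subset> P'" "P' \<inter> zpolys u = pmult p u"
proof -
  interpret simple_ext "zpolys u" "zvar v" by (rule simple_ext_zpolys[OF V(3)])
  have B: "B = zpolys (insert v u)" by (rule poly_ext_zpolys[OF V(3)])
  have E: "poly_ext (pmult p u) (zvar v) = pmult p (insert v u)" by (rule poly_ext_pmult[OF V(3)])
  have fu: "finite u" using V(2) finite_subset[OF _ V(1), of u] by simp
  have Vu: "insert v u \<union> (V - insert v u) = V" using V by auto
  \<comment> \<open>No particular element has to be avoided in the full ring, so \<open>1\<close>
    takes the place of \<open>b\<close>.\<close>
  have "1 \<in> zpolys V - P" using prime_in_one[OF P(1)] zpolys_closed(2) by blast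
  have "finite (V - insert v u)" "(V - insert v u) \<inter> insert v u = {}" using V by auto
  from lift_prime_zpolys[OF this, unfolded Vu, OF P(1) \<open>1 \<in> zpolys V - P\<close>]
  have "\<exists>a\<in>zpolys (insert v u) - P. \<forall>q. prime_in (zpolys (insert v u)) q \<longrightarrow> P \<inter> zpolys (insert v u) \<subseteq> q \<longrightarrow> a \<notin> q \<longrightarrow>
    (\<exists>q'. prime_in (zpolys V) q' \<and> P \<subseteq> q' \<and> q' \<inter> zpolys (insert v u) = q \<and> 1 \<notin> q')" .
  then obtain a where a1: "a \<in> zpolys (insert v u) - P"
    and a2: "\<forall>q. prime_in (zpolys (insert v u)) q \<longrightarrow> P \<inter> zpolys (insert v u) \<subseteq> q \<longrightarrow> a \<notin> q \<longrightarrow>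
      (\<exists>q'. prime_in (zpolys V) q' \<and> P \<subseteq> q' \<and> q' \<inter> zpolys (insert v u) = q \<and> 1 \<notin> q')"
    by (rule bexE)
  have "a \<in> B" "a \<notin> poly_ext (pmult p u) (zvar v)" using a1 P(2) unfolding B E by auto
  then obtain q where q: "prime_in (zpolys (insert v u)) q" "pmult p (insert v u) \<subset> q" "q \<inter> zpolys u = pmult p u" "a \<notin> q"
    using larger_prime[OF pmult_prime[OF p fu], of a] unfolding B E by metis
  then obtain q' where q': "prime_in (zpolys V) q'" "P \<subseteq> q'" "q' \<inter> zpolys (insert v u) = q"
    using a2 P(2) by blast
  have "zpolys u \<subseteq> zpolys (insert v u)" by (rule zpolys_mono) auto
  then have "q' \<inter> zpolys u = pmult p u" using q' q(3) by blast
  moreover have "P \<noteq> q'" using q' q(2) P(2) by blast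
  ultimately show thesis using that q' by blast
qed

lemma prime_chain_zpolys:
  assumes p: "Factorial_Ring.prime p" and V: "finite V"
  shows "finite u \<Longrightarrow> u \<subseteq> V \<Longrightarrow> prime_in (zpolys V) P \<Longrightarrow> P \<inter> zpolys u = pmult p u \<Longrightarrow>
    \<exists>C. C 0 = P \<and> (\<forall>i\<le>card u. prime_in (zpolys V) (C i)) \<and> (\<forall>i<card u. C i \<subset> C (Suc i))"
proof (induction u arbitrary: P rule: finite_induct)
  case empty
  then show ?case by (intro exI[of _ "\<lambda>_. P"]) auto
next
  case (insert v u)
  obtain P' where P': "prime_in (zpolys V) P'" "P \<subset> P'" "P' \<inter> zpolys u = pmult p u"
    using larger_prime_zpolys[OF p V, of v u P] insert by metis
  then obtain C where C: "C 0 = P'" "\<forall>i\<le>card u. prime_in (zpolys V) (C i)" "\<forall>i<card u. C i \<subset> C (Suc i)"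
    using insert.IH[of P'] insert.prems by blast
  have cu: "card (insert v u) = Suc (card u)" using insert by simp
  show ?case
    unfolding cu
  proof (intro exI[of _ "case_nat P C"] conjI allI impI)
    fix i assume "i \<le> Suc (card u)"
    then show "prime_in (zpolys V) (case i of 0 \<Rightarrow> P | Suc i \<Rightarrow> C i)"
      using C insert.prems by (cases i) auto
  next
    fix i assume "i < Suc (card u)"
    then show "(case i of 0 \<Rightarrow> P | Suc i \<Rightarrow> C i) \<subset> (case Suc i of 0 \<Rightarrow> P | Suc i \<Rightarrow> C i)"
      using C P' by (cases i) auto
  qed simp
qed

text \<open>\<open>max\<close> states the dimension bound by chains of primes over the integers;
  reduction modulo \<open>p\<close> enters only when it is discharged. The sum is returned with its
  summands, because later a power of \<open>i\<close> is used to land in \<open>J\<close>.\<close>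

lemma ideal_meets_complement:
  assumes p: "Factorial_Ring.prime p" and V: "finite V" "u \<subseteq> V"
    and P: "prime_in (zpolys V) P" "P \<inter> zpolys u = pmult p u"
    and J: "ideal_in (zpolys V) J" "\<not> J \<subseteq> P"
    and max: "\<And>C. C 0 = P \<Longrightarrow> \<forall>i\<le>Suc (card u). prime_in (zpolys V) (C i) \<Longrightarrow> \<exists>i\<le>card u. \<not> C i \<subset> C (Suc i)"
  obtains i j where "i \<in> P" "j \<in> J" "i + j \<in> zpolys u - pmult p u"
proof -
  have fu: "finite u" by (rule finite_subset[OF V(2,1)])
  note Pi = prime_in_ideal[OF P(1)]
  let ?I = "{i + j | i j. i \<in> P \<and> j \<in> J}"
  have Ii: "ideal_in (zpolys V) ?I" by (rule ideal_in_sum[OF Pi J(1) zpolys_subring])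
  note c = prime_in_complement_mult[OF pmult_prime[OF p fu] zpolys_subring]
  have sub: "zpolys u - pmult p u \<subseteq> zpolys V" using zpolys_mono[OF V(2)] by blast
  have "?I \<inter> (zpolys u - pmult p u) \<noteq> {}"
  proof
    assume "?I \<inter> (zpolys u - pmult p u) = {}"
    from exists_prime_in[OF zpolys_subring Ii c(1) sub c(2) this]
    obtain q where q: "prime_in (zpolys V) q" "?I \<subseteq> q" "q \<inter> (zpolys u - pmult p u) = {}" .
    have Pq: "P \<subseteq> q" and Jq: "J \<subseteq> q" using ideal_in_sum_upper[OF Pi J(1)] q(2) by blast+
    have "q \<inter> zpolys u = pmult p u" using q(3) Pq P(2) by blast
    then obtain C where C: "C 0 = q" "\<forall>i\<le>card u. prime_in (zpolys V) (C i)" "\<forall>i<card u. C i \<subset> C (Suc i)"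
      using prime_chain_zpolys[OF p V(1) fu V(2) q(1)] by blast
    have "\<forall>i\<le>Suc (card u). prime_in (zpolys V) (case_nat P C i)"
      using C P(1) by (auto split: nat.split)
    then obtain i where i: "i \<le> card u" "\<not> case_nat P C i \<subset> case_nat P C (Suc i)"
      using max[of "case_nat P C"] by auto
    moreover have "P \<subset> C 0" using Pq Jq J(2) C(1) by blast
    ultimately show False using C(3) by (cases i) auto
  qed
  then show thesis using that by blast
qed

lemma (in ring) idealI_closed:
  assumes "I \<subseteq> carrier R" "I \<noteq> {}"
    and add: "\<And>x y. x \<in> I \<Longrightarrow> y \<in> I \<Longrightarrow> x \<oplus> y \<in> I"
    and l: "\<And>r x. x \<in> I \<Longrightarrow> r \<in> carrier R \<Longrightarrow> r \<otimes> x \<in> I"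
    and r: "\<And>r x. x \<in> I \<Longrightarrow> r \<in> carrier R \<Longrightarrow> x \<otimes> r \<in> I"
  shows "ideal I R"
proof (rule idealI[OF ring_axioms _ l r])
  show "subgroup I (add_monoid R)"
  proof (rule add.subgroupI)
    fix x assume x: "x \<in> I"
    then have "\<ominus> x = (\<ominus> \<one>) \<otimes> x" using assms(1) by (simp add: l_minus subsetD)
    then show "\<ominus> x \<in> I" using l[OF x, of "\<ominus> \<one>"] by simp
  qed (use assms in auto)
qed

section \<open>The ring of integer polynomials\<close>

lemma int_mpoly_cring: "cring (int_mpoly V)"
  by (rule cring.mpoly_ring_cring[OF int_is_cring])

lemma lookup_in_carrier [simp]: "lookup t \<in> carrier (int_mpoly V) \<longleftrightarrow> t \<in> zpolys V"
  by (auto simp: cring.mpoly_ring_simps[OF int_is_cring] zpolys_def)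

text \<open>Coefficient functions in the carrier have finite support, so each is some
  \<open>lookup t\<close>; as \<open>lookup\<close> is injective, questions on
  \<open>int_mpoly V\<close> can be settled in \<open>zpolys V\<close>.\<close>

lemma carrier_int_mpoly: "carrier (int_mpoly V) = lookup ` zpolys V"
proof -
  have "f \<in> lookup ` zpolys V" if "f \<in> carrier (int_mpoly V)" for f :: "'a multiset \<Rightarrow> int"
  proof -
    have "finite {m. f m \<noteq> 0}" using that by (simp add: cring.mpoly_ring_simps[OF int_is_cring])
    then have "f = lookup (Abs_poly_mapping f)" by simp
    then show ?thesis using that by (metis imageI lookup_in_carrier)
  qed
  then show ?thesis by auto
qed

lemma lookup_mult_int [simp]: "lookup s \<otimes>\<^bsub>int_mpoly V\<^esub> lookup t = lookup (s * t)"
  by (auto simp: cring.mpoly_ring_simps[OF int_is_cring] lookup_times int_finsum_eq)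

lemma lookup_add_int [simp]: "lookup s \<oplus>\<^bsub>int_mpoly V\<^esub> lookup t = lookup (s + t)"
  by (auto simp: cring.mpoly_ring_simps[OF int_is_cring] lookup_add)

lemma zero_int_mpoly: "\<zero>\<^bsub>int_mpoly V\<^esub> = lookup 0"
  by (auto simp: cring.mpoly_ring_simps[OF int_is_cring])

lemma one_int_mpoly: "\<one>\<^bsub>int_mpoly V\<^esub> = lookup 1"
  by (auto simp: cring.mpoly_ring_simps[OF int_is_cring] lookup_one when_def)

lemma lookup_pow_int [simp]: "lookup t [^]\<^bsub>int_mpoly V\<^esub> (n::nat) = lookup (t ^ n)"
proof (induction n)
  case (Suc n)
  then show ?case by (simp add: nat_pow_def mult.commute)
qed (simp add: nat_pow_def one_int_mpoly)

lemma int_const_lookup: "int_const c = lookup (Poly_Mapping.single {#} c)"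
  by (auto simp: ring.indexed_const_def[OF cring.axioms(1)[OF int_is_cring]] lookup_single when_def)

abbreviation pull :: "('v multiset \<Rightarrow> int) set \<Rightarrow> 'v zpoly set" where
  "pull C \<equiv> {t. lookup t \<in> C}"

lemma lookup_inj: "lookup s = lookup t \<longleftrightarrow> s = t"
  by (rule poly_mapping.lookup_inject)

lemma pull_image [simp]: "pull (lookup ` K) = K"
  by (auto simp: lookup_inj)

lemma image_pull:
  assumes "C \<subseteq> carrier (int_mpoly V)"
  shows "lookup ` pull C = C"
  using assms unfolding carrier_int_mpoly by blast

lemma ideal_in_pull:
  assumes "ideal C (int_mpoly V)"
  shows "ideal_in (zpolys V) (pull C)"
proof -
  interpret ideal C "int_mpoly V" by fact
  show ?thesis
    unfolding ideal_in_def
  proof (intro conjI ballI)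
    show "pull C \<subseteq> zpolys V" using a_subset by auto
    show "0 \<in> pull C" using additive_subgroup.zero_closed[OF additive_subgroup_axioms] by (simp add: zero_int_mpoly)
    show "s + t \<in> pull C" if "s \<in> pull C" "t \<in> pull C" for s t
      using additive_subgroup.a_closed[OF additive_subgroup_axioms, of "lookup s" "lookup t"] that by simp
    show "s * t \<in> pull C" if "s \<in> zpolys V" "t \<in> pull C" for s t
      using I_l_closed[of "lookup t" "lookup s"] that by simp
  qed
qed

lemma ideal_lookup:
  assumes "ideal_in (zpolys V) K"
  shows "ideal (lookup ` K) (int_mpoly V)"
proof -
  interpret cring "int_mpoly V" by (rule int_mpoly_cring)
  show ?thesis
  proof (rule idealI_closed)
    show "lookup ` K \<subseteq> carrier (int_mpoly V)" "lookup ` K \<noteq> {}"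
      using ideal_in_subset[OF assms] ideal_in_zero[OF assms] by auto
  next
    fix x y assume "x \<in> lookup ` K" "y \<in> lookup ` K"
    then show "x \<oplus>\<^bsub>int_mpoly V\<^esub> y \<in> lookup ` K" using ideal_in_add[OF assms] by auto
  next
    fix r x assume "x \<in> lookup ` K" "r \<in> carrier (int_mpoly V)"
    then obtain k s where "x = lookup k" "k \<in> K" "r = lookup s" "s \<in> zpolys V"
      unfolding carrier_int_mpoly by blast
    then show "r \<otimes>\<^bsub>int_mpoly V\<^esub> x \<in> lookup ` K" "x \<otimes>\<^bsub>int_mpoly V\<^esub> r \<in> lookup ` K"
      using ideal_in_mult[OF assms, of s k] by (auto simp: mult.commute)
  qed
qed

lemma prime_in_pull:
  assumes "primeideal C (int_mpoly V)"
  shows "prime_in (zpolys V) (pull C)"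
proof -
  interpret primeideal C "int_mpoly V" by fact
  show ?thesis
    unfolding prime_in_def
  proof (intro conjI ballI impI)
    show "ideal_in (zpolys V) (pull C)" by (rule ideal_in_pull[OF is_ideal])
    show "1 \<notin> pull C" using I_notcarr one_imp_carrier by (auto simp: one_int_mpoly)
    fix s t assume "s \<in> zpolys V" "t \<in> zpolys V" "s * t \<in> pull C"
    then show "s \<in> pull C \<or> t \<in> pull C" using I_prime[of "lookup s" "lookup t"] by simp
  qed
qed

lemma primeideal_lookup:
  assumes "prime_in (zpolys V) K"
  shows "primeideal (lookup ` K) (int_mpoly V)"
proof (rule primeidealI[OF ideal_lookup[OF prime_in_ideal[OF assms]] int_mpoly_cring])
  show "carrier (int_mpoly V) \<noteq> lookup ` K"
  proof
    assume "carrier (int_mpoly V) = lookup ` K"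
    then have "lookup 1 \<in> lookup ` K" using zpolys_closed(2) lookup_in_carrier by blast
    then show False using prime_in_one[OF assms] by (auto simp: lookup_inj)
  qed
next
  fix a b assume "a \<in> carrier (int_mpoly V)" "b \<in> carrier (int_mpoly V)" "a \<otimes>\<^bsub>int_mpoly V\<^esub> b \<in> lookup ` K"
  moreover then obtain s t where "a = lookup s" "s \<in> zpolys V" "b = lookup t" "t \<in> zpolys V"
    unfolding carrier_int_mpoly by blast
  ultimately show "a \<in> lookup ` K \<or> b \<in> lookup ` K"
    using prime_in_mult[OF assms, of s t] by (auto simp: lookup_inj)
qed

lemma pull_radical:
  "pull (radical (int_mpoly V) C) = {t \<in> zpolys V. \<exists>n. t ^ n \<in> pull C}"
  by (auto simp: radical_def)

lemma of_nat_single_empty: "(of_nat n :: 'v zpoly) = Poly_Mapping.single {#} (int n)"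
  by (metis single_of_nat zero_multiset_def)

lemma lookup_times_of_nat: "lookup (t * of_nat n) m = lookup t m * int n" for t :: "'v zpoly"
  by (simp only: of_nat_single_empty lookup_times_single) simp

lemma pmult_factor:
  assumes "t \<in> pmult p W"
  obtains t' where "t' \<in> zpolys W" "t = t' * of_nat p"
proof
  define t' where "t' = Poly_Mapping.map (\<lambda>c. c div int p) t"
  have l: "lookup t' m = lookup t m div int p" for m
    unfolding t'_def by (simp add: Poly_Mapping.map.rep_eq when_def)
  have "lookup t m \<noteq> 0" if "lookup t' m \<noteq> 0" for m using that by (auto simp: l)
  then show "t' \<in> zpolys W" using assms unfolding pmult_def zpolys_def by blast
  show "t = t' * of_nat p"
    using assms by (intro poly_mapping_eqI) (auto simp: lookup_times_of_nat l pmult_def)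
qed

lemma of_nat_in_zpolys: "of_nat n \<in> zpolys W"
  by (induction n) (auto intro: zpolys_closed)

lemma times_of_nat_in_pmult: "t \<in> zpolys W \<Longrightarrow> t * of_nat p \<in> pmult p W"
  by (auto simp: pmult_def lookup_times_of_nat intro: zpolys_closed of_nat_in_zpolys)

lemma int_const_of_nat: "int_const (int p) = lookup (of_nat p)"
  unfolding int_const_lookup of_nat_single_empty by (rule refl)

lemma p_ideal_eq: "p_ideal p W = lookup ` pmult p W"
proof -
  interpret cring "int_mpoly W" by (rule int_mpoly_cring)
  have "p_ideal p W = PIdl\<^bsub>int_mpoly W\<^esub> (int_const (int p))"
    using cgenideal_eq_genideal[of "int_const (int p)"] of_nat_in_zpolys[of p W]
    by (simp add: int_const_of_nat)
  also have "\<dots> = {x \<otimes>\<^bsub>int_mpoly W\<^esub> lookup (of_nat p) | x. x \<in> lookup ` zpolys W}"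
    by (simp add: cgenideal_def int_const_of_nat carrier_int_mpoly)
  also have "\<dots> = lookup ` pmult p W"
  proof (intro equalityI subsetI)
    fix x assume "x \<in> lookup ` pmult p W"
    then obtain t where "t \<in> pmult p W" "x = lookup t" by blast
    moreover from this(1) obtain t' where "t' \<in> zpolys W" "t = t' * of_nat p" by (rule pmult_factor)
    ultimately show "x \<in> {x \<otimes>\<^bsub>int_mpoly W\<^esub> lookup (of_nat p) | x. x \<in> lookup ` zpolys W}"
      by (auto intro!: exI[of _ "lookup t'"])
  qed (auto intro: times_of_nat_in_pmult)
  finally show ?thesis .
qed

section \<open>Coefficients with respect to the variables outside u\<close>

text \<open>The coefficient of \<open>m\<close> when \<open>f\<close> is read in
  \<open>\<int>[u][x - u]\<close>, repackaged as a polynomial so that the ring operations apply; it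
  is \<open>0\<close> when \<open>m\<close> involves a variable of \<open>u\<close>.\<close>

definition blockcoeff :: "'v set \<Rightarrow> 'v zpoly \<Rightarrow> 'v multiset \<Rightarrow> 'v zpoly" where
  "blockcoeff u f m = Abs_poly_mapping (nest u (lookup f) m)"

lemma lookup_blockcoeff: "lookup (blockcoeff u f m) = nest u (lookup f) m"
proof -
  have "{k. nest u (lookup f) m k \<noteq> 0} \<subseteq> (\<lambda>n. n - m) ` {n. lookup f n \<noteq> 0}"
    by (auto simp: nest_def intro!: image_eqI[of _ _ "m + _"])
  then have "finite {k. nest u (lookup f) m k \<noteq> 0}" by (rule finite_subset) simp
  then show ?thesis by (simp add: blockcoeff_def)
qed

lemma blockcoeff_in_zpolys: "blockcoeff u f m \<in> zpolys u"
  by (auto simp: zpolys_def lookup_blockcoeff nest_def split: if_splits)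

lemma blockcoeff_add: "blockcoeff u (f + g) m = blockcoeff u f m + blockcoeff u g m"
  by (rule poly_mapping_eqI) (simp add: lookup_blockcoeff lookup_add nest_def)

lemma blockcoeff_diff: "blockcoeff u (f - g) m = blockcoeff u f m - blockcoeff u g m"
  by (rule poly_mapping_eqI) (simp add: lookup_blockcoeff lookup_minus nest_def)

lemma blockcoeff_zero [simp]: "blockcoeff u 0 m = 0"
  by (rule poly_mapping_eqI) (simp add: lookup_blockcoeff nest_def)

lemma filter_mset_eq_empty: "(\<And>x. x \<in># m \<Longrightarrow> \<not> Q x) \<Longrightarrow> filter_mset Q m = {#}"
  by (induction m) auto

lemma filter_mset_eq_self: "(\<And>x. x \<in># m \<Longrightarrow> Q x) \<Longrightarrow> filter_mset Q m = m"
  by (induction m) auto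

text \<open>If \<open>m\<close> is outside \<open>u\<close> and \<open>n\<close> inside, each
  divisor of \<open>m + n\<close> splits uniquely into a divisor of \<open>m\<close> and one of
  \<open>n\<close>. The sum over divisors of \<open>m + n\<close> thus becomes a double sum.\<close>

lemma blockcoeff_mult:
  "blockcoeff u (f * g) m = (\<Sum>k | k \<subseteq># m. blockcoeff u f k * blockcoeff u g (m - k))"
proof (rule poly_mapping_eqI)
  fix n
  let ?r = "\<lambda>k. \<Sum>l | l \<subseteq># n. nest u (lookup f) k l * nest u (lookup g) (m - k) (n - l)"
  have r: "lookup (\<Sum>k | k \<subseteq># m. blockcoeff u f k * blockcoeff u g (m - k)) n = (\<Sum>k | k \<subseteq># m. ?r k)"
    by (simp add: lookup_sum lookup_times lookup_blockcoeff)
  show "lookup (blockcoeff u (f * g) m) n = lookup (\<Sum>k | k \<subseteq># m. blockcoeff u f k * blockcoeff u g (m - k)) n"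
  proof (cases "set_mset m \<inter> u = {} \<and> set_mset n \<subseteq> u")
    case True
    have bij: "bij_betw (\<lambda>(k, l). k + l) ({k. k \<subseteq># m} \<times> {l. l \<subseteq># n}) {k. k \<subseteq># m + n}"
    proof (rule bij_betw_byWitness[where f' = "\<lambda>k. (filter_mset (\<lambda>v. v \<notin> u) k, filter_mset (\<lambda>v. v \<in> u) k)"])
      have a: "filter_mset (\<lambda>v. v \<notin> u) k = k" "filter_mset (\<lambda>v. v \<in> u) k = {#}" if "k \<subseteq># m" for k
        using True mset_subset_eqD[OF that] by (intro filter_mset_eq_self filter_mset_eq_empty; blast)+
      have b: "filter_mset (\<lambda>v. v \<notin> u) l = {#}" "filter_mset (\<lambda>v. v \<in> u) l = l" if "l \<subseteq># n" for l
        using True mset_subset_eqD[OF that] by (intro filter_mset_eq_self filter_mset_eq_empty; blast)+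
      show "\<forall>z\<in>{k. k \<subseteq># m} \<times> {l. l \<subseteq># n}. (\<lambda>k. (filter_mset (\<lambda>v. v \<notin> u) k, filter_mset (\<lambda>v. v \<in> u) k)) (case z of (k, l) \<Rightarrow> k + l) = z"
        using a b by auto
      show "\<forall>k\<in>{k. k \<subseteq># m + n}. (case (filter_mset (\<lambda>v. v \<notin> u) k, filter_mset (\<lambda>v. v \<in> u) k) of (k, l) \<Rightarrow> k + l) = k"
        by (auto simp: union_filter_mset_complement)
      show "(\<lambda>(k, l). k + l) ` ({k. k \<subseteq># m} \<times> {l. l \<subseteq># n}) \<subseteq> {k. k \<subseteq># m + n}"
        by (auto intro: subset_mset.add_mono)
      show "(\<lambda>k. (filter_mset (\<lambda>v. v \<notin> u) k, filter_mset (\<lambda>v. v \<in> u) k)) ` {k. k \<subseteq># m + n} \<subseteq> {k. k \<subseteq># m} \<times> {l. l \<subseteq># n}"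
      proof
        fix z assume "z \<in> (\<lambda>k. (filter_mset (\<lambda>v. v \<notin> u) k, filter_mset (\<lambda>v. v \<in> u) k)) ` {k. k \<subseteq># m + n}"
        then obtain k where k: "k \<subseteq># m + n" "z = (filter_mset (\<lambda>v. v \<notin> u) k, filter_mset (\<lambda>v. v \<in> u) k)" by blast
        have "filter_mset (\<lambda>v. v \<notin> u) k \<subseteq># filter_mset (\<lambda>v. v \<notin> u) (m + n)"
          "filter_mset (\<lambda>v. v \<in> u) k \<subseteq># filter_mset (\<lambda>v. v \<in> u) (m + n)"
          by (rule multiset_filter_mono[OF k(1)])+
        then show "z \<in> {k. k \<subseteq># m} \<times> {l. l \<subseteq># n}" using k(2) a[of m] b[of n] by simp
      qed
    qed
    have "lookup (blockcoeff u (f * g) m) n = (\<Sum>k | k \<subseteq># m + n. lookup f k * lookup g (m + n - k))"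
      using True by (simp add: lookup_blockcoeff nest_def lookup_times)
    also have "\<dots> = (\<Sum>(k, l)\<in>{k. k \<subseteq># m} \<times> {l. l \<subseteq># n}. lookup f (k + l) * lookup g (m + n - (k + l)))"
      using sum.reindex_bij_betw[OF bij, of "\<lambda>k. lookup f k * lookup g (m + n - k)"] by (simp add: case_prod_unfold)
    also have "\<dots> = (\<Sum>(k, l)\<in>{k. k \<subseteq># m} \<times> {l. l \<subseteq># n}. nest u (lookup f) k l * nest u (lookup g) (m - k) (n - l))"
    proof (intro sum.cong refl, clarify)
      fix k l assume kl: "k \<subseteq># m" "l \<subseteq># n"
      have "set_mset k \<subseteq> set_mset m" "set_mset l \<subseteq> set_mset n" "set_mset (m - k) \<subseteq> set_mset m" "set_mset (n - l) \<subseteq> set_mset n"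
        using kl by (auto dest: mset_subset_eqD in_diffD)
      moreover have "m + n - (k + l) = (m - k) + (n - l)"
        using kl by (auto simp: subseteq_mset_def intro!: multiset_eqI)
      ultimately show "lookup f (k + l) * lookup g (m + n - (k + l)) = nest u (lookup f) k l * nest u (lookup g) (m - k) (n - l)"
        using True by (auto simp: nest_def)
    qed
    also have "\<dots> = (\<Sum>k | k \<subseteq># m. ?r k)" by (simp add: sum.cartesian_product)
    finally show ?thesis using r by simp
  next
    case False
    \<comment> \<open>If \<open>m\<close> meets \<open>u\<close> or \<open>n\<close> leaves
      \<open>u\<close>, the same happens to a part in any decomposition, so every product
      vanishes.\<close>
    have z: "nest u (lookup f) k l * nest u (lookup g) (m - k) (n - l) = 0" if kl: "k \<subseteq># m" "l \<subseteq># n" for k l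
    proof (rule ccontr)
      assume "\<not> ?thesis"
      then have "set_mset k \<inter> u = {}" "set_mset l \<subseteq> u" "set_mset (m - k) \<inter> u = {}" "set_mset (n - l) \<subseteq> u"
        by (auto simp: nest_def split: if_splits)
      moreover have "m = k + (m - k)" "n = l + (n - l)" using kl by auto
      ultimately show False using False by (metis Int_Un_distrib2 Un_empty Un_subset_iff set_mset_union)
    qed
    have "(\<Sum>k | k \<subseteq># m. ?r k) = 0"
    proof (rule sum.neutral, rule ballI, rule sum.neutral, rule ballI)
      fix k l assume "k \<in> {k. k \<subseteq># m}" "l \<in> {l. l \<subseteq># n}"
      then show "nest u (lookup f) k l * nest u (lookup g) (m - k) (n - l) = 0" by (intro z) auto
    qed
    moreover have "lookup (blockcoeff u (f * g) m) n = 0"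
      using False by (auto simp: lookup_blockcoeff nest_def)
    ultimately show ?thesis using r by simp
  qed
qed

lemma blockcoeff_const:
  assumes "a \<in> zpolys u"
  shows "blockcoeff u a m = (if m = {#} then a else 0)"
proof (rule poly_mapping_eqI)
  fix k
  have "lookup a (m + k) = 0" if "m \<noteq> {#}" "set_mset m \<inter> u = {}"
  proof (rule ccontr)
    assume "lookup a (m + k) \<noteq> 0"
    then have "set_mset (m + k) \<subseteq> u" using assms unfolding zpolys_def by blast
    then show False using that by auto
  qed
  moreover have "lookup a k = 0" if "\<not> set_mset k \<subseteq> u" using that assms by (auto simp: zpolys_def)
  ultimately show "lookup (blockcoeff u a m) k = lookup (if m = {#} then a else 0) k"
    by (auto simp: lookup_blockcoeff nest_def)
qed

lemma blockcoeff_const_mult: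
  assumes "a \<in> zpolys u"
  shows "blockcoeff u (a * f) m = a * blockcoeff u f m"
proof -
  have "blockcoeff u (a * f) m = (\<Sum>k | k \<subseteq># m. if k = {#} then a * blockcoeff u f m else 0)"
    unfolding blockcoeff_mult by (intro sum.cong) (auto simp: blockcoeff_const[OF assms])
  then show ?thesis by simp
qed

lemma blockcoeff_monom_mult:
  assumes "set_mset n \<inter> u = {}"
  shows "blockcoeff u (Poly_Mapping.single n 1 * f) m = (if n \<subseteq># m then blockcoeff u f (m - n) else 0)"
proof -
  have "blockcoeff u (Poly_Mapping.single n 1) k = (if k = n then 1 else 0)" for k
  proof (rule poly_mapping_eqI)
    fix l
    have "n = k + l \<Longrightarrow> set_mset l \<subseteq> u \<Longrightarrow> l = {#}" using assms by auto
    then show "lookup (blockcoeff u (Poly_Mapping.single n 1) k) l = lookup (if k = n then 1 else 0) l"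
      using assms by (auto simp: lookup_blockcoeff nest_def lookup_single lookup_one when_def)
  qed
  then have "blockcoeff u (Poly_Mapping.single n 1 * f) m
      = (\<Sum>k | k \<subseteq># m. if k = n then blockcoeff u f (m - n) else 0)"
    unfolding blockcoeff_mult by (intro sum.cong) auto
  then show ?thesis by simp
qed

lemma lookup_split:
  "lookup f m = lookup (blockcoeff u f (filter_mset (\<lambda>v. v \<notin> u) m)) (filter_mset (\<lambda>v. v \<in> u) m)"
proof -
  have "filter_mset (\<lambda>v. v \<notin> u) m + filter_mset (\<lambda>v. v \<in> u) m = m"
    by (metis add.commute multiset_partition)
  then show ?thesis by (auto simp: lookup_blockcoeff nest_def)
qed

lemma blockcoeff_nonzero:
  assumes "blockcoeff u f m \<noteq> 0"
  obtains k where "lookup f (m + k) \<noteq> 0" "set_mset m \<inter> u = {}" "set_mset k \<subseteq> u"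
  using assms by (auto simp: poly_mapping_eq_iff lookup_blockcoeff nest_def fun_eq_iff split: if_splits)

lemma blockcoeff_eq_zero: "(\<forall>m. blockcoeff u f m = 0) \<Longrightarrow> f = 0"
  by (rule poly_mapping_eqI) (simp add: lookup_split[of f _ u])

lemma finite_blockcoeff: "finite {m. blockcoeff u f m \<noteq> 0}"
proof (rule finite_subset)
  show "{m. blockcoeff u f m \<noteq> 0} \<subseteq> filter_mset (\<lambda>v. v \<notin> u) ` {m. lookup f m \<noteq> 0}"
  proof
    fix m assume "m \<in> {m. blockcoeff u f m \<noteq> 0}"
    then have "blockcoeff u f m \<noteq> 0" by simp
    then obtain k where k: "lookup f (m + k) \<noteq> 0" "set_mset m \<inter> u = {}" "set_mset k \<subseteq> u"
      by (rule blockcoeff_nonzero)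
    have "filter_mset (\<lambda>v. v \<notin> u) m = m" "filter_mset (\<lambda>v. v \<notin> u) k = {#}"
      using k(2,3) by (intro filter_mset_eq_self filter_mset_eq_empty; blast)+
    then have "filter_mset (\<lambda>v. v \<notin> u) (m + k) = m" by simp
    then show "m \<in> filter_mset (\<lambda>v. v \<notin> u) ` {m. lookup f m \<noteq> 0}"
      using k(1) by (intro image_eqI[of _ _ "m + k"]) auto
  qed
qed simp

lemma blockcoeff_supp:
  assumes "f \<in> zpolys V" "blockcoeff u f m \<noteq> 0"
  shows "set_mset m \<subseteq> V - u"
proof -
  obtain k where k: "lookup f (m + k) \<noteq> 0" "set_mset m \<inter> u = {}"
    using blockcoeff_nonzero[OF assms(2)] by metis
  then have "set_mset (m + k) \<subseteq> V" using assms(1) unfolding zpolys_def by blast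
  then show ?thesis using k(2) by auto
qed

section \<open>The localized coefficient ring\<close>

lemma sum_in_zpolys: "(\<And>k. k \<in> K \<Longrightarrow> h k \<in> zpolys W) \<Longrightarrow> sum h K \<in> zpolys W"
  by (induction K rule: infinite_finite_induct) (auto intro: zpolys_closed)

locale localized_coeffs =
  fixes p :: nat and V u :: "'v set"
  assumes prime_p: "Factorial_Ring.prime p" and fin_V: "finite V" and u_V: "u \<subseteq> V"
begin

abbreviation "R \<equiv> coeff_ring p u"
abbreviation "M \<equiv> mpoly_ring R (V - u)"

definition S :: "'v zpoly set" where
  "S = zpolys u - pmult p u"

lemma S_u [simp]: "s \<in> S \<Longrightarrow> s \<in> zpolys u"
  by (simp add: S_def)

lemma fin_u: "finite u"
  by (rule finite_subset[OF u_V fin_V])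

lemma u_in_V: "a \<in> zpolys u \<Longrightarrow> a \<in> zpolys V"
  using zpolys_mono[OF u_V] by blast

lemmas S_one [simp] = prime_in_complement_mult(1)[OF pmult_prime[OF prime_p fin_u] zpolys_subring, folded S_def]
lemmas S_mult = prime_in_complement_mult(2)[OF pmult_prime[OF prime_p fin_u] zpolys_subring, folded S_def]

lemma S_power: "s \<in> S \<Longrightarrow> s ^ n \<in> S"
  by (induction n) (use S_mult S_one in auto)

lemma S_nonzero: "s \<in> S \<Longrightarrow> s \<noteq> 0"
  using ideal_in_zero[OF prime_in_ideal[OF pmult_prime[OF prime_p fin_u]]] unfolding S_def by blast

lemma mult_cancel_u: "c \<in> zpolys V \<Longrightarrow> a \<in> zpolys V \<Longrightarrow> b \<in> zpolys V \<Longrightarrow> c \<noteq> 0 \<Longrightarrow> c * a = c * b \<longleftrightarrow> a = b"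
  using zpolys_no_zero_divisors[OF fin_V, of c "a - b"] zpolys_closed(4)[of a V b]
  by (auto simp: algebra_simps)

lemma S_eq: "carrier (int_mpoly u) - p_ideal p u = lookup ` S"
  unfolding p_ideal_eq carrier_int_mpoly S_def by (auto simp: lookup_inj)

sublocale loc: cring_mult_set "int_mpoly u" "lookup ` S"
proof -
  interpret cring "int_mpoly u" by (rule int_mpoly_cring)
  show "cring_mult_set (int_mpoly u) (lookup ` S)"
  proof
    show "\<one>\<^bsub>int_mpoly u\<^esub> \<in> lookup ` S" using S_one by (auto simp: one_int_mpoly)
    fix s t assume "s \<in> lookup ` S" "t \<in> lookup ` S"
    then show "s \<otimes>\<^bsub>int_mpoly u\<^esub> t \<in> lookup ` S"
      using S_mult by auto
  qed auto
qed

lemma R_eq: "R = localization (int_mpoly u) (lookup ` S)"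
  by (simp add: localization_at_def S_eq)

definition frq :: "'v zpoly \<Rightarrow> 'v zpoly \<Rightarrow> (('v multiset \<Rightarrow> int) \<times> ('v multiset \<Rightarrow> int)) set" where
  "frq a s = frac_class (int_mpoly u) (lookup ` S) (lookup a) (lookup s)"

lemma R_cring: "cring R"
  unfolding R_eq by (rule loc.localization_cring)

lemma M_cring: "cring M"
  by (rule cring.mpoly_ring_cring[OF R_cring])

lemma carrier_R: "x \<in> carrier R \<longleftrightarrow> (\<exists>a\<in>zpolys u. \<exists>s\<in>S. x = frq a s)"
  unfolding R_eq loc.carrier_localization frq_def carrier_int_mpoly by blast

lemma frq_in_R [simp]: "a \<in> zpolys u \<Longrightarrow> s \<in> S \<Longrightarrow> frq a s \<in> carrier R"
  using carrier_R by blast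

text \<open>\<open>\<int>[u]\<close> is a domain and \<open>0\<close> is not in \<open>S\<close>, so
  the auxiliary factor \<open>w\<close> cancels and equality of fractions is
  cross-multiplication.\<close>

lemma frq_eq_iff:
  assumes "a \<in> zpolys u" "s \<in> S" "b \<in> zpolys u" "t \<in> S"
  shows "frq a s = frq b t \<longleftrightarrow> t * a = s * b"
proof -
  have "frq a s = frq b t \<longleftrightarrow> (\<exists>w\<in>S. w * (t * a) = w * (s * b))"
    using assms unfolding frq_def by (subst loc.frac_eq_iff) (auto simp: lookup_inj)
  also have "\<dots> \<longleftrightarrow> t * a = s * b"
  proof
    assume "\<exists>w\<in>S. w * (t * a) = w * (s * b)"
    then obtain w where w: "w \<in> S" "w * (t * a) = w * (s * b)" by blast
    have "w \<in> zpolys V" "t * a \<in> zpolys V" "s * b \<in> zpolys V"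
      using w(1) assms by (auto intro!: u_in_V zpolys_closed)
    then show "t * a = s * b" using mult_cancel_u S_nonzero[OF w(1)] w(2) by blast
  qed (use S_one in metis)
  finally show ?thesis .
qed

lemma frq_mult:
  assumes "a \<in> zpolys u" "s \<in> S" "b \<in> zpolys u" "t \<in> S"
  shows "frq a s \<otimes>\<^bsub>R\<^esub> frq b t = frq (a * b) (s * t)"
  using assms unfolding frq_def R_eq by (subst loc.frac_mult) auto

lemma frq_add:
  assumes "a \<in> zpolys u" "s \<in> S" "b \<in> zpolys u" "t \<in> S"
  shows "frq a s \<oplus>\<^bsub>R\<^esub> frq b t = frq (t * a + s * b) (s * t)"
  using assms unfolding frq_def R_eq by (subst loc.frac_add) auto

lemma R_zero: "\<zero>\<^bsub>R\<^esub> = frq 0 1"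
  unfolding R_eq loc.localization_zero frq_def by (simp add: zero_int_mpoly one_int_mpoly)

lemma to_coeff_ring_lookup: "to_coeff_ring p u (lookup a) = frq a 1"
  by (simp add: to_localization_at_def S_eq frq_def one_int_mpoly)

lemma frq_cancel: "a \<in> zpolys u \<Longrightarrow> s \<in> S \<Longrightarrow> t \<in> S \<Longrightarrow> frq (t * a) (t * s) = frq a s"
  by (subst frq_eq_iff) (auto intro!: zpolys_closed S_mult simp: algebra_simps)

lemma embed_lookup: "embed p u (lookup f) m = frq (blockcoeff u f m) 1"
  unfolding embed_def lookup_blockcoeff[symmetric] to_coeff_ring_lookup ..

lemma frq_1_inj: "a \<in> zpolys u \<Longrightarrow> b \<in> zpolys u \<Longrightarrow> frq a 1 = frq b 1 \<longleftrightarrow> a = b"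
  by (subst frq_eq_iff) auto

lemma frq_eq_zero: "a \<in> zpolys u \<Longrightarrow> s \<in> S \<Longrightarrow> frq a s = \<zero>\<^bsub>R\<^esub> \<longleftrightarrow> a = 0"
  using S_one zpolys_closed(1) unfolding R_zero by (subst frq_eq_iff) auto

lemma embed_nonzero_iff: "embed p u (lookup f) m \<noteq> \<zero>\<^bsub>R\<^esub> \<longleftrightarrow> blockcoeff u f m \<noteq> 0"
  unfolding embed_lookup using S_one by (simp add: frq_eq_zero blockcoeff_in_zpolys)

lemma embed_in_M: "f \<in> zpolys V \<Longrightarrow> embed p u (lookup f) \<in> carrier M"
  unfolding cring.carrier_mpoly_ring[OF R_cring] embed_nonzero_iff
  using finite_blockcoeff[of u f] blockcoeff_supp[of f V u] by (simp add: embed_lookup blockcoeff_in_zpolys)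

lemma finsum_frq:
  assumes "\<And>k. k \<in> K \<Longrightarrow> h k \<in> zpolys u" "finite K"
  shows "finsum R (\<lambda>k. frq (h k) 1) K = frq (sum h K) 1"
proof -
  interpret R: cring R by (rule R_cring)
  show ?thesis using assms(2,1)
  proof (induction K rule: finite_induct)
    case (insert k K)
    have "sum h K \<in> zpolys u" using insert by (intro sum_in_zpolys) auto
    then show ?case using insert by (subst R.finsum_insert) (simp_all add: frq_add Pi_iff)
  qed (simp add: R_zero)
qed

text \<open>\<open>clears s f F\<close> says that \<open>F = f / s\<close>.\<close>

definition clears :: "'v zpoly \<Rightarrow> 'v zpoly \<Rightarrow> ('v multiset \<Rightarrow> (('v multiset \<Rightarrow> int) \<times> ('v multiset \<Rightarrow> int)) set) \<Rightarrow> bool" where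
  "clears s f F \<longleftrightarrow> s \<in> S \<and> f \<in> zpolys V \<and> (\<forall>m. F m = frq (blockcoeff u f m) s)"

text \<open>Induction on the finite support: a further coefficient \<open>a / t\<close> at the
  monomial \<open>n\<close> is absorbed by passing from numerator \<open>f\<close> over
  \<open>s\<close> to numerator \<open>g\<close> over \<open>s * t\<close>.\<close>

lemma common_denominator:
  assumes "F \<in> carrier M"
  obtains s f where "clears s f F"
proof -
  interpret R: cring R by (rule R_cring)
  have "\<exists>s f. clears s f F"
    if "finite K" "\<And>m. F m \<in> carrier R" "\<And>m. F m \<noteq> \<zero>\<^bsub>R\<^esub> \<Longrightarrow> m \<in> K" "\<And>m. m \<in> K \<Longrightarrow> set_mset m \<subseteq> V - u" for F K
    using that
  proof (induction K arbitrary: F rule: finite_induct)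
    case empty
    then have "F m = \<zero>\<^bsub>R\<^esub>" for m by blast
    then have "clears 1 0 F" using S_one zpolys_closed(1) by (auto simp: clears_def R_zero)
    then show ?case by blast
  next
    case (insert n K)
    have "\<exists>s f. clears s f (F(n := \<zero>\<^bsub>R\<^esub>))"
    proof (rule insert.IH)
      show "(F(n := \<zero>\<^bsub>R\<^esub>)) m \<in> carrier R" for m using insert.prems(1) by simp
      show "m \<in> K" if "(F(n := \<zero>\<^bsub>R\<^esub>)) m \<noteq> \<zero>\<^bsub>R\<^esub>" for m
        using that insert.prems(2)[of m] by (auto split: if_splits)
    qed (use insert.prems in blast)
    then obtain s f where sf: "s \<in> S" "f \<in> zpolys V" "\<And>m. (F(n := \<zero>\<^bsub>R\<^esub>)) m = frq (blockcoeff u f m) s"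
      unfolding clears_def by blast
    obtain a t where at: "a \<in> zpolys u" "t \<in> S" "F n = frq a t"
      using insert.prems(1)[of n] carrier_R by blast
    have nu: "set_mset n \<inter> u = {}" "set_mset n \<subseteq> V" using insert.prems(3)[of n] by auto
    have fn: "blockcoeff u f n = 0"
      using sf(3)[of n] frq_eq_zero[OF blockcoeff_in_zpolys sf(1)] by (metis fun_upd_same)
    define g where "g = t * f + (s * a) * Poly_Mapping.single n 1"
    have tu: "t \<in> zpolys u" "s \<in> zpolys u" "s * a \<in> zpolys u"
      using at sf(1) by (auto intro: zpolys_closed)
    have gV: "g \<in> zpolys V"
      unfolding g_def
      by (intro zpolys_closed(3,5) single_in_zpolys u_in_V[OF tu(1)] u_in_V[OF tu(3)] sf(2) nu(2))
    have bg: "blockcoeff u g m = t * blockcoeff u f m + (if m = n then s * a else 0)" for m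
    proof -
      have "blockcoeff u (s * a * Poly_Mapping.single n 1) m = (if n \<subseteq># m then blockcoeff u (s * a) (m - n) else 0)"
        using blockcoeff_monom_mult[OF nu(1), of "s * a" m] by (simp add: mult.commute)
      moreover have "n \<subseteq># m \<and> m - n = {#} \<longleftrightarrow> m = n"
        by (metis diff_empty subset_mset.add_diff_inverse subset_mset.diff_add subset_mset.order_refl Multiset.diff_cancel add.right_neutral)
      ultimately show ?thesis
        unfolding g_def blockcoeff_add blockcoeff_const_mult[OF tu(1)] blockcoeff_const[OF tu(3)] by auto
    qed
    have "F m = frq (blockcoeff u g m) (s * t)" for m
    proof (cases "m = n")
      case True
      then show ?thesis using at fn bg frq_cancel[OF at(1,2) sf(1)] by simp
    next
      case False
      then have "F m = frq (blockcoeff u f m) s" using sf(3)[of m] by simp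
      also have "\<dots> = frq (t * blockcoeff u f m) (t * s)"
        by (rule frq_cancel[OF blockcoeff_in_zpolys sf(1) at(2), symmetric])
      finally show ?thesis using False bg by (simp add: mult.commute)
    qed
    then have "clears (s * t) g F" unfolding clears_def using S_mult[OF sf(1) at(2)] gV by blast
    then show ?case by blast
  qed
  from this[of "{m. F m \<noteq> \<zero>\<^bsub>R\<^esub>}" F] assms show thesis
    using that unfolding cring.carrier_mpoly_ring[OF R_cring] by blast
qed

text \<open>Separates the denominator as a constant polynomial, so that a fraction with numerator in
  an ideal is seen to lie in the extended ideal.\<close>

lemma clears_embed:
  assumes "clears s f F"
  shows "F = (\<lambda>m. if m = {#} then frq 1 s else \<zero>\<^bsub>R\<^esub>) \<otimes>\<^bsub>M\<^esub> embed p u (lookup f)"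
proof
  fix m
  interpret R: cring R by (rule R_cring)
  have s: "s \<in> S" and F: "F m = frq (blockcoeff u f m) s" using assms by (auto simp: clears_def)
  have f1: "frq 1 s \<in> carrier R" using s zpolys_closed(2) by simp
  have bc: "frq (blockcoeff u f k) 1 \<in> carrier R" for k
    using S_one by (intro frq_in_R blockcoeff_in_zpolys)
  have "finsum R (\<lambda>k. (if k = {#} then frq 1 s else \<zero>\<^bsub>R\<^esub>) \<otimes>\<^bsub>R\<^esub> frq (blockcoeff u f (m - k)) 1) {k. k \<subseteq># m}
      = frq 1 s \<otimes>\<^bsub>R\<^esub> frq (blockcoeff u f m) 1"
    using R.finsum_single[of "{k. k \<subseteq># m}" "{#}" "\<lambda>k. (if k = {#} then frq 1 s else \<zero>\<^bsub>R\<^esub>) \<otimes>\<^bsub>R\<^esub> frq (blockcoeff u f (m - k)) 1"]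
      f1 bc by simp
  also have "\<dots> = F m"
    unfolding F using frq_mult[OF zpolys_closed(2) s blockcoeff_in_zpolys S_one, of f m] by simp
  finally show "F m = ((\<lambda>m. if m = {#} then frq 1 s else \<zero>\<^bsub>R\<^esub>) \<otimes>\<^bsub>M\<^esub> embed p u (lookup f)) m"
    unfolding cring.mult_mpoly_ring[OF R_cring] embed_lookup by simp
qed

lemma const_in_M: "c \<in> carrier R \<Longrightarrow> (\<lambda>m. if m = {#} then c else \<zero>\<^bsub>R\<^esub>) \<in> carrier M"
proof -
  assume "c \<in> carrier R"
  moreover interpret R: cring R by (rule R_cring)
  have "finite {m. (if m = {#} then c else \<zero>\<^bsub>R\<^esub>) \<noteq> \<zero>\<^bsub>R\<^esub>}"
    by (rule finite_subset[of _ "{{#}}"]) auto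
  ultimately show ?thesis unfolding cring.carrier_mpoly_ring[OF R_cring] by auto
qed

lemma clears_in_M: "clears s f F \<Longrightarrow> F \<in> carrier M"
proof -
  assume c: "clears s f F"
  interpret M: cring M by (rule M_cring)
  show ?thesis
    using c zpolys_closed(2) unfolding clears_embed[OF c] 
    by (intro M.m_closed const_in_M embed_in_M) (auto simp: clears_def)
qed

lemma clears_add:
  assumes "clears s f F" "clears t g G"
  shows "clears (s * t) (t * f + s * g) (F \<oplus>\<^bsub>M\<^esub> G)"
proof -
  have st: "s \<in> S" "t \<in> S" "f \<in> zpolys V" "g \<in> zpolys V"
    and F: "F m = frq (blockcoeff u f m) s" and G: "G m = frq (blockcoeff u g m) t" for m
    using assms by (auto simp: clears_def)
  have "t * f + s * g \<in> zpolys V" using st by (simp add: zpolys_closed u_in_V)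
  moreover have "(F \<oplus>\<^bsub>M\<^esub> G) m = frq (blockcoeff u (t * f + s * g) m) (s * t)" for m
    unfolding cring.add_mpoly_ring[OF R_cring] F G blockcoeff_add
    using st by (simp add: frq_add blockcoeff_in_zpolys blockcoeff_const_mult)
  ultimately show ?thesis unfolding clears_def using S_mult[OF st(1,2)] by blast
qed

lemma clears_mult:
  assumes "clears s f F" "clears t g G"
  shows "clears (s * t) (f * g) (F \<otimes>\<^bsub>M\<^esub> G)"
proof -
  interpret R: cring R by (rule R_cring)
  have st: "s \<in> S" "t \<in> S" "f \<in> zpolys V" "g \<in> zpolys V"
    and F: "F m = frq (blockcoeff u f m) s" and G: "G m = frq (blockcoeff u g m) t" for m
    using assms by (auto simp: clears_def)
  have st': "s * t \<in> S" by (rule S_mult[OF st(1,2)])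
  have "(F \<otimes>\<^bsub>M\<^esub> G) m = frq (blockcoeff u (f * g) m) (s * t)" for m
  proof -
    \<comment> \<open>The common denominator is moved into a second factor that does not depend on
      \<open>k\<close>, so that it can leave the sum.\<close>
    have "(F \<otimes>\<^bsub>M\<^esub> G) m = finsum R (\<lambda>k. frq (blockcoeff u f k * blockcoeff u g (m - k)) 1 \<otimes>\<^bsub>R\<^esub> frq 1 (s * t)) {k. k \<subseteq># m}"
      unfolding cring.mult_mpoly_ring[OF R_cring] F G
      using st st' S_one by (intro R.finsum_cong') (auto simp: frq_mult blockcoeff_in_zpolys zpolys_closed)
    also have "\<dots> = finsum R (\<lambda>k. frq (blockcoeff u f k * blockcoeff u g (m - k)) 1) {k. k \<subseteq># m} \<otimes>\<^bsub>R\<^esub> frq 1 (s * t)"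
      using st' S_one by (intro R.finsum_ldistr[symmetric]) (auto simp: blockcoeff_in_zpolys zpolys_closed)
    also have "\<dots> = frq (blockcoeff u (f * g) m) 1 \<otimes>\<^bsub>R\<^esub> frq 1 (s * t)"
      unfolding blockcoeff_mult by (subst finsum_frq) (auto intro: zpolys_closed blockcoeff_in_zpolys)
    also have "\<dots> = frq (blockcoeff u (f * g) m) (s * t)"
      using st' S_one by (subst frq_mult) (auto simp: blockcoeff_in_zpolys zpolys_closed)
    finally show ?thesis .
  qed
  then show ?thesis unfolding clears_def using st' zpolys_closed(5)[OF st(3,4)] by blast
qed

text \<open>Fractions with numerator in \<open>I\<close> form an ideal, by common denominators, and
  it contains the generators; minimality of the generated ideal does the rest.\<close>

lemma extended_ideal_clears:
  assumes I: "ideal_in (zpolys V) I" and F: "F \<in> extended_ideal p V u (lookup ` I)"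
  obtains s f where "f \<in> I" "clears s f F"
proof -
  interpret M: cring M by (rule M_cring)
  let ?E = "{F. \<exists>s f. f \<in> I \<and> clears s f F}"
  have mult: "G \<otimes>\<^bsub>M\<^esub> F \<in> ?E" if F: "F \<in> ?E" and G: "G \<in> carrier M" for F G
  proof -
    obtain s f where sf: "f \<in> I" "clears s f F" using F by blast
    obtain t g where g: "clears t g G" using common_denominator[OF G] .
    have "g * f \<in> I" using ideal_in_mult[OF I _ sf(1), of g] g by (simp add: clears_def)
    then show ?thesis using clears_mult[OF g sf(2)] by blast
  qed
  have "ideal ?E M"
  proof (rule M.idealI_closed)
    show sub: "?E \<subseteq> carrier M" using clears_in_M by blast
    have "clears 1 0 (embed p u (lookup 0))"
      using S_one zpolys_closed(1) by (auto simp: clears_def embed_lookup)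
    then show "?E \<noteq> {}" using ideal_in_zero[OF I] by blast
  next
    fix F G assume "F \<in> ?E" "G \<in> ?E"
    then obtain s f t g where *: "f \<in> I" "clears s f F" "g \<in> I" "clears t g G" by blast
    then have "t * f + s * g \<in> I"
      by (intro ideal_in_add[OF I] ideal_in_mult[OF I] u_in_V) (auto simp: clears_def)
    then show "F \<oplus>\<^bsub>M\<^esub> G \<in> ?E" using clears_add[OF *(2,4)] by blast
  next
    fix F G assume F: "F \<in> ?E" and G: "G \<in> carrier M"
    show GF: "G \<otimes>\<^bsub>M\<^esub> F \<in> ?E" by (rule mult[OF F G])
    have "F \<in> carrier M" using F clears_in_M by blast
    then have "F \<otimes>\<^bsub>M\<^esub> G = G \<otimes>\<^bsub>M\<^esub> F" by (rule M.m_comm[OF _ G])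
    then show "F \<otimes>\<^bsub>M\<^esub> G \<in> ?E" using GF by (simp only:)
  qed
  moreover have "embed p u ` lookup ` I \<subseteq> ?E"
  proof clarify
    fix f assume "f \<in> I"
    moreover have "clears 1 f (embed p u (lookup f))"
      using S_one ideal_in_subset[OF I] calculation by (auto simp: clears_def embed_lookup)
    ultimately show "\<exists>s f'. f' \<in> I \<and> clears s f' (embed p u (lookup f))" by blast
  qed
  ultimately have "extended_ideal p V u (lookup ` I) \<subseteq> ?E"
    unfolding extended_ideal_def by (rule M.genideal_minimal)
  then show thesis using F that by blast
qed

lemma embed_in_extended:
  assumes "I \<subseteq> zpolys V" "f \<in> I"
  shows "embed p u (lookup f) \<in> extended_ideal p V u (lookup ` I)"
proof -
  interpret M: cring M by (rule M_cring)
  have "embed p u ` lookup ` I \<subseteq> carrier M" using assms(1) embed_in_M by blast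
  from M.genideal_self[OF this] show ?thesis unfolding extended_ideal_def using assms(2) by blast
qed

text \<open>If \<open>f\<close> equals \<open>g / s\<close> over \<open>R\<close>, comparing
  coefficients in \<open>\<int>[u]\<close> gives \<open>s * f = g\<close> exactly, without a further
  factor. Conversely, \<open>f\<close> is the constant \<open>1 / s\<close> times
  \<open>s * f\<close>.\<close>

lemma contracted_extension_eq:
  assumes I: "ideal_in (zpolys V) I"
  shows "contracted_extension p V u (lookup ` I) = lookup ` {f \<in> zpolys V. \<exists>s\<in>S. s * f \<in> I}"
proof -
  interpret M: cring M by (rule M_cring)
  have char: "lookup f \<in> contracted_extension p V u (lookup ` I) \<longleftrightarrow> (\<exists>s\<in>S. s * f \<in> I)" if f: "f \<in> zpolys V" for f
  proof
    assume "lookup f \<in> contracted_extension p V u (lookup ` I)"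
    then have "embed p u (lookup f) \<in> extended_ideal p V u (lookup ` I)" by (simp add: contracted_extension_def)
    then obtain s g where g: "g \<in> I" "clears s g (embed p u (lookup f))" by (rule extended_ideal_clears[OF I])
    have s: "s \<in> S" using g(2) by (simp add: clears_def)
    have "frq (blockcoeff u f m) 1 = frq (blockcoeff u g m) s" for m
      using g(2) by (simp add: clears_def embed_lookup)
    then have "s * blockcoeff u f m = blockcoeff u g m" for m
      using frq_eq_iff[OF blockcoeff_in_zpolys S_one blockcoeff_in_zpolys s] by simp
    then have "blockcoeff u (s * f - g) m = 0" for m
      using s by (simp add: blockcoeff_diff blockcoeff_const_mult)
    then have "s * f - g = 0" using blockcoeff_eq_zero by blast
    then show "\<exists>s\<in>S. s * f \<in> I" using s g(1) by (metis eq_iff_diff_eq_0)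
  next
    assume "\<exists>s\<in>S. s * f \<in> I"
    then obtain s where s: "s \<in> S" "s * f \<in> I" by blast
    have sub: "embed p u ` lookup ` I \<subseteq> carrier M" using ideal_in_subset[OF I] embed_in_M by blast
    have "clears s (s * f) (embed p u (lookup f))"
      unfolding clears_def
    proof (intro conjI allI)
      show "s * f \<in> zpolys V" using s ideal_in_subset[OF I] by blast
      fix m
      show "embed p u (lookup f) m = frq (blockcoeff u (s * f) m) s"
        unfolding embed_lookup using frq_cancel[OF blockcoeff_in_zpolys S_one s(1), of f m] s(1)
        by (simp add: blockcoeff_const_mult)
    qed (rule s)
    from clears_embed[OF this]
    have "embed p u (lookup f) = (\<lambda>m. if m = {#} then frq 1 s else \<zero>\<^bsub>R\<^esub>) \<otimes>\<^bsub>M\<^esub> embed p u (lookup (s * f))" .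
    also have "\<dots> \<in> extended_ideal p V u (lookup ` I)"
      using embed_in_extended[OF ideal_in_subset[OF I] s(2)] s(1) zpolys_closed(2)
      unfolding extended_ideal_def
      by (intro ideal.I_l_closed[OF M.genideal_ideal[OF sub]] const_in_M) auto
    finally show "lookup f \<in> contracted_extension p V u (lookup ` I)"
      using f by (simp add: contracted_extension_def)
  qed
  show ?thesis
  proof (intro equalityI subsetI)
    fix x assume x: "x \<in> contracted_extension p V u (lookup ` I)"
    then obtain f where "f \<in> zpolys V" "x = lookup f"
      by (auto simp: contracted_extension_def carrier_int_mpoly)
    then show "x \<in> lookup ` {f \<in> zpolys V. \<exists>s\<in>S. s * f \<in> I}" using char x by blast
  next
    fix x assume "x \<in> lookup ` {f \<in> zpolys V. \<exists>s\<in>S. s * f \<in> I}"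
    then obtain f where "f \<in> zpolys V" "\<exists>s\<in>S. s * f \<in> I" "x = lookup f" by blast
    then show "x \<in> contracted_extension p V u (lookup ` I)" using char by simp
  qed
qed

end

section \<open>Heights and dimensions\<close>

lemma hom_image_ideal:
  assumes h: "h \<in> ring_hom A B" "h ` carrier A = carrier B" and "ring A" "ring B" and C: "ideal C A"
  shows "ideal (h ` C) B"
proof -
  interpret A: ring A by fact
  interpret B: ring B by fact
  interpret C: ideal C A by fact
  show ?thesis
  proof (rule B.idealI_closed)
    show "h ` C \<subseteq> carrier B" using C.a_subset h(2) by blast
    show "h ` C \<noteq> {}" using additive_subgroup.zero_closed[OF C.additive_subgroup_axioms] by blast
  next
    fix x y assume "x \<in> h ` C" "y \<in> h ` C"
    then obtain a b where "x = h a" "y = h b" "a \<in> C" "b \<in> C" by blast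
    then show "x \<oplus>\<^bsub>B\<^esub> y \<in> h ` C"
      using additive_subgroup.a_closed[OF C.additive_subgroup_axioms, of a b] ring_hom_add[OF h(1), of a b] C.a_subset
      by (metis imageI subsetD)
  next
    fix r x assume "x \<in> h ` C" "r \<in> carrier B"
    then obtain a c where ac: "x = h a" "r = h c" "a \<in> C" "c \<in> carrier A" using h(2) by blast
    then have "a \<in> carrier A" using C.a_subset by blast
    then show "r \<otimes>\<^bsub>B\<^esub> x \<in> h ` C" "x \<otimes>\<^bsub>B\<^esub> r \<in> h ` C"
      using ac C.I_l_closed[of a c] C.I_r_closed[of a c] ring_hom_mult[OF h(1), of c a] ring_hom_mult[OF h(1), of a c]
      by (metis imageI)+
  qed
qed

text \<open>Two elements with equal image differ by an element of the kernel, which \<open>C\<close>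
  contains. So \<open>C\<close> is recovered from its image, and both primality and strict
  inclusions survive.\<close>

lemma hom_image_mem_iff:
  assumes h: "h \<in> ring_hom A B" and "ring A" "ring B" and C: "ideal C A"
    and ker: "{a \<in> carrier A. h a = \<zero>\<^bsub>B\<^esub>} \<subseteq> C" and a: "a \<in> carrier A"
  shows "h a \<in> h ` C \<longleftrightarrow> a \<in> C"
proof
  interpret A: ring A by fact
  interpret B: ring B by fact
  interpret C: ideal C A by fact
  assume "h a \<in> h ` C"
  then obtain c where c: "c \<in> C" "h a = h c" by blast
  then have cA: "c \<in> carrier A" using C.a_subset by blast
  interpret h: ring_hom_ring A B h
    by (rule ring_hom_ringI2) (use h in \<open>auto intro: A.ring_axioms B.ring_axioms\<close>)
  have "h (a \<ominus>\<^bsub>A\<^esub> c) = \<zero>\<^bsub>B\<^esub>"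
    using a cA c(2) by (simp add: A.minus_eq B.r_neg)
  then have "a \<ominus>\<^bsub>A\<^esub> c \<in> C" using ker a cA by blast
  then have "(a \<ominus>\<^bsub>A\<^esub> c) \<oplus>\<^bsub>A\<^esub> c \<in> C"
    using c(1) additive_subgroup.a_closed[OF C.additive_subgroup_axioms] by blast
  then show "a \<in> C" using a cA by (simp add: A.minus_eq A.a_assoc A.l_neg)
qed simp

lemma hom_image_prime:
  assumes h: "h \<in> ring_hom A B" "h ` carrier A = carrier B" and A: "ring A" and B: "cring B" and C: "primeideal C A"
    and ker: "{a \<in> carrier A. h a = \<zero>\<^bsub>B\<^esub>} \<subseteq> C"
  shows "primeideal (h ` C) B"
proof -
  interpret A: ring A by fact
  interpret B: cring B by fact
  interpret C: primeideal C A by fact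
  note mem = hom_image_mem_iff[OF h(1) A B.ring_axioms C.is_ideal ker]
  show ?thesis
  proof (rule primeidealI[OF hom_image_ideal[OF h A B.ring_axioms C.is_ideal] B])
    show "carrier B \<noteq> h ` C"
    proof
      assume eq: "carrier B = h ` C"
      have "h \<one>\<^bsub>A\<^esub> \<in> h ` C" using h(2) A.one_closed unfolding eq[symmetric] by blast
      then have "\<one>\<^bsub>A\<^esub> \<in> C" using mem by blast
      then show False using C.one_imp_carrier C.I_notcarr by blast
    qed
    fix x y assume "x \<in> carrier B" "y \<in> carrier B" and xy: "x \<otimes>\<^bsub>B\<^esub> y \<in> h ` C"
    then obtain a b where ab: "x = h a" "y = h b" "a \<in> carrier A" "b \<in> carrier A" using h(2) by blast
    then have "a \<otimes>\<^bsub>A\<^esub> b \<in> C" using xy mem[of "a \<otimes>\<^bsub>A\<^esub> b"] ring_hom_mult[OF h(1)] by simp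
    then show "x \<in> h ` C \<or> y \<in> h ` C" using C.I_prime ab by blast
  qed
qed

lemma prime_chain_mono: "prime_chain A n C \<Longrightarrow> i \<le> j \<Longrightarrow> j \<le> n \<Longrightarrow> C i \<subseteq> C j"
proof (induction j)
  case (Suc j)
  have "C j \<subset> C (Suc j)" using Suc.prems by (simp add: prime_chain_def Suc_le_eq)
  then show ?case using Suc by (cases "i = Suc j") auto
qed simp

text \<open>Only the smallest prime of the chain has to be assumed to contain the kernel; the larger
  ones inherit it.\<close>

lemma krull_dim_quotient_ge:
  assumes h: "h \<in> ring_hom A B" "h ` carrier A = carrier B" and A: "ring A" and B: "cring B"
    and C: "prime_chain A n C" and ker: "{a \<in> carrier A. h a = \<zero>\<^bsub>B\<^esub>} \<subseteq> C 0"
  shows "enat n \<le> krull_dim B"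
proof -
  have ker': "{a \<in> carrier A. h a = \<zero>\<^bsub>B\<^esub>} \<subseteq> C i" if "i \<le> n" for i
    using prime_chain_mono[OF C le0 that] ker by blast
  have pr: "primeideal (C i) A" if "i \<le> n" for i using C that by (simp add: prime_chain_def)
  have "prime_chain B n (\<lambda>i. h ` C i)"
    unfolding prime_chain_def
  proof (intro conjI allI impI)
    fix i assume "i \<le> n"
    then show "primeideal (h ` C i) B" using hom_image_prime[OF h A B pr ker'] by blast
  next
    fix i assume i: "i < n"
    then have "C i \<subset> C (Suc i)" using C by (simp add: prime_chain_def)
    then obtain a where a: "a \<in> C (Suc i)" "a \<notin> C i" and sub: "C i \<subseteq> C (Suc i)" by blast
    have id: "ideal (C j) A" if "j \<le> n" for j using pr[OF that] by (rule primeideal.axioms(1))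
    have "a \<in> carrier A" using a(1) additive_subgroup.a_subset[OF ideal.axioms(1)[OF id[of "Suc i"]]] i by auto
    then have "h a \<notin> h ` C i"
      using hom_image_mem_iff[OF h(1) A cring.axioms(1)[OF B] id ker', of i a] a(2) i by simp
    then show "h ` C i \<subset> h ` C (Suc i)" using a(1) sub by blast
  qed
  then show ?thesis unfolding krull_dim_def by (intro Sup_upper) blast
qed

lemma prime_height_mono:
  assumes "primeideal P A" "primeideal P' A" "P \<subseteq> P'"
  shows "prime_height A P \<le> prime_height A P'"
proof (cases "P = P'")
  case False
  show ?thesis
    unfolding prime_height_def
  proof (rule Sup_mono)
    fix x assume "x \<in> {enat n | n. \<exists>C. prime_chain A n C \<and> C n = P}"
    then obtain n C where C: "x = enat n" "prime_chain A n C" "C n = P" by blast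
    have "prime_chain A (Suc n) (C(Suc n := P'))"
      using C(2,3) assms False by (auto simp: prime_chain_def le_Suc_eq less_Suc_eq)
    then have "enat (Suc n) \<in> {enat n | n. \<exists>C. prime_chain A n C \<and> C n = P'}"
      by (auto intro!: exI[of _ "C(Suc n := P')"])
    then show "\<exists>y\<in>{enat n | n. \<exists>C. prime_chain A n C \<and> C n = P'}. x \<le> y"
      unfolding C(1) by (rule bexI[rotated]) simp
  qed
qed simp

lemma radical_subset_prime:
  assumes "primeideal P A" "Q \<subseteq> P" "ring A"
  shows "radical A Q \<subseteq> P"
proof
  interpret primeideal P A by fact
  fix a assume "a \<in> radical A Q"
  then obtain n :: nat where a: "a \<in> carrier A" "a [^]\<^bsub>A\<^esub> n \<in> P" using assms(2) by (auto simp: radical_def)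
  have "a [^]\<^bsub>A\<^esub> k \<in> P \<Longrightarrow> a \<in> P" for k :: nat
  proof (induction k)
    case 0
    then show ?case using one_imp_carrier I_notcarr by simp
  next
    case (Suc k)
    then show ?case using I_prime[of "a [^]\<^bsub>A\<^esub> k" a] a(1) by auto
  qed
  then show "a \<in> P" using a(2) by blast
qed

text \<open>Every prime above \<open>Q\<close> contains its radical \<open>P\<close>, so the height
  of \<open>P\<close> is at most that of \<open>Q\<close>, while \<open>J \<subseteq> P\<close>
  would bound the height of \<open>J\<close> by that of \<open>P\<close>.\<close>

lemma not_subset_radical:
  assumes A: "ring A" and P: "primeideal P A" "radical A Q = P"
    and ht: "ideal_height A Q < ideal_height A J"
  shows "\<not> J \<subseteq> P"
proof
  assume "J \<subseteq> P"
  then have "ideal_height A J \<le> prime_height A P"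
    unfolding ideal_height_def using P(1) by (intro Inf_lower) blast
  also have "\<dots> \<le> ideal_height A Q"
    unfolding ideal_height_def
  proof (rule Inf_greatest)
    fix x assume "x \<in> {prime_height A P | P. primeideal P A \<and> Q \<subseteq> P}"
    then obtain P' where P': "x = prime_height A P'" "primeideal P' A" "Q \<subseteq> P'" by blast
    then have "P \<subseteq> P'" using radical_subset_prime[OF P'(2,3) A] P(2) by simp
    then show "prime_height A P \<le> x" unfolding P'(1) by (rule prime_height_mono[OF P(1) P'(2)])
  qed
  finally show False using ht by simp
qed

section \<open>Reduction modulo p\<close>

lemma residue_ring_simps:
  assumes "1 < p"
  shows "cring (residue_ring (int p))" "carrier (residue_ring (int p)) = {0..int p - 1}"
    "x \<otimes>\<^bsub>residue_ring (int p)\<^esub> y = (x * y) mod int p" "x \<oplus>\<^bsub>residue_ring (int p)\<^esub> y = (x + y) mod int p"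
    "\<zero>\<^bsub>residue_ring (int p)\<^esub> = 0" "\<one>\<^bsub>residue_ring (int p)\<^esub> = 1"
proof -
  interpret residues "int p" "residue_ring (int p)"
    using assms by unfold_locales auto
  show "cring (residue_ring (int p))" by (rule cring)
qed (auto simp: residue_ring_def)

lemma finsum_residue_ring:
  assumes "1 < p" "finite K"
  shows "finsum (residue_ring (int p)) (\<lambda>k. f k mod int p) K = sum f K mod int p"
proof -
  note rr = residue_ring_simps[OF assms(1)]
  interpret cring "residue_ring (int p)" by (rule rr(1))
  show ?thesis
    using assms(2)
  proof (induction K rule: finite_induct)
    case (insert k K)
    have "f x mod int p \<in> carrier (residue_ring (int p))" for x using assms(1) by (simp add: rr)
    then show ?case using insert by (subst finsum_insert) (auto simp: rr mod_add_eq)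
  qed (simp add: rr)
qed

lemma reduce_mod_hom:
  fixes V :: "'v set"
  assumes p: "1 < p"
  shows "reduce_mod p \<in> ring_hom (int_mpoly V) (mpoly_ring (residue_ring (int p)) V)"
proof -
  note rr = residue_ring_simps[OF p]
  note zs = cring.mpoly_ring_simps[OF int_is_cring] and ks = cring.mpoly_ring_simps[OF rr(1)]
  show ?thesis
  proof (rule ring_hom_memI)
    fix f :: "'v multiset \<Rightarrow> int" assume f: "f \<in> carrier (int_mpoly V)"
    have "{m. f m mod int p \<noteq> 0} \<subseteq> {m. f m \<noteq> 0}" by auto
    moreover have "finite {m. f m \<noteq> 0}" using f by (simp add: zs)
    ultimately have "finite {m. f m mod int p \<noteq> 0}" by (rule finite_subset)
    moreover have "set_mset m \<subseteq> V" if "f m mod int p \<noteq> 0" for m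
    proof -
      have "f m \<noteq> 0" using that by auto
      then show ?thesis using f by (simp add: zs)
    qed
    ultimately show "reduce_mod p f \<in> carrier (mpoly_ring (residue_ring (int p)) V)"
      unfolding ks using p by (simp add: rr reduce_mod_def)
  next
    fix f g :: "'v multiset \<Rightarrow> int"
    show "reduce_mod p (f \<otimes>\<^bsub>int_mpoly V\<^esub> g)
        = reduce_mod p f \<otimes>\<^bsub>mpoly_ring (residue_ring (int p)) V\<^esub> reduce_mod p g"
      unfolding zs ks by (simp add: rr reduce_mod_def fun_eq_iff mod_mult_eq finsum_residue_ring[OF p] int_finsum_eq)
    show "reduce_mod p (f \<oplus>\<^bsub>int_mpoly V\<^esub> g)
        = reduce_mod p f \<oplus>\<^bsub>mpoly_ring (residue_ring (int p)) V\<^esub> reduce_mod p g"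
      unfolding zs ks by (simp add: rr reduce_mod_def fun_eq_iff mod_add_eq)
  next
    show "reduce_mod p \<one>\<^bsub>int_mpoly V\<^esub> = \<one>\<^bsub>mpoly_ring (residue_ring (int p)) V\<^esub>"
      unfolding zs ks using p by (simp add: rr reduce_mod_def fun_eq_iff)
  qed
qed

lemma reduce_mod_surj:
  fixes V :: "'v set"
  assumes p: "1 < p"
  shows "reduce_mod p ` carrier (int_mpoly V) = carrier (mpoly_ring (residue_ring (int p)) V)"
proof
  note rr = residue_ring_simps[OF p]
  note zs = cring.mpoly_ring_simps[OF int_is_cring] and ks = cring.mpoly_ring_simps[OF rr(1)]
  show "reduce_mod p ` carrier (int_mpoly V) \<subseteq> carrier (mpoly_ring (residue_ring (int p)) V)"
    using reduce_mod_hom[OF p, of V] by (auto simp: ring_hom_closed)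
  show "carrier (mpoly_ring (residue_ring (int p)) V) \<subseteq> reduce_mod p ` carrier (int_mpoly V)"
  proof
    fix f :: "'v multiset \<Rightarrow> int" assume f: "f \<in> carrier (mpoly_ring (residue_ring (int p)) V)"
    then have "f m \<in> {0..int p - 1}" for m unfolding ks rr by blast
    then have "reduce_mod p f = f" by (auto simp: reduce_mod_def fun_eq_iff)
    moreover have "f \<in> carrier (int_mpoly V)" using f unfolding zs ks by (simp add: rr)
    ultimately show "f \<in> reduce_mod p ` carrier (int_mpoly V)" by (metis imageI)
  qed
qed

context localized_coeffs
begin

lemma p_gt_1: "1 < p"
  using prime_p prime_nat_iff by blast

lemma pmult_subset:
  assumes "ideal_in (zpolys V) P" "of_nat p \<in> P"
  shows "pmult p V \<subseteq> P"
proof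
  fix t assume "t \<in> pmult p V"
  then obtain t' where "t' \<in> zpolys V" "t = t' * of_nat p" by (rule pmult_factor)
  then show "t \<in> P" using ideal_in_mult[OF assms(1)] assms(2) by blast
qed

text \<open>\<open>P\<close> contains \<open>pmult p V\<close>, so membership in \<open>P\<close>
  depends only on the residues of the coefficients.\<close>

lemma reduce_mod_eq:
  assumes P: "ideal_in (zpolys V) P" "of_nat p \<in> P"
    and t: "t \<in> zpolys V" and s: "s \<in> P" and eq: "reduce_mod p (lookup t) = reduce_mod p (lookup s)"
  shows "t \<in> P"
proof -
  have sV: "s \<in> zpolys V" using s ideal_in_subset[OF P(1)] by blast
  have "int p dvd lookup (t - s) m" for m
    using fun_cong[OF eq, of m] by (simp add: reduce_mod_def lookup_minus mod_eq_dvd_iff)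
  then have "t - s \<in> pmult p V" using t sV by (simp add: pmult_def zpolys_closed)
  then have "t - s \<in> P" using pmult_subset[OF P] by blast
  then show ?thesis using ideal_in_diff_cancel[OF zpolys_subring P(1)] s by blast
qed

text \<open>An element of \<open>P \<inter> zpolys u\<close> reduces modulo \<open>p\<close> into
  both sets intersected in \<open>ind\<close>, hence to \<open>0\<close>; the other inclusion holds
  because \<open>p\<close> lies in \<open>P\<close>.\<close>

lemma independent_inter:
  assumes P: "ideal_in (zpolys V) P" "of_nat p \<in> P"
    and ind: "(Idl\<^bsub>mpoly_ring (residue_ring (int p)) V\<^esub> (reduce_mod p ` lookup ` P))
      \<inter> carrier (mpoly_ring (residue_ring (int p)) u) = {\<zero>\<^bsub>mpoly_ring (residue_ring (int p)) u\<^esub>}"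
  shows "P \<inter> zpolys u = pmult p u"
proof
  note rr = residue_ring_simps[OF p_gt_1]
  interpret K: cring "mpoly_ring (residue_ring (int p)) V" by (rule cring.mpoly_ring_cring[OF rr(1)])
  have sub: "reduce_mod p ` lookup ` P \<subseteq> carrier (mpoly_ring (residue_ring (int p)) V)"
    using ideal_in_subset[OF P(1)] reduce_mod_surj[OF p_gt_1, of V] unfolding carrier_int_mpoly by blast
  show "pmult p u \<subseteq> P \<inter> zpolys u"
    using pmult_subset[OF P] u_in_V by (auto simp: pmult_def)
  show "P \<inter> zpolys u \<subseteq> pmult p u"
  proof
    fix t assume t: "t \<in> P \<inter> zpolys u"
    then have "reduce_mod p (lookup t) \<in> Idl\<^bsub>mpoly_ring (residue_ring (int p)) V\<^esub> (reduce_mod p ` lookup ` P)"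
      using K.genideal_self[OF sub] by blast
    moreover have "reduce_mod p (lookup t) \<in> carrier (mpoly_ring (residue_ring (int p)) u)"
      using t reduce_mod_surj[OF p_gt_1, of u] unfolding carrier_int_mpoly by blast
    ultimately have "reduce_mod p (lookup t) = \<zero>\<^bsub>mpoly_ring (residue_ring (int p)) u\<^esub>" using ind by blast
    then have "lookup t m mod int p = 0" for m
      unfolding cring.zero_mpoly_ring[OF rr(1)] by (simp add: rr reduce_mod_def fun_eq_iff)
    then show "t \<in> pmult p u" using t by (auto simp: pmult_def)
  qed
qed

text \<open>The kernel of the composite of reduction modulo \<open>p\<close> with the quotient map
  lies in \<open>P\<close>, so a chain of primes above \<open>P\<close> over the integers keeps its
  length in the quotient.\<close>

lemma krull_dim_reduction_ge:
  assumes P: "ideal_in (zpolys V) P" "of_nat p \<in> P" and "P \<subseteq> C 0"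
    and C: "\<forall>i\<le>n. prime_in (zpolys V) (C i)" "\<forall>i<n. C i \<subset> C (Suc i)"
  shows "enat n \<le> krull_dim (mpoly_ring (residue_ring (int p)) V Quot
    (Idl\<^bsub>mpoly_ring (residue_ring (int p)) V\<^esub> (reduce_mod p ` lookup ` P)))"
proof -
  let ?K = "mpoly_ring (residue_ring (int p)) V"
  note rr = residue_ring_simps[OF p_gt_1]
  interpret Z: cring "int_mpoly V" by (rule int_mpoly_cring)
  interpret K: cring ?K by (rule cring.mpoly_ring_cring[OF rr(1)])
  have idP: "ideal (reduce_mod p ` lookup ` P) ?K"
    by (rule hom_image_ideal[OF reduce_mod_hom[OF p_gt_1] reduce_mod_surj[OF p_gt_1] Z.ring_axioms K.ring_axioms ideal_lookup[OF P(1)]])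
  define I where "I = Idl\<^bsub>?K\<^esub> (reduce_mod p ` lookup ` P)"
  \<comment> \<open>Reduction is surjective, so the image of \<open>P\<close> is already an ideal
    and generating adds nothing.\<close>
  have I: "I = reduce_mod p ` lookup ` P"
    unfolding I_def using K.genideal_minimal[OF idP order_refl]
      K.genideal_self[OF additive_subgroup.a_subset[OF ideal.axioms(1)[OF idP]]] by blast
  interpret I: ideal I ?K unfolding I by (rule idP)
  let ?h = "\<lambda>f. I +>\<^bsub>?K\<^esub> reduce_mod p f"
  have h: "?h \<in> ring_hom (int_mpoly V) (?K Quot I)"
    using ring_hom_trans[OF reduce_mod_hom[OF p_gt_1, of V] I.rcos_ring_hom] by (simp add: comp_def)
  have surj: "?h ` carrier (int_mpoly V) = carrier (?K Quot I)"
  proof -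
    have "?h ` carrier (int_mpoly V) = (+>\<^bsub>?K\<^esub>) I ` reduce_mod p ` carrier (int_mpoly V)"
      by (simp add: image_image)
    also have "\<dots> = carrier (?K Quot I)"
      unfolding reduce_mod_surj[OF p_gt_1] by (auto simp: FactRing_def A_RCOSETS_def')
    finally show ?thesis .
  qed
  have ker: "{f \<in> carrier (int_mpoly V). ?h f = \<zero>\<^bsub>?K Quot I\<^esub>} \<subseteq> lookup ` C 0"
  proof clarify
    fix f assume f: "f \<in> carrier (int_mpoly V)" "?h f = \<zero>\<^bsub>?K Quot I\<^esub>"
    then obtain t where t: "f = lookup t" "t \<in> zpolys V" unfolding carrier_int_mpoly by blast
    have "reduce_mod p f \<in> carrier ?K" using f(1) reduce_mod_surj[OF p_gt_1, of V] by blast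
    moreover have "?h f = I" using f(2) by (simp add: FactRing_def)
    ultimately have "reduce_mod p f \<in> I" by (rule I.rcos_const_imp_mem)
    then obtain s where "s \<in> P" "reduce_mod p f = reduce_mod p (lookup s)" unfolding I by blast
    then have "t \<in> P" using reduce_mod_eq[OF P t(2)] t(1) by blast
    then show "f \<in> lookup ` C 0" using t(1) assms(3) by blast
  qed
  have "prime_chain (int_mpoly V) n (\<lambda>i. lookup ` C i)"
    unfolding prime_chain_def
  proof (intro conjI allI impI)
    fix i assume "i \<le> n"
    then show "primeideal (lookup ` C i) (int_mpoly V)" using C(1) primeideal_lookup by blast
  next
    fix i assume "i < n"
    then have "C i \<subset> C (Suc i)" using C(2) by blast
    then show "lookup ` C i \<subset> lookup ` C (Suc i)"
      by (metis pull_image image_mono psubset_eq subset_not_subset_eq)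
  qed
  from krull_dim_quotient_ge[OF h surj Z.ring_axioms I.quotient_is_cring[OF K.is_cring] this ker]
  show ?thesis unfolding I_def .
qed

text \<open>Serves to move \<open>(i + j) ^ n\<close> into \<open>J\<close> once
  \<open>i ^ n\<close> is known to lie there.\<close>

lemma power_add_in_ideal:
  assumes J: "ideal_in (zpolys V) J" and "i \<in> zpolys V" "j \<in> J"
  shows "(i + j) ^ n - i ^ n \<in> J"
proof (induction n)
  case (Suc n)
  have "j \<in> zpolys V" using assms(3) ideal_in_subset[OF J] by blast
  then have c: "i + j \<in> zpolys V" "i ^ n \<in> zpolys V" using assms(2) by (auto intro: zpolys_closed)
  have "(i + j) ^ Suc n - i ^ Suc n = (i + j) * ((i + j) ^ n - i ^ n) + i ^ n * j"
    by (simp add: algebra_simps)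
  also have "\<dots> \<in> J"
    by (intro ideal_in_add[OF J] ideal_in_mult[OF J] c Suc assms(3))
  finally show ?case .
qed (simp add: ideal_in_zero[OF J])

text \<open>With \<open>s\<close> in both \<open>S\<close> and \<open>J\<close>, an element
  \<open>f\<close> of \<open>Q\<close> satisfies \<open>s * f \<in> Q \<inter> J = I\<close>.
  Conversely, \<open>t * f \<in> I \<subseteq> Q\<close> with \<open>t \<notin> P\<close> gives
  \<open>f \<in> Q\<close>, because \<open>Q\<close> is \<open>P\<close>-primary.\<close>

lemma contracted_extension_eq_component:
  assumes I: "ideal I (int_mpoly V)" "radical (int_mpoly V) I = P" "primeideal P (int_mpoly V)"
    and Q: "primary_to (int_mpoly V) P Q" and J: "ideal J (int_mpoly V)" and IQJ: "I = Q \<inter> J"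
    and ht: "ideal_height (int_mpoly V) Q < ideal_height (int_mpoly V) J"
    and pP: "of_nat p \<in> pull P"
    and ind: "max_independent_set (residue_ring (int p)) V
           (Idl\<^bsub>mpoly_ring (residue_ring (int p)) V\<^esub> (reduce_mod p ` P)) u"
  shows "contracted_extension p V u I = Q"
proof -
  interpret Z: cring "int_mpoly V" by (rule int_mpoly_cring)
  have Qi: "ideal Q (int_mpoly V)" and Qp: "\<And>a b. a \<in> carrier (int_mpoly V) \<Longrightarrow> b \<in> carrier (int_mpoly V) \<Longrightarrow>
      a \<otimes>\<^bsub>int_mpoly V\<^esub> b \<in> Q \<Longrightarrow> a \<in> Q \<or> b \<in> P" and Qr: "radical (int_mpoly V) Q = P"
    using Q unfolding primary_to_def primary_ideal_def by auto
  have sub: "C \<subseteq> carrier (int_mpoly V)" if "ideal C (int_mpoly V)" for C :: "('v multiset \<Rightarrow> int) set"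
    using additive_subgroup.a_subset[OF ideal.axioms(1)[OF that]] .
  note Pi = primeideal.axioms(1)[OF I(3)]
  have PP: "P = lookup ` pull P" by (rule image_pull[OF sub[OF Pi], symmetric])
  have II: "I = lookup ` pull I" by (rule image_pull[OF sub[OF I(1)], symmetric])
  note P' = prime_in_pull[OF I(3)] and I' = ideal_in_pull[OF I(1)] and J' = ideal_in_pull[OF J] and Q' = ideal_in_pull[OF Qi]
  have JP: "\<not> pull J \<subseteq> pull P"
  proof
    assume "pull J \<subseteq> pull P"
    then have "lookup ` pull J \<subseteq> lookup ` pull P" by blast
    then show False
      using not_subset_radical[OF Z.ring_axioms I(3) Qr ht] image_pull[OF sub[OF J]] image_pull[OF sub[OF Pi]] by simp
  qed
  have Pu: "pull P \<inter> zpolys u = pmult p u"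
    using ind PP unfolding max_independent_set_def
    by (intro independent_inter[OF prime_in_ideal[OF P'] pP]) simp
  have dim: "krull_dim (mpoly_ring (residue_ring (int p)) V Quot
    (Idl\<^bsub>mpoly_ring (residue_ring (int p)) V\<^esub> (reduce_mod p ` lookup ` pull P))) = enat (card u)"
    using ind PP unfolding max_independent_set_def by simp
  have "\<exists>i\<le>card u. \<not> C i \<subset> C (Suc i)"
    if "C 0 = pull P" "\<forall>i\<le>Suc (card u). prime_in (zpolys V) (C i)" for C
  proof (rule ccontr)
    assume "\<not> ?thesis"
    then have "\<forall>i<Suc (card u). C i \<subset> C (Suc i)" by (auto simp: less_Suc_eq_le)
    then have "enat (Suc (card u)) \<le> enat (card u)"
      using krull_dim_reduction_ge[OF prime_in_ideal[OF P'] pP, of C "Suc (card u)"] that dim by simp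
    then show False by simp
  qed
  then obtain i j where ij: "i \<in> pull P" "j \<in> pull J" "i + j \<in> S"
    using ideal_meets_complement[OF prime_p fin_V u_V P' Pu J' JP] unfolding S_def by metis
  have iV: "i \<in> zpolys V" using ij(1) ideal_in_subset[OF prime_in_ideal[OF P']] by blast
  \<comment> \<open>\<open>i\<close> itself need not lie in \<open>J\<close>; being in the radical
    of \<open>I\<close>, it has a power in \<open>I \<subseteq> J\<close>, so a power of
    \<open>i + j\<close> is used as \<open>s\<close>.\<close>
  have "i \<in> pull (radical (int_mpoly V) I)" using ij(1) I(2) by simp
  then obtain n where n: "i ^ n \<in> pull I" unfolding pull_radical by blast
  define s where "s = (i + j) ^ n"
  have sS: "s \<in> S" unfolding s_def by (rule S_power[OF ij(3)])
  have "i ^ n \<in> pull J" using n IQJ by blast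
  then have sJ: "s \<in> pull J"
    using power_add_in_ideal[OF J' iV ij(2), of n] ideal_in_diff_cancel[OF zpolys_subring J'] unfolding s_def by blast
  have "{f \<in> zpolys V. \<exists>s\<in>S. s * f \<in> pull I} = pull Q"
  proof (intro equalityI subsetI)
    fix f assume "f \<in> {f \<in> zpolys V. \<exists>s\<in>S. s * f \<in> pull I}"
    then obtain t where t: "f \<in> zpolys V" "t \<in> S" "t * f \<in> pull Q" using IQJ by blast
    have "t \<notin> pull P" using t(2) Pu by (auto simp: S_def)
    moreover have "lookup f \<otimes>\<^bsub>int_mpoly V\<^esub> lookup t \<in> Q" using t(3) by (simp add: mult.commute)
    ultimately show "f \<in> pull Q" using Qp[of "lookup f" "lookup t"] t(1) u_in_V[OF S_u[OF t(2)]] by auto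
  next
    fix f assume f: "f \<in> pull Q"
    have fV: "f \<in> zpolys V" using f ideal_in_subset[OF Q'] by blast
    have "s * f \<in> pull Q" by (rule ideal_in_mult[OF Q' u_in_V[OF S_u[OF sS]] f])
    moreover have "s * f \<in> pull J" using ideal_in_mult[OF J' fV sJ] by (simp add: mult.commute)
    ultimately show "f \<in> {f \<in> zpolys V. \<exists>s\<in>S. s * f \<in> pull I}" using fV sS IQJ by blast
  qed
  then have "contracted_extension p V u (lookup ` pull I) = lookup ` pull Q"
    using contracted_extension_eq[OF I'] by simp
  then show ?thesis using II image_pull[OF sub[OF Qi]] by simp
qed

end

section \<open>Monomial orderings\<close>

lemma monomial_orderingD:
  assumes "monomial_ordering W r"
  shows mo_trans: "\<And>a b c. (a, b) \<in> r \<Longrightarrow> (b, c) \<in> r \<Longrightarrow> (a, c) \<in> r"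
    and mo_antisym: "\<And>a b. (a, b) \<in> r \<Longrightarrow> (b, a) \<in> r \<Longrightarrow> a = b"
    and mo_refl: "\<And>a. a \<in> monomials W \<Longrightarrow> (a, a) \<in> r"
    and mo_total: "\<And>a b. a \<in> monomials W \<Longrightarrow> b \<in> monomials W \<Longrightarrow> (a, b) \<in> r \<or> (b, a) \<in> r"
    and mo_field: "\<And>a b. (a, b) \<in> r \<Longrightarrow> a \<in> monomials W \<and> b \<in> monomials W"
    and mo_add: "\<And>a b c. c \<in> monomials W \<Longrightarrow> (a, b) \<in> r \<Longrightarrow> (a + c, b + c) \<in> r"
    and mo_least: "\<And>a. a \<in> monomials W \<Longrightarrow> ({#}, a) \<in> r"
proof -
  have l: "linear_order_on (monomials W) r" using assms by (simp add: monomial_ordering_def)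
  show "\<And>a b c. (a, b) \<in> r \<Longrightarrow> (b, c) \<in> r \<Longrightarrow> (a, c) \<in> r"
    using l by (auto simp: order_on_defs dest: transD)
  show "\<And>a b. (a, b) \<in> r \<Longrightarrow> (b, a) \<in> r \<Longrightarrow> a = b"
    using l by (auto simp: order_on_defs dest: antisymD)
  show "\<And>a. a \<in> monomials W \<Longrightarrow> (a, a) \<in> r"
    using l by (auto simp: order_on_defs dest: refl_onD)
  then show "(a, b) \<in> r \<or> (b, a) \<in> r" if "a \<in> monomials W" "b \<in> monomials W" for a b
    using l that by (cases "a = b") (auto simp: order_on_defs total_on_def)
  show "\<And>a b. (a, b) \<in> r \<Longrightarrow> a \<in> monomials W \<and> b \<in> monomials W"
    using l by (auto simp: order_on_defs)
qed (use assms in \<open>auto simp: monomial_ordering_def\<close>)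

lemma mo_subset:
  assumes "monomial_ordering W r" "a \<subseteq># b" "b \<in> monomials W"
  shows "(a, b) \<in> r"
proof -
  have "a \<in> monomials W" "b - a \<in> monomials W"
    using assms(2,3) by (auto simp: monomials_def dest: mset_subset_eqD in_diffD)
  then show ?thesis using mo_add[OF assms(1) _ mo_least[OF assms(1)], of a "b - a"] assms(2) by simp
qed

text \<open>Formulated for sets of monomials, since it is applied to the support of a polynomial, to
  the support of a coefficient in \<open>\<int>[u]\<close>, and to the monomials outside
  \<open>u\<close> with nonzero coefficient.\<close>

definition is_top :: "'v multiset rel \<Rightarrow> 'v multiset set \<Rightarrow> 'v multiset \<Rightarrow> bool" where
  "is_top r K m \<longleftrightarrow> m \<in> K \<and> (\<forall>k\<in>K. (k, m) \<in> r)"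

lemma is_top_exists:
  assumes r: "monomial_ordering W r" and "finite K" "K \<noteq> {}" "K \<subseteq> monomials W"
  obtains m where "is_top r K m"
proof -
  have "\<exists>m. is_top r K m"
    using assms(2-4)
  proof (induction K rule: finite_ne_induct)
    case (singleton x)
    then show ?case using mo_refl[OF r] by (auto simp: is_top_def)
  next
    case (insert x K)
    then obtain m where m: "is_top r K m" by auto
    then have mK: "m \<in> monomials W" "x \<in> monomials W" using insert by (auto simp: is_top_def)
    show ?case
    proof (cases "(x, m) \<in> r")
      case True
      then show ?thesis using m by (auto simp: is_top_def)
    next
      case False
      then have mx: "(m, x) \<in> r" using mo_total[OF r mK] by blast
      have "is_top r (insert x K) x"
        using m mo_trans[OF r _ mx] mo_refl[OF r mK(2)] by (auto simp: is_top_def)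
      then show ?thesis by blast
    qed
  qed
  then show thesis using that by blast
qed

lemma lead_monom_eq:
  assumes "monomial_ordering W r" "is_top r {m. f m \<noteq> \<zero>\<^bsub>A\<^esub>} m"
  shows "lead_monom A r f = m" "lead_term A r f = (f m, m)"
proof -
  show "lead_monom A r f = m"
    unfolding lead_monom_def using assms(2) mo_antisym[OF assms(1)]
    by (intro the_equality) (auto simp: is_top_def)
  then show "lead_term A r f = (f m, m)" by (simp add: lead_term_def)
qed

abbreviation supp :: "'v zpoly \<Rightarrow> 'v multiset set" where
  "supp t \<equiv> {m. lookup t m \<noteq> 0}"

lemma is_top_mult:
  assumes r: "monomial_ordering W r" and ab: "a \<in> zpolys W" "b \<in> zpolys W"
    and k: "is_top r (supp a) k" and l: "is_top r (supp b) l"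
  shows "lookup (a * b) (k + l) = lookup a k * lookup b l" "is_top r (supp (a * b)) (k + l)"
proof -
  have W: "m \<in> monomials W" if "lookup a m \<noteq> 0 \<or> lookup b m \<noteq> 0" for m
    using that ab by (auto simp: zpolys_def monomials_def)
  have le: "(k' + l', k + l) \<in> r" "(k' + l', k + l') \<in> r" "(k + l', k + l) \<in> r"
    if "lookup a k' \<noteq> 0" "lookup b l' \<noteq> 0" for k' l'
  proof -
    have "(k', k) \<in> r" "(l', l) \<in> r" using k l that by (auto simp: is_top_def)
    moreover have "k \<in> monomials W" using k W by (auto simp: is_top_def)
    ultimately show 1: "(k' + l', k + l') \<in> r" and 2: "(k + l', k + l) \<in> r"
      using mo_add[OF r, of l' k' k] mo_add[OF r, of k l' l] W that by (auto simp: add.commute)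
    show "(k' + l', k + l) \<in> r" by (rule mo_trans[OF r 1 2])
  qed
  have "lookup (a * b) (k + l) = (\<Sum>m | m \<subseteq># k + l. if m = k then lookup a k * lookup b l else 0)"
    unfolding lookup_times
  proof (intro sum.cong refl)
    fix m assume m: "m \<in> {m. m \<subseteq># k + l}"
    show "lookup a m * lookup b (k + l - m) = (if m = k then lookup a k * lookup b l else 0)"
    proof (cases "lookup a m \<noteq> 0 \<and> lookup b (k + l - m) \<noteq> 0 \<and> m \<noteq> k")
      case True
      have e: "m + (k + l - m) = k + l" using m by simp
      \<comment> \<open>With \<open>l' = k + l - m\<close>, the chain
        \<open>m + l' \<le> k + l' \<le> k + l\<close> has equal ends, so all three agree; then
        \<open>l' = l\<close> and \<open>m = k\<close>.\<close>
      have "k + (k + l - m) = k + l"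
        using mo_antisym[OF r, of "k + (k + l - m)" "k + l"] le(2,3)[of m "k + l - m"] True e by metis
      then have "k + l - m = l" by simp
      then have "m = k" using e by simp
      then show ?thesis using True by simp
    qed auto
  qed
  also have "\<dots> = lookup a k * lookup b l" by simp
  finally show eq: "lookup (a * b) (k + l) = lookup a k * lookup b l" .
  show "is_top r (supp (a * b)) (k + l)"
    unfolding is_top_def
  proof (intro conjI ballI)
    show "k + l \<in> supp (a * b)" using eq k l by (auto simp: is_top_def)
    fix m assume "m \<in> supp (a * b)"
    then have "lookup (a * b) m \<noteq> 0" by simp
    then show "(m, k + l) \<in> r" by (rule lookup_times_nonzero) (use le(1) in auto)
  qed
qed

lemma is_top_power:
  assumes r: "monomial_ordering W r" and a: "a \<in> zpolys W" and k: "is_top r (supp a) k"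
  obtains l where "is_top r (supp (a ^ n)) l" "lookup (a ^ n) l = lookup a k ^ n"
proof -
  have "\<exists>l. is_top r (supp (a ^ n)) l \<and> lookup (a ^ n) l = lookup a k ^ n"
  proof (induction n)
    case 0
    have "is_top r (supp (a ^ 0)) {#}"
      using mo_refl[OF r, of "{#}"] by (auto simp: is_top_def lookup_one when_def monomials_def)
    then show ?case by (intro exI[of _ "{#}"]) (simp add: lookup_one when_def)
  next
    case (Suc n)
    then obtain l where l: "is_top r (supp (a ^ n)) l" "lookup (a ^ n) l = lookup a k ^ n" by blast
    have "a ^ n \<in> zpolys W" using a by (rule zpolys_closed)
    from is_top_mult[OF r a this k l(1)] l(2) show ?case by (auto intro!: exI[of _ "k + l"])
  qed
  then show thesis using that by blast
qed

section \<open>Monomial orderings are well-founded\<close>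

text \<open>Beyond any index there is a position whose value is minimal on its own tail, since the
  least value beyond that index is attained; successive such positions form the subsequence.\<close>

lemma nondecreasing_subsequence:
  fixes n :: "nat \<Rightarrow> nat"
  obtains \<psi> :: "nat \<Rightarrow> nat" where "strict_mono \<psi>" "\<And>i j. i \<le> j \<Longrightarrow> n (\<psi> i) \<le> n (\<psi> j)"
proof -
  have ex: "\<exists>m\<ge>k. \<forall>j\<ge>m. n m \<le> n j" for k
  proof -
    have "\<exists>v. \<exists>m\<ge>k. n m = v" by blast
    then obtain m where m: "m \<ge> k" "n m = (LEAST v. \<exists>m\<ge>k. n m = v)"
      using LeastI_ex[of "\<lambda>v. \<exists>m\<ge>k. n m = v"] by blast
    have "n m \<le> n j" if "j \<ge> m" for j
      unfolding m(2) using m(1) that by (intro Least_le exI[of _ j]) auto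
    then show ?thesis using m(1) by blast
  qed
  have "\<exists>\<psi>. \<forall>i. (\<forall>j\<ge>\<psi> i. n (\<psi> i) \<le> n j) \<and> \<psi> i < \<psi> (Suc i)"
  proof (rule dependent_nat_choice)
    show "\<exists>m. \<forall>j\<ge>m. n m \<le> n j" using ex[of 0] by blast
    show "\<exists>m'. (\<forall>j\<ge>m'. n m' \<le> n j) \<and> m < m'" for m
      using ex[of "Suc m"] by (auto simp: Suc_le_eq)
  qed
  then obtain \<psi> where "\<And>i j. j \<ge> \<psi> i \<Longrightarrow> n (\<psi> i) \<le> n j" "\<And>i. \<psi> i < \<psi> (Suc i)" by blast
  moreover from this(2) have "strict_mono \<psi>" by (simp add: strict_mono_Suc_iff)
  ultimately show thesis using that by (simp add: strict_mono_less_eq)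
qed

text \<open>Dickson's lemma by induction on the variables: a subsequence that works for the other
  variables is thinned out once more for the multiplicity of \<open>x\<close>.\<close>

lemma dickson:
  assumes "finite W" "\<And>i. f i \<in> monomials W"
  obtains \<phi> :: "nat \<Rightarrow> nat" where "strict_mono \<phi>" "\<And>i j. i \<le> j \<Longrightarrow> f (\<phi> i) \<subseteq># f (\<phi> j)"
proof -
  have "\<exists>\<phi>::nat \<Rightarrow> nat. strict_mono \<phi> \<and> (\<forall>i j. i \<le> j \<longrightarrow> f (\<phi> i) \<subseteq># f (\<phi> j))"
    using assms
  proof (induction W arbitrary: f rule: finite_induct)
    case empty
    then have "f i = {#}" for i by (simp add: monomials_def)
    then show ?case by (intro exI[of _ id]) (auto simp: strict_mono_def)
  next
    case (insert x W)
    have "filter_mset (\<lambda>v. v \<noteq> x) (f i) \<in> monomials W" for i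
      using insert.prems[of i] by (auto simp: monomials_def)
    from insert.IH[of "\<lambda>i. filter_mset (\<lambda>v. v \<noteq> x) (f i)", OF this] obtain \<phi> :: "nat \<Rightarrow> nat"
      where \<phi>': "strict_mono \<phi> \<and> (\<forall>i j. i \<le> j \<longrightarrow>
        filter_mset (\<lambda>v. v \<noteq> x) (f (\<phi> i)) \<subseteq># filter_mset (\<lambda>v. v \<noteq> x) (f (\<phi> j)))" by (rule exE)
    have \<phi>: "strict_mono \<phi>"
      "\<And>i j. i \<le> j \<Longrightarrow> filter_mset (\<lambda>v. v \<noteq> x) (f (\<phi> i)) \<subseteq># filter_mset (\<lambda>v. v \<noteq> x) (f (\<phi> j))"
      using \<phi>' by simp_all
    obtain \<psi> :: "nat \<Rightarrow> nat" where \<psi>: "strict_mono \<psi>"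
      "\<And>i j. i \<le> j \<Longrightarrow> count (f (\<phi> (\<psi> i))) x \<le> count (f (\<phi> (\<psi> j))) x"
      using nondecreasing_subsequence[of "\<lambda>i. count (f (\<phi> i)) x"] by metis
    show ?case
    proof (intro exI[of _ "\<phi> \<circ> \<psi>"] conjI allI impI)
      show "strict_mono (\<phi> \<circ> \<psi>)" using \<phi>(1) \<psi>(1) by (rule strict_mono_o)
      fix i j :: nat assume ij: "i \<le> j"
      then have le: "\<psi> i \<le> \<psi> j" using \<psi>(1) by (simp add: strict_mono_less_eq)
      show "f ((\<phi> \<circ> \<psi>) i) \<subseteq># f ((\<phi> \<circ> \<psi>) j)"
      proof (rule mset_subset_eqI)
        fix v
        have "count (filter_mset (\<lambda>v. v \<noteq> x) (f (\<phi> (\<psi> i)))) v \<le> count (filter_mset (\<lambda>v. v \<noteq> x) (f (\<phi> (\<psi> j)))) v"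
          by (rule mset_subset_eq_count[OF \<phi>(2)[OF le]])
        then show "count (f ((\<phi> \<circ> \<psi>) i)) v \<le> count (f ((\<phi> \<circ> \<psi>) j)) v"
          using \<psi>(2)[OF ij] by (cases "v = x") auto
      qed
    qed
  qed
  then show thesis using that by blast
qed

text \<open>In a strictly descending sequence, Dickson's lemma finds an earlier monomial dividing a
  later one. A global ordering places divisors below their multiples, so the sequence cannot have
  descended between the two.\<close>

lemma monomial_ordering_wf:
  assumes r: "monomial_ordering W r" and W: "finite W"
  shows "wf {(a, b). (a, b) \<in> r \<and> a \<noteq> b}"
  unfolding wf_iff_no_infinite_down_chain
proof
  assume "\<exists>f. \<forall>i. (f (Suc i), f i) \<in> {(a, b). (a, b) \<in> r \<and> a \<noteq> b}"
  then obtain f where f: "\<And>i. (f (Suc i), f i) \<in> r" "\<And>i. f (Suc i) \<noteq> f i" by blast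
  have fW: "f i \<in> monomials W" for i using mo_field[OF r f(1)[of i]] by blast
  have desc: "(f j, f i) \<in> r" if "i \<le> j" for i j
    using that
  proof (induction j)
    case (Suc j)
    then show ?case using mo_trans[OF r f(1)] mo_refl[OF r fW] by (cases "i = Suc j") auto
  qed (use mo_refl[OF r fW] in auto)
  obtain \<phi> :: "nat \<Rightarrow> nat" where \<phi>: "strict_mono \<phi>" "\<And>i j. i \<le> j \<Longrightarrow> f (\<phi> i) \<subseteq># f (\<phi> j)"
    using dickson[of W f, OF W fW] by metis
  have le: "Suc (\<phi> 0) \<le> \<phi> 1" using \<phi>(1) by (simp add: strict_mono_def Suc_le_eq)
  have "(f (\<phi> 0), f (\<phi> 1)) \<in> r" using mo_subset[OF r \<phi>(2) fW] by simp
  then have "(f (\<phi> 0), f (Suc (\<phi> 0))) \<in> r" using desc[OF le] mo_trans[OF r] by blast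
  then show False using f[of "\<phi> 0"] mo_antisym[OF r] by metis
qed

section \<open>Strong Groebner bases and localization\<close>

lemma difference_of_powers:
  assumes "unital_subring A" "x \<in> A" "y \<in> A"
  obtains t where "t \<in> A" "(x - y) * t = x ^ n - y ^ n"
proof -
  have "\<exists>t\<in>A. (x - y) * t = x ^ n - y ^ n"
  proof (induction n)
    case 0
    then show ?case using subring_zero[OF assms(1)] by (intro bexI[of _ 0]) auto
  next
    case (Suc n)
    then obtain t where t: "t \<in> A" "(x - y) * t = x ^ n - y ^ n" by blast
    have "(x - y) * (x * t + y ^ n) = x * ((x - y) * t) + (x - y) * y ^ n" by (simp add: algebra_simps)
    also have "\<dots> = x ^ Suc n - y ^ Suc n" unfolding t(2) by (simp add: algebra_simps)
    finally have "(x - y) * (x * t + y ^ n) = x ^ Suc n - y ^ Suc n" .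
    moreover have "x * t + y ^ n \<in> A"
      by (intro subring_add[OF assms(1)] subring_mult[OF assms(1)] subring_power[OF assms(1)] assms t)
    ultimately show ?case by blast
  qed
  then show thesis using that by blast
qed

lemma lookup_p_power: "lookup (of_nat p ^ n * t) m = int p ^ n * lookup t m" for t :: "'v zpoly"
proof (induction n)
  case (Suc n)
  have "lookup (of_nat p ^ Suc n * t) m = lookup ((of_nat p ^ n * t) * of_nat p) m" by (simp add: mult_ac)
  also have "\<dots> = int p ^ Suc n * lookup t m" unfolding lookup_times_of_nat Suc by simp
  finally show ?case .
qed simp

locale block_order = localized_coeffs p V u for p and V u :: "'v set" +
  fixes r r1 r2 :: "'v multiset rel"
  assumes r: "monomial_ordering V r" and r1: "monomial_ordering (V - u) r1"
    and r2: "monomial_ordering u r2"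
    and block: "\<And>a b. a \<in> monomials V \<Longrightarrow> b \<in> monomials V \<Longrightarrow>
          (a, b) \<in> r \<longleftrightarrow>
          (if filter_mset (\<lambda>v. v \<notin> u) a \<noteq> filter_mset (\<lambda>v. v \<notin> u) b
           then (filter_mset (\<lambda>v. v \<notin> u) a, filter_mset (\<lambda>v. v \<notin> u) b) \<in> r1
           else (filter_mset (\<lambda>v. v \<in> u) a, filter_mset (\<lambda>v. v \<in> u) b) \<in> r2)"
begin

abbreviation bsupp :: "'v zpoly \<Rightarrow> 'v multiset set" where
  "bsupp f \<equiv> {m. blockcoeff u f m \<noteq> 0}"

section \<open>Leading terms in a block ordering\<close>

lemma blocktop_exists:
  assumes "f \<in> zpolys V" "f \<noteq> 0"
  obtains \<beta> where "is_top r1 (bsupp f) \<beta>"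
proof (rule is_top_exists[OF r1 finite_blockcoeff])
  show "bsupp f \<noteq> {}" using blockcoeff_eq_zero assms(2) by blast
  show "bsupp f \<subseteq> monomials (V - u)" using blockcoeff_supp[OF assms(1)] by (auto simp: monomials_def)
qed

lemma coefftop_exists:
  assumes "a \<in> zpolys u" "a \<noteq> 0"
  obtains \<gamma> where "is_top r2 (supp a) \<gamma>"
proof (rule is_top_exists[OF r2, of "supp a"])
  show "supp a \<noteq> {}" using assms(2) by (auto simp: poly_mapping_eq_iff fun_eq_iff)
  show "supp a \<subseteq> monomials u" using assms(1) by (auto simp: zpolys_def monomials_def)
qed simp

lemma filter_split:
  assumes "set_mset m \<inter> u = {}" "set_mset k \<subseteq> u"
  shows "filter_mset (\<lambda>v. v \<notin> u) (m + k) = m" "filter_mset (\<lambda>v. v \<in> u) (m + k) = k"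
proof -
  have "filter_mset (\<lambda>v. v \<notin> u) m = m" "filter_mset (\<lambda>v. v \<notin> u) k = {#}"
    "filter_mset (\<lambda>v. v \<in> u) m = {#}" "filter_mset (\<lambda>v. v \<in> u) k = k"
    using assms by (intro filter_mset_eq_self filter_mset_eq_empty; blast)+
  then show "filter_mset (\<lambda>v. v \<notin> u) (m + k) = m" "filter_mset (\<lambda>v. v \<in> u) (m + k) = k" by simp_all
qed

text \<open>The block ordering compares the parts outside \<open>u\<close> first, so the top
  monomial is found in two stages: the top \<open>\<beta>\<close> of those parts, then the top
  \<open>\<gamma>\<close> of its coefficient in \<open>\<int>[u]\<close>.\<close>

lemma full_top:
  assumes f: "f \<in> zpolys V" and \<beta>: "is_top r1 (bsupp f) \<beta>" and \<gamma>: "is_top r2 (supp (blockcoeff u f \<beta>)) \<gamma>"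
  shows "set_mset \<beta> \<inter> u = {}" "set_mset \<gamma> \<subseteq> u"
    "lookup f (\<beta> + \<gamma>) = lookup (blockcoeff u f \<beta>) \<gamma>" "is_top r (supp f) (\<beta> + \<gamma>)"
proof -
  have nz: "lookup (blockcoeff u f \<beta>) \<gamma> \<noteq> 0" using \<gamma> by (simp add: is_top_def)
  then show d: "set_mset \<beta> \<inter> u = {}" "set_mset \<gamma> \<subseteq> u"
    and eq: "lookup f (\<beta> + \<gamma>) = lookup (blockcoeff u f \<beta>) \<gamma>"
    by (auto simp: lookup_blockcoeff nest_def split: if_splits)
  have V: "m \<in> monomials V" if "lookup f m \<noteq> 0" for m using f that by (auto simp: zpolys_def monomials_def)
  show "is_top r (supp f) (\<beta> + \<gamma>)"
    unfolding is_top_def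
  proof (intro conjI ballI)
    show "\<beta> + \<gamma> \<in> supp f" using eq nz by simp
    fix k assume k: "k \<in> supp f"
    let ?k1 = "filter_mset (\<lambda>v. v \<notin> u) k" and ?k2 = "filter_mset (\<lambda>v. v \<in> u) k"
    have nz': "lookup (blockcoeff u f ?k1) ?k2 \<noteq> 0" using k lookup_split[of f k u] by simp
    then have "blockcoeff u f ?k1 \<noteq> 0" by auto
    then have 1: "(?k1, \<beta>) \<in> r1" using \<beta> by (simp add: is_top_def)
    have 2: "(?k2, \<gamma>) \<in> r2" if "?k1 = \<beta>" using \<gamma> nz' that by (simp add: is_top_def)
    have "\<beta> + \<gamma> \<in> monomials V" "k \<in> monomials V" using V eq nz k by auto
    from block[OF this(2,1)] show "(k, \<beta> + \<gamma>) \<in> r"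
      unfolding filter_split[OF d] using 1 2 by (cases "?k1 = \<beta>") auto
  qed
qed

lemma lead_term_int:
  assumes "f \<in> zpolys V" "is_top r1 (bsupp f) \<beta>" "is_top r2 (supp (blockcoeff u f \<beta>)) \<gamma>"
  shows "lead_term \<Z> r (lookup f) = (lookup (blockcoeff u f \<beta>) \<gamma>, \<beta> + \<gamma>)"
  using lead_monom_eq(2)[OF r, of "lookup f" \<Z> "\<beta> + \<gamma>"] full_top[OF assms] by simp

text \<open>A fraction vanishes only with its numerator, so the denominator \<open>s\<close> does
  not affect the leading monomial.\<close>

lemma lead_term_R:
  assumes "clears s f F" "is_top r1 (bsupp f) \<beta>"
  shows "lead_term R r1 F = (frq (blockcoeff u f \<beta>) s, \<beta>)"
proof -
  have s: "s \<in> S" and F: "F m = frq (blockcoeff u f m) s" for m using assms(1) by (auto simp: clears_def)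
  have "{m. F m \<noteq> \<zero>\<^bsub>R\<^esub>} = bsupp f"
    unfolding F using frq_eq_zero[OF blockcoeff_in_zpolys s] by simp
  then show ?thesis using lead_monom_eq(2)[OF r1, of F R \<beta>] assms(2) F by simp
qed

lemma clears_self: "f \<in> zpolys V \<Longrightarrow> clears 1 f (embed p u (lookup f))"
  by (simp add: clears_def embed_lookup)

text \<open>Splitting off factors \<open>p\<close> ends because the absolute value of one fixed
  nonzero coefficient drops each time.\<close>

lemma content:
  assumes "c \<in> zpolys u" "c \<noteq> 0"
  obtains \<nu> a where "a \<in> S" "c = of_nat p ^ \<nu> * a"
proof -
  obtain k where k: "lookup c k \<noteq> 0" using assms(2) by (auto simp: poly_mapping_eq_iff fun_eq_iff)
  have "\<exists>\<nu> a. a \<in> S \<and> c = of_nat p ^ \<nu> * a"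
    using assms(1) k
  proof (induction "nat \<bar>lookup c k\<bar>" arbitrary: c rule: less_induct)
    case less
    show ?case
    proof (cases "c \<in> pmult p u")
      case False
      then show ?thesis using less.prems(1) by (intro exI[of _ 0] exI[of _ c]) (simp add: S_def)
    next
      case True
      then obtain c' where c': "c' \<in> zpolys u" "c = c' * of_nat p" by (rule pmult_factor)
      then have l: "lookup c k = lookup c' k * int p" by (simp add: lookup_times_of_nat)
      then have nz: "lookup c' k \<noteq> 0" using less.prems(2) by auto
      have "\<bar>lookup c' k\<bar> * 1 < \<bar>lookup c' k\<bar> * int p" using nz p_gt_1 by (intro mult_strict_left_mono) auto
      then have "nat \<bar>lookup c' k\<bar> < nat \<bar>lookup c k\<bar>" unfolding l by (simp add: abs_mult)
      then obtain \<nu> a where "a \<in> S" "c' = of_nat p ^ \<nu> * a" using less.hyps[of c'] c'(1) nz by blast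
      then show ?thesis using c'(2) by (intro exI[of _ "Suc \<nu>"] exI[of _ a]) (simp add: mult_ac)
    qed
  qed
  then show thesis using that by blast
qed

text \<open>\<open>a0\<close> collects the terms of \<open>a\<close> whose coefficients are prime to
  \<open>p\<close>; there is one because \<open>a\<close> is not in \<open>pmult p u\<close>. Its
  top coefficient is then prime to \<open>p\<close> whatever the ordering.\<close>

lemma p_free_part:
  assumes "a \<in> S"
  obtains a0 a1 where "a0 \<in> zpolys u" "a1 \<in> zpolys u" "a = a0 + a1 * of_nat p" "a0 \<noteq> 0"
    "\<And>m. lookup a0 m \<noteq> 0 \<Longrightarrow> \<not> int p dvd lookup a0 m"
proof -
  define a0 where "a0 = Abs_poly_mapping (\<lambda>m. if int p dvd lookup a m then 0 else lookup a m)"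
  have "finite {m. (if int p dvd lookup a m then 0 else lookup a m) \<noteq> 0}"
    by (rule finite_subset[of _ "supp a"]) auto
  then have l: "lookup a0 m = (if int p dvd lookup a m then 0 else lookup a m)" for m
    unfolding a0_def by simp
  have a: "a \<in> zpolys u" "a \<notin> pmult p u" using assms by (auto simp: S_def)
  have a0: "a0 \<in> zpolys u" using a(1) by (auto simp: zpolys_def l split: if_splits)
  have "a - a0 \<in> pmult p u" using a(1) a0 by (auto simp: pmult_def lookup_minus l zpolys_closed)
  then obtain a1 where a1: "a1 \<in> zpolys u" "a - a0 = a1 * of_nat p" by (rule pmult_factor)
  show thesis
  proof (rule that[OF a0 a1(1)])
    show "a = a0 + a1 * of_nat p" using a1(2) by (simp add: algebra_simps)
    obtain m where "\<not> int p dvd lookup a m" using a by (auto simp: pmult_def)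
    then have "lookup a0 m \<noteq> 0" unfolding l by auto
    then show "a0 \<noteq> 0" by auto
    show "\<And>m. lookup a0 m \<noteq> 0 \<Longrightarrow> \<not> int p dvd lookup a0 m" by (auto simp: l split: if_splits)
  qed
qed

text \<open>Divisibility of the full monomials passes to their parts outside \<open>u\<close>. The
  parts inside \<open>u\<close> are dropped, since coefficients in \<open>\<int>[u]\<close> are to
  be compared in \<open>R\<close>.\<close>

lemma strong_groebner_member:
  assumes G: "strong_groebner_basis \<Z> V r (lookup ` I) G" and I: "ideal_in (zpolys V) I"
    and f: "f \<in> I" and \<beta>: "is_top r1 (bsupp f) \<beta>" and \<gamma>: "is_top r2 (supp (blockcoeff u f \<beta>)) \<gamma>"
  obtains g \<beta>' \<gamma>' where "lookup g \<in> G" "g \<in> I" "is_top r1 (bsupp g) \<beta>'" "is_top r2 (supp (blockcoeff u g \<beta>')) \<gamma>'"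
    "lookup (blockcoeff u g \<beta>') \<gamma>' dvd lookup (blockcoeff u f \<beta>) \<gamma>" "\<beta>' \<subseteq># \<beta>"
proof -
  have IV: "I \<subseteq> zpolys V" by (rule ideal_in_subset[OF I])
  then have fV: "f \<in> zpolys V" using f by blast
  have "f \<noteq> 0" using \<beta> by (auto simp: is_top_def)
  then have "lookup f \<in> lookup ` I - {\<zero>\<^bsub>int_mpoly V\<^esub>}" using f by (auto simp: zero_int_mpoly lookup_inj)
  then obtain g' where g': "g' \<in> G" "g' \<noteq> \<zero>\<^bsub>int_mpoly V\<^esub>" "term_divides \<Z> (lead_term \<Z> r g') (lead_term \<Z> r (lookup f))"
    using G unfolding strong_groebner_basis_def by blast
  then obtain g where g: "g' = lookup g" "g \<in> I" using G unfolding strong_groebner_basis_def by blast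
  have gV: "g \<in> zpolys V" "g \<noteq> 0" using g g'(2) IV by (auto simp: zero_int_mpoly)
  obtain \<beta>' where \<beta>': "is_top r1 (bsupp g) \<beta>'" by (rule blocktop_exists[OF gV])
  have "blockcoeff u g \<beta>' \<noteq> 0" using \<beta>' by (simp add: is_top_def)
  then obtain \<gamma>' where \<gamma>': "is_top r2 (supp (blockcoeff u g \<beta>')) \<gamma>'" by (rule coefftop_exists[OF blockcoeff_in_zpolys])
  have td: "lookup (blockcoeff u g \<beta>') \<gamma>' divides\<^bsub>\<Z>\<^esub> lookup (blockcoeff u f \<beta>) \<gamma>" "\<beta>' + \<gamma>' \<subseteq># \<beta> + \<gamma>"
    using g'(3) unfolding g(1) lead_term_int[OF gV(1) \<beta>' \<gamma>'] lead_term_int[OF fV \<beta> \<gamma>] term_divides_def by auto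
  have "filter_mset (\<lambda>v. v \<notin> u) (\<beta>' + \<gamma>') \<subseteq># filter_mset (\<lambda>v. v \<notin> u) (\<beta> + \<gamma>)"
    by (rule multiset_filter_mono[OF td(2)])
  then have "\<beta>' \<subseteq># \<beta>"
    unfolding filter_split[OF full_top(1,2)[OF gV(1) \<beta>' \<gamma>']] filter_split[OF full_top(1,2)[OF fV \<beta> \<gamma>]] .
  moreover have "lookup (blockcoeff u g \<beta>') \<gamma>' dvd lookup (blockcoeff u f \<beta>) \<gamma>"
    using td(1) by (auto simp: factor_def)
  ultimately show thesis using that g g'(1) \<beta>' \<gamma>' by blast
qed

lemma strong_groebner_localized:
  assumes I: "ideal_in (zpolys V) I" and pN: "of_nat p ^ N \<in> I"
    and G: "strong_groebner_basis \<Z> V r (lookup ` I) G"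
  shows "strong_groebner_basis R (V - u) r1 (extended_ideal p V u (lookup ` I)) (embed p u ` G)"
  unfolding strong_groebner_basis_def
proof (intro conjI ballI)
  have IV: "I \<subseteq> zpolys V" by (rule ideal_in_subset[OF I])
  have GI: "G \<subseteq> lookup ` I" "finite G" using G by (auto simp: strong_groebner_basis_def)
  show "finite (embed p u ` G)" using GI(2) by simp
  show "embed p u ` G \<subseteq> extended_ideal p V u (lookup ` I)" using GI(1) embed_in_extended[OF IV] by blast
  fix F assume F: "F \<in> extended_ideal p V u (lookup ` I) - {\<zero>\<^bsub>M\<^esub>}"
  then obtain s f where sf: "f \<in> I" "clears s f F" using extended_ideal_clears[OF I] by blast
  then have s: "s \<in> S" and fV: "f \<in> zpolys V" and Fm: "\<And>m. F m = frq (blockcoeff u f m) s" by (auto simp: clears_def)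
  have "f \<noteq> 0"
  proof
    assume "f = 0"
    then have "F m = \<zero>\<^bsub>R\<^esub>" for m using Fm frq_eq_zero[OF zpolys_closed(1) s] by simp
    then show False using F unfolding cring.zero_mpoly_ring[OF R_cring] by auto
  qed
  then obtain \<beta> where \<beta>: "is_top r1 (bsupp f) \<beta>" using blocktop_exists[OF fV] by blast
  have c0: "blockcoeff u f \<beta> \<noteq> 0" using \<beta> by (simp add: is_top_def)
  have \<beta>V: "set_mset \<beta> \<inter> u = {}" "set_mset \<beta> \<subseteq> V" using blockcoeff_supp[OF fV c0] by auto
  obtain \<nu> a where a: "a \<in> S" "blockcoeff u f \<beta> = of_nat p ^ \<nu> * a"
    by (rule content[OF blockcoeff_in_zpolys c0])
  obtain a0 a1 where a01: "a0 \<in> zpolys u" "a1 \<in> zpolys u" "a = a0 + a1 * of_nat p" "a0 \<noteq> 0"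
    "\<And>m. lookup a0 m \<noteq> 0 \<Longrightarrow> \<not> int p dvd lookup a0 m" using p_free_part[OF a(1)] by metis
  txt \<open>
    Multiplying by the geometric sum \<open>t\<close> turns \<open>a = a0 - y\<close> into \<open>a0\<^sup>N - y\<^sup>N\<close>, and \<open>y\<^sup>N\<close> is
    divisible by \<open>p\<^sup>N \<in> I\<close>.
  \<close>
  define y where "y = - (a1 * of_nat p)"
  have yu: "y \<in> zpolys u" unfolding y_def by (intro zpolys_closed a01 of_nat_in_zpolys)
  obtain t where t: "t \<in> zpolys u" "(a0 - y) * t = a0 ^ N - y ^ N"
    using difference_of_powers[OF zpolys_subring a01(1) yu] by blast
  have at: "a * t = a0 ^ N - y ^ N" using t(2) a01(3) by (simp add: y_def)
  have yp: "y ^ N = (- a1) ^ N * of_nat p ^ N"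
    unfolding y_def by (simp flip: power_mult_distrib)
  \<comment> \<open>The added term sits at \<open>\<beta>\<close> alone. It cancels
    \<open>y ^ N\<close> there and leaves the coefficient \<open>of_nat p ^ \<nu> * a0 ^ N\<close>,
    while all other coefficients are merely multiplied by \<open>t\<close>.\<close>
  define f' where "f' = t * f + (of_nat p ^ \<nu> * y ^ N) * Poly_Mapping.single \<beta> 1"
  have cu: "of_nat p ^ \<nu> * y ^ N \<in> zpolys u" by (intro zpolys_closed of_nat_in_zpolys yu)
  have "f' = t * f + (of_nat p ^ \<nu> * (- a1) ^ N * Poly_Mapping.single \<beta> 1) * of_nat p ^ N"
    unfolding f'_def yp by (simp add: mult_ac)
  also have "\<dots> \<in> I"
    by (intro ideal_in_add[OF I] ideal_in_mult[OF I] u_in_V[OF t(1)] sf(1) pN zpolys_closed(5,6,7)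
        u_in_V[OF a01(2)] of_nat_in_zpolys single_in_zpolys \<beta>V(2))
  finally have f'I: "f' \<in> I" .
  then have f'V: "f' \<in> zpolys V" using IV by blast
  have bf': "blockcoeff u f' m = t * blockcoeff u f m + (if m = \<beta> then of_nat p ^ \<nu> * y ^ N else 0)" for m
  proof -
    have "blockcoeff u (of_nat p ^ \<nu> * y ^ N * Poly_Mapping.single \<beta> 1) m
        = (if \<beta> \<subseteq># m then blockcoeff u (of_nat p ^ \<nu> * y ^ N) (m - \<beta>) else 0)"
      using blockcoeff_monom_mult[OF \<beta>V(1), of "of_nat p ^ \<nu> * y ^ N" m] by (simp add: mult.commute)
    moreover have "\<beta> \<subseteq># m \<and> m - \<beta> = {#} \<longleftrightarrow> m = \<beta>"
      by (metis diff_empty subset_mset.add_diff_inverse subset_mset.order_refl Multiset.diff_cancel add.right_neutral)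
    ultimately show ?thesis
      unfolding f'_def blockcoeff_add blockcoeff_const_mult[OF t(1)] blockcoeff_const[OF cu] by auto
  qed
  have bf'\<beta>: "blockcoeff u f' \<beta> = of_nat p ^ \<nu> * a0 ^ N"
  proof -
    have "blockcoeff u f' \<beta> = of_nat p ^ \<nu> * (a * t + y ^ N)" unfolding bf' a(2) by (simp add: algebra_simps)
    then show ?thesis unfolding at by simp
  qed
  \<comment> \<open>The top integer coefficient of \<open>a0 ^ N\<close> is a power of that of
    \<open>a0\<close>, hence prime to \<open>p\<close>.\<close>
  obtain \<gamma>0 where \<gamma>0: "is_top r2 (supp a0) \<gamma>0" by (rule coefftop_exists[OF a01(1,4)])
  obtain \<gamma> where \<gamma>: "is_top r2 (supp (a0 ^ N)) \<gamma>" "lookup (a0 ^ N) \<gamma> = lookup a0 \<gamma>0 ^ N"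
    by (rule is_top_power[OF r2 a01(1) \<gamma>0])
  have supp': "supp (blockcoeff u f' \<beta>) = supp (a0 ^ N)"
    unfolding bf'\<beta> lookup_p_power using p_gt_1 by simp
  have \<gamma>': "is_top r2 (supp (blockcoeff u f' \<beta>)) \<gamma>" unfolding supp' by (rule \<gamma>(1))
  have \<beta>': "is_top r1 (bsupp f') \<beta>"
    unfolding is_top_def
  proof (intro conjI ballI)
    show "\<beta> \<in> bsupp f'" using \<gamma>' by (auto simp: is_top_def)
    fix m assume m: "m \<in> bsupp f'"
    then have "m \<in> bsupp f" using bf'[of m] c0 by (cases "m = \<beta>") auto
    then show "(m, \<beta>) \<in> r1" using \<beta> by (simp add: is_top_def)
  qed
  obtain g \<beta>g \<gamma>g where g: "lookup g \<in> G" "g \<in> I" "is_top r1 (bsupp g) \<beta>g" "is_top r2 (supp (blockcoeff u g \<beta>g)) \<gamma>g"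
    "lookup (blockcoeff u g \<beta>g) \<gamma>g dvd lookup (blockcoeff u f' \<beta>) \<gamma>" "\<beta>g \<subseteq># \<beta>"
    by (rule strong_groebner_member[OF G I f'I \<beta>' \<gamma>'])
  have gV: "g \<in> zpolys V" using g(2) IV by blast
  have cg: "blockcoeff u g \<beta>g \<noteq> 0" using g(3) by (simp add: is_top_def)
  obtain \<nu>g ag where ag: "ag \<in> S" "blockcoeff u g \<beta>g = of_nat p ^ \<nu>g * ag"
    by (rule content[OF blockcoeff_in_zpolys cg])
  \<comment> \<open>\<open>p ^ \<nu>g\<close> divides every integer coefficient of the leading
    coefficient of \<open>g\<close>, and the top one divides \<open>p ^ \<nu>\<close> times a number
    prime to \<open>p\<close>; hence \<open>\<nu>g \<le> \<nu>\<close>.\<close>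
  have "int p ^ \<nu>g dvd lookup (blockcoeff u g \<beta>g) \<gamma>g" unfolding ag(2) lookup_p_power by simp
  also note g(5)
  also have "lookup (blockcoeff u f' \<beta>) \<gamma> = int p ^ \<nu> * lookup a0 \<gamma>0 ^ N"
    unfolding bf'\<beta> lookup_p_power \<gamma>(2) ..
  finally have dv: "int p ^ \<nu>g dvd int p ^ \<nu> * lookup a0 \<gamma>0 ^ N" .
  have pp: "Factorial_Ring.prime (int p)" using prime_p by simp
  have "\<not> int p dvd lookup a0 \<gamma>0" using a01(5) \<gamma>0 by (simp add: is_top_def)
  then have "coprime (int p ^ \<nu>g) (lookup a0 \<gamma>0 ^ N)"
    using pp by (simp add: prime_imp_coprime coprime_power_left_iff coprime_power_right_iff)
  then have "int p ^ \<nu>g dvd int p ^ \<nu>" using dv by (simp add: coprime_dvd_mult_left_iff)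
  then have "p ^ \<nu>g dvd p ^ \<nu>" by (metis of_nat_dvd_iff of_nat_power)
  then have \<nu>: "\<nu>g \<le> \<nu>" using p_gt_1 by (rule power_dvd_imp_le)
  show "\<exists>G'\<in>embed p u ` G - {\<zero>\<^bsub>M\<^esub>}. term_divides R (lead_term R r1 G') (lead_term R r1 F)"
  proof (intro bexI[of _ "embed p u (lookup g)"])
    have "embed p u (lookup g) \<beta>g \<noteq> \<zero>\<^bsub>R\<^esub>" using cg embed_nonzero_iff by blast
    then have "embed p u (lookup g) \<noteq> \<zero>\<^bsub>M\<^esub>" unfolding cring.zero_mpoly_ring[OF R_cring] by auto
    then show "embed p u (lookup g) \<in> embed p u ` G - {\<zero>\<^bsub>M\<^esub>}" using g(1) by blast
    \<comment> \<open>Since \<open>ag\<close> is a unit in \<open>R\<close>, the quotient of the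
      leading coefficients is \<open>p ^ (\<nu> - \<nu>g) * a\<close> over
      \<open>ag * s\<close>.\<close>
    have sag: "ag * s \<in> S" by (rule S_mult[OF ag(1) s])
    have k: "of_nat p ^ (\<nu> - \<nu>g) * a \<in> zpolys u"
      by (intro zpolys_closed of_nat_in_zpolys S_u[OF a(1)])
    have "of_nat p ^ \<nu> = of_nat p ^ \<nu>g * (of_nat p ^ (\<nu> - \<nu>g) :: 'v zpoly)"
      using \<nu> by (simp flip: power_add)
    then have e: "blockcoeff u g \<beta>g * (of_nat p ^ (\<nu> - \<nu>g) * a) = ag * blockcoeff u f \<beta>"
      unfolding ag(2) a(2) by (simp add: mult_ac)
    have "frq (blockcoeff u g \<beta>g) 1 \<otimes>\<^bsub>R\<^esub> frq (of_nat p ^ (\<nu> - \<nu>g) * a) (ag * s) = frq (ag * blockcoeff u f \<beta>) (ag * s)"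
      unfolding frq_mult[OF blockcoeff_in_zpolys S_one k sag] e by simp
    also have "\<dots> = frq (blockcoeff u f \<beta>) s" by (rule frq_cancel[OF blockcoeff_in_zpolys s ag(1)])
    finally have "frq (blockcoeff u g \<beta>g) 1 divides\<^bsub>R\<^esub> frq (blockcoeff u f \<beta>) s"
      using frq_in_R[OF k sag] by (auto simp: factor_def)
    then show "term_divides R (lead_term R r1 (embed p u (lookup g))) (lead_term R r1 F)"
      unfolding lead_term_R[OF clears_self[OF gV] g(3)] lead_term_R[OF sf(2) \<beta>] term_divides_def
      using g(6) by simp
  qed
qed

text \<open>\<open>pmult p u\<close> is prime and misses \<open>t\<close>, so each factor
  \<open>p\<close> of \<open>t * c\<close> already divides \<open>c\<close>.\<close>

lemma p_power_cancel:
  assumes "t \<in> S" "c \<in> zpolys u" "b \<in> zpolys u" "t * c = of_nat p ^ \<nu> * b"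
  obtains c2 where "c2 \<in> zpolys u" "c = of_nat p ^ \<nu> * c2"
proof -
  have "\<exists>c2\<in>zpolys u. c = of_nat p ^ \<nu> * c2"
    using assms(2,4)
  proof (induction \<nu> arbitrary: c)
    case (Suc \<nu>)
    have pb: "of_nat p ^ \<nu> * b \<in> zpolys u" by (intro zpolys_closed of_nat_in_zpolys assms(3))
    have "t * c = (of_nat p ^ \<nu> * b) * of_nat p" using Suc.prems(2) by (simp add: mult_ac)
    then have "t * c \<in> pmult p u" using times_of_nat_in_pmult[OF pb] by simp
    then have "c \<in> pmult p u"
      using prime_in_mult[OF pmult_prime[OF prime_p fin_u] S_u[OF assms(1)] Suc.prems(1)] assms(1) by (auto simp: S_def)
    then obtain c' where c': "c' \<in> zpolys u" "c = c' * of_nat p" by (rule pmult_factor)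
    have "of_nat p * (t * c') = of_nat p * (of_nat p ^ \<nu> * b)" using Suc.prems(2) c'(2) by (simp add: mult_ac)
    moreover have "(of_nat p :: 'v zpoly) \<noteq> 0" using p_gt_1 by simp
    ultimately have "t * c' = of_nat p ^ \<nu> * b"
      using mult_cancel_u[of "of_nat p" "t * c'" "of_nat p ^ \<nu> * b"] of_nat_in_zpolys u_in_V pb
        u_in_V[OF zpolys_closed(5)[OF S_u[OF assms(1)] c'(1)]] by blast
    then obtain c2 where "c2 \<in> zpolys u" "c' = of_nat p ^ \<nu> * c2" using Suc.IH c'(1) by blast
    then show ?case using c'(2) by (intro bexI[of _ c2]) (auto simp: mult_ac)
  qed simp
  then show thesis using that by blast
qed

lemma contraction_ideal:
  assumes I: "ideal_in (zpolys V) I"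
  shows "ideal_in (zpolys V) {f \<in> zpolys V. \<exists>s\<in>S. s * f \<in> I}"
  unfolding ideal_in_def
proof (intro conjI ballI)
  show "0 \<in> {f \<in> zpolys V. \<exists>s\<in>S. s * f \<in> I}"
    using ideal_in_zero[OF I] zpolys_closed(1) by (intro CollectI conjI bexI[of _ 1] S_one) auto
next
  fix f g assume "f \<in> {f \<in> zpolys V. \<exists>s\<in>S. s * f \<in> I}" "g \<in> {f \<in> zpolys V. \<exists>s\<in>S. s * f \<in> I}"
  then obtain s t where st: "f \<in> zpolys V" "s \<in> S" "s * f \<in> I" "g \<in> zpolys V" "t \<in> S" "t * g \<in> I" by blast
  have "(s * t) * (f + g) = t * (s * f) + s * (t * g)" by (simp add: algebra_simps)
  also have "\<dots> \<in> I" by (intro ideal_in_add[OF I] ideal_in_mult[OF I] u_in_V S_u st)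
  finally show "f + g \<in> {f \<in> zpolys V. \<exists>s\<in>S. s * f \<in> I}"
    using st S_mult[OF st(2,5)] zpolys_closed(3) by blast
next
  fix f g assume "f \<in> zpolys V" "g \<in> {f \<in> zpolys V. \<exists>s\<in>S. s * f \<in> I}"
  then obtain s where s: "f \<in> zpolys V" "g \<in> zpolys V" "s \<in> S" "s * g \<in> I" by blast
  have "s * (f * g) = f * (s * g)" by (simp add: algebra_simps)
  also have "\<dots> \<in> I" by (intro ideal_in_mult[OF I] s)
  finally show "f * g \<in> {f \<in> zpolys V. \<exists>s\<in>S. s * f \<in> I}" using s zpolys_closed(5) by blast
qed blast

text \<open>Well-founded induction on the leading monomial outside \<open>u\<close>. Divisibility in
  \<open>R\<close> only shows that \<open>of_nat p ^ \<nu>\<close> divides the leading coefficient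
  of \<open>f\<close> over \<open>\<int>[u]\<close>; the missing factor \<open>a\<close> comes from
  \<open>h = a * h2\<close>, at the price of one factor \<open>h\<close> per step.\<close>

lemma contraction_eq_saturation:
  assumes I: "ideal_in (zpolys V) I" and pN: "of_nat p ^ N \<in> I"
    and G: "strong_groebner_basis \<Z> V r (lookup ` I) G"
    and h: "h \<in> S"
    and lt: "\<And>g. lookup g \<in> G \<Longrightarrow> \<exists>\<nu> a \<beta> h2. a \<in> zpolys u \<and> h2 \<in> zpolys u \<and> h = a * h2 \<and>
      lead_term R r1 (embed p u (lookup g)) = (frq (of_nat p ^ \<nu> * a) 1, \<beta>)"
  shows "{f \<in> zpolys V. \<exists>s\<in>S. s * f \<in> I} = {f \<in> zpolys V. \<exists>m. h ^ m * f \<in> I}"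
proof (intro equalityI subsetI)
  fix f assume "f \<in> {f \<in> zpolys V. \<exists>m. h ^ m * f \<in> I}"
  then show "f \<in> {f \<in> zpolys V. \<exists>s\<in>S. s * f \<in> I}" using S_power[OF h] by blast
next
  let ?Q = "{f \<in> zpolys V. \<exists>s\<in>S. s * f \<in> I}"
  note Qi = contraction_ideal[OF I]
  have IV: "I \<subseteq> zpolys V" by (rule ideal_in_subset[OF I])
  have IQ: "I \<subseteq> ?Q" using IV S_one by (auto intro!: bexI[of _ 1])
  have hu: "h \<in> zpolys u" by (rule S_u[OF h])
  have R: "strong_groebner_basis R (V - u) r1 (extended_ideal p V u (lookup ` I)) (embed p u ` G)"
    by (rule strong_groebner_localized[OF I pN G])
  have "\<forall>f\<in>?Q. is_top r1 (bsupp f) \<beta> \<longrightarrow> (\<exists>m. h ^ m * f \<in> I)" for \<beta>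
  proof (induction \<beta> rule: wf_induct_rule[OF monomial_ordering_wf[OF r1 finite_Diff[OF fin_V]]])
    case (1 \<beta>)
    show ?case
    proof (intro ballI impI)
      fix f assume f: "f \<in> ?Q" and \<beta>: "is_top r1 (bsupp f) \<beta>"
      have fV: "f \<in> zpolys V" using f by blast
      let ?c = "blockcoeff u f \<beta>"
      have c0: "?c \<noteq> 0" using \<beta> by (simp add: is_top_def)
      have "lookup f \<in> contracted_extension p V u (lookup ` I)"
        unfolding contracted_extension_eq[OF I] using f by blast
      then have "embed p u (lookup f) \<in> extended_ideal p V u (lookup ` I)" by (simp add: contracted_extension_def)
      moreover have "embed p u (lookup f) \<noteq> \<zero>\<^bsub>M\<^esub>"
        using c0 embed_nonzero_iff[of f \<beta>] unfolding cring.zero_mpoly_ring[OF R_cring] by auto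
      ultimately obtain g' where g': "g' \<in> G" "embed p u g' \<noteq> \<zero>\<^bsub>M\<^esub>"
        "term_divides R (lead_term R r1 (embed p u g')) (lead_term R r1 (embed p u (lookup f)))"
        using R unfolding strong_groebner_basis_def by blast
      obtain g where g: "g' = lookup g" "g \<in> I" using g'(1) G unfolding strong_groebner_basis_def by blast
      have gV: "g \<in> zpolys V" using g(2) IV by blast
      have "g \<noteq> 0"
        using g'(2) unfolding g(1) cring.zero_mpoly_ring[OF R_cring]
        by (auto simp: fun_eq_iff embed_lookup R_zero)
      then obtain \<beta>g where \<beta>g: "is_top r1 (bsupp g) \<beta>g" by (rule blocktop_exists[OF gV])
      obtain \<nu> a \<beta>' h2 where lg: "a \<in> zpolys u" "h2 \<in> zpolys u" "h = a * h2"
        "lead_term R r1 (embed p u (lookup g)) = (frq (of_nat p ^ \<nu> * a) 1, \<beta>')"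
        using lt[of g] g'(1) g(1) by blast
      have pa: "of_nat p ^ \<nu> * a \<in> zpolys u" by (intro zpolys_closed of_nat_in_zpolys lg)
      have "frq (blockcoeff u g \<beta>g) 1 = frq (of_nat p ^ \<nu> * a) 1"
        using lg(4) unfolding lead_term_R[OF clears_self[OF gV] \<beta>g] by (rule conjunct1[OF prod.inject[THEN iffD1]])
      then have bg: "blockcoeff u g \<beta>g = of_nat p ^ \<nu> * a"
        using frq_1_inj[OF blockcoeff_in_zpolys pa] by blast
      have "frq (blockcoeff u g \<beta>g) 1 divides\<^bsub>R\<^esub> frq ?c 1" and sub: "\<beta>g \<subseteq># \<beta>"
        using g'(3) unfolding g(1) lead_term_R[OF clears_self[OF gV] \<beta>g] lead_term_R[OF clears_self[OF fV] \<beta>] term_divides_def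
        by simp_all
      then obtain y where y: "y \<in> carrier R" "frq ?c 1 = frq (of_nat p ^ \<nu> * a) 1 \<otimes>\<^bsub>R\<^esub> y"
        unfolding bg factor_def by blast
      then obtain b t where bt: "b \<in> zpolys u" "t \<in> S" "y = frq b t" using carrier_R by blast
      have ab: "a * b \<in> zpolys u" using lg(1) bt(1) by (rule zpolys_closed)
      have "frq ?c 1 = frq (of_nat p ^ \<nu> * a * b) t"
        using y(2) frq_mult[OF pa S_one bt(1,2)] bt(3) by simp
      then have "t * ?c = of_nat p ^ \<nu> * (a * b)"
        using frq_eq_iff[OF blockcoeff_in_zpolys S_one zpolys_closed(5)[OF pa bt(1)] bt(2), of f \<beta>] by (simp add: mult.assoc)
      then obtain c2 where c2: "c2 \<in> zpolys u" "?c = of_nat p ^ \<nu> * c2"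
        by (rule p_power_cancel[OF bt(2) blockcoeff_in_zpolys ab])
      define \<delta> where "\<delta> = \<beta> - \<beta>g"
      have \<delta>: "\<beta> = \<delta> + \<beta>g" using sub by (simp add: \<delta>_def)
      have \<beta>V: "set_mset \<beta> \<subseteq> V - u" by (rule blockcoeff_supp[OF fV c0])
      then have \<delta>V: "set_mset \<delta> \<inter> u = {}" "set_mset \<delta> \<subseteq> V" unfolding \<delta> by auto
      have hc: "h2 * c2 \<in> zpolys u" using lg(2) c2(1) by (rule zpolys_closed)
      \<comment> \<open>At \<open>\<beta>\<close>, \<open>h * f\<close> has coefficient
        \<open>a * h2 * p ^ \<nu> * c2\<close>, and the leading coefficient of \<open>g\<close> is
        \<open>p ^ \<nu> * a\<close>; so this \<open>w\<close> makes \<open>w * g\<close>, an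
        element of \<open>I\<close>, cancel the top term.\<close>
      define w where "w = (h2 * c2) * Poly_Mapping.single \<delta> 1"
      have wV: "w \<in> zpolys V" unfolding w_def by (intro zpolys_closed(5)[OF u_in_V[OF hc]] single_in_zpolys \<delta>V)
      define f2 where "f2 = h * f - w * g"
      have wgI: "w * g \<in> I" by (rule ideal_in_mult[OF I wV g(2)])
      have f2Q: "f2 \<in> ?Q"
        unfolding f2_def
        by (rule ideal_in_diff[OF zpolys_subring Qi ideal_in_mult[OF Qi u_in_V[OF hu] f]]) (use wgI IQ in blast)
      have bf2: "blockcoeff u f2 m = h * blockcoeff u f m - h2 * c2 * (if \<delta> \<subseteq># m then blockcoeff u g (m - \<delta>) else 0)" for m
      proof -
        have "w * g = (h2 * c2) * (Poly_Mapping.single \<delta> 1 * g)" by (simp add: w_def mult.assoc)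
        then show ?thesis
          unfolding f2_def blockcoeff_diff
          by (simp add: blockcoeff_const_mult[OF hu] blockcoeff_const_mult[OF hc] blockcoeff_monom_mult[OF \<delta>V(1)])
      qed
      have bf2\<beta>: "blockcoeff u f2 \<beta> = 0"
        unfolding bf2 c2(2) using bg lg(3) by (simp add: \<delta> mult_ac)
      \<comment> \<open>Monomials of \<open>w * g\<close> are those of \<open>g\<close> shifted by
        \<open>\<delta>\<close>, hence bounded by \<open>\<beta>g + \<delta> = \<beta>\<close>. As
        the coefficient at \<open>\<beta>\<close> is gone, the leading monomial drops
        strictly.\<close>
      have le: "(m, \<beta>) \<in> r1" if "m \<in> bsupp f2" for m
      proof (cases "m \<in> bsupp f")
        case True
        then show ?thesis using \<beta> by (simp add: is_top_def)
      next
        case False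
        then have m: "\<delta> \<subseteq># m" "blockcoeff u g (m - \<delta>) \<noteq> 0" using that bf2[of m] by (auto split: if_splits)
        have "(m - \<delta>, \<beta>g) \<in> r1" using \<beta>g m(2) by (simp add: is_top_def)
        moreover have "\<delta> \<in> monomials (V - u)" using \<delta>V by (auto simp: monomials_def)
        ultimately have "(m - \<delta> + \<delta>, \<beta>g + \<delta>) \<in> r1" using mo_add[OF r1] by blast
        then show ?thesis using m(1) by (simp add: \<delta> add.commute)
      qed
      have "\<exists>m. h ^ m * f2 \<in> I"
      proof (cases "f2 = 0")
        case True
        then show ?thesis using ideal_in_zero[OF I] by simp
      next
        case False
        have "f2 \<in> zpolys V" using f2Q by blast
        then obtain \<beta>2 where \<beta>2: "is_top r1 (bsupp f2) \<beta>2" using False by (rule blocktop_exists)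
        then have "\<beta>2 \<in> bsupp f2" by (simp add: is_top_def)
        then have "(\<beta>2, \<beta>) \<in> {(a, b). (a, b) \<in> r1 \<and> a \<noteq> b}" using le bf2\<beta> by auto
        from 1[OF this] show ?thesis using f2Q \<beta>2 by blast
      qed
      then obtain m where m: "h ^ m * f2 \<in> I" by blast
      have "h ^ Suc m * f = h ^ m * f2 + h ^ m * (w * g)"
        by (simp add: f2_def algebra_simps)
      also have "\<dots> \<in> I"
        by (intro ideal_in_add[OF I m] ideal_in_mult[OF I _ wgI] u_in_V zpolys_closed(7) hu)
      finally show "\<exists>m. h ^ m * f \<in> I" by blast
    qed
  qed
  note main = this
  fix f assume f: "f \<in> ?Q"
  show "f \<in> {f \<in> zpolys V. \<exists>m. h ^ m * f \<in> I}"
  \<comment> \<open>The induction speaks of leading monomials, so \<open>0\<close> is treated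
    apart.\<close>
  proof (cases "f = 0")
    case True
    then show ?thesis using ideal_in_zero[OF I] zpolys_closed(1) by auto
  next
    case False
    then obtain \<beta> where "is_top r1 (bsupp f) \<beta>" using f by (blast elim: blocktop_exists)
    then show ?thesis using main[of \<beta>] f by blast
  qed
qed

end

theorem lemma2p5:
  fixes V u :: "'v set" and p :: nat
    and I P Q J :: "('v multiset \<Rightarrow> int) set"
  assumes "finite V"
    and "pseudo_primary (int_mpoly V) I"
    and "radical (int_mpoly V) I = P"
    and "ideal Q (int_mpoly V)" and "ideal J (int_mpoly V)"
    and "I = Q \<inter> J"
    and "primary_to (int_mpoly V) P Q"
    and "ideal_height (int_mpoly V) Q < ideal_height (int_mpoly V) J"
    and "Factorial_Ring.prime p"
    and "{c. int_const c \<in> P} = Idl\<^bsub>\<Z>\<^esub> {int p}"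
    and "max_independent_set (residue_ring (int p)) V
           (Idl\<^bsub>mpoly_ring (residue_ring (int p)) V\<^esub> (reduce_mod p ` P)) u"
  shows "contracted_extension p V u I = Q \<and>
    (\<forall>G r r\<^sub>1. block_ordering V u r r\<^sub>1 \<longrightarrow>
       strong_groebner_basis \<Z> V r I G \<longrightarrow>
       strong_groebner_basis (coeff_ring p u) (V - u) r\<^sub>1 (extended_ideal p V u I) (embed p u ` G)) \<and>
    (\<forall>G r r\<^sub>1 (k::nat) g \<nu> a \<beta> h. block_ordering V u r r\<^sub>1 \<longrightarrow>
       strong_groebner_basis \<Z> V r I G \<longrightarrow>
       G = g ` {1..k} \<longrightarrow>
       (\<forall>i\<in>{1..k}. g i \<noteq> \<zero>\<^bsub>int_mpoly V\<^esub> \<and>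
          a i \<in> carrier (int_mpoly u) - p_ideal p u \<and>
          lead_term (coeff_ring p u) r\<^sub>1 (embed p u (g i)) =
            (to_coeff_ring p u
               (int_const (int p) [^]\<^bsub>int_mpoly u\<^esub> (\<nu> i :: nat) \<otimes>\<^bsub>int_mpoly u\<^esub> a i), \<beta> i)) \<longrightarrow>
       is_lcm_of (int_mpoly u) (a ` {1..k}) h \<longrightarrow>
       contracted_extension p V u I = saturation (int_mpoly V) I h)"
proof -
  have "u \<subseteq> V" using assms(11) by (simp add: max_independent_set_def)
  then interpret localized_coeffs p V u using assms(1,9) by unfold_locales
  have I: "ideal I (int_mpoly V)" and P: "primeideal P (int_mpoly V)"
    using assms(2,3) by (auto simp: pseudo_primary_def)
  note I' = ideal_in_pull[OF I]
  have II: "I = lookup ` pull I"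
    by (rule image_pull[symmetric], rule additive_subgroup.a_subset[OF ideal.axioms(1)[OF I]])
  have "int p \<in> Idl\<^bsub>\<Z>\<^esub> {int p}"
    using ring.genideal_self'[OF cring.axioms(1)[OF int_is_cring], of "int p"] by simp
  then have "int_const (int p) \<in> P" using assms(10) by blast
  then have pP: "of_nat p \<in> pull P" by (simp add: int_const_of_nat)
  \<comment> \<open>\<open>P\<close> is the radical of \<open>I\<close>, so \<open>p \<in> P\<close>
    has a power in \<open>I\<close>.\<close>
  then obtain N where pN: "of_nat p ^ N \<in> pull I"
    using pull_radical[of V I] assms(3) by auto
  have eq: "contracted_extension p V u I = Q"
    by (rule contracted_extension_eq_component[OF I assms(3) P assms(7,5,6,8) pP assms(11)])
  have block: "\<exists>r2. block_order p V u r r1 r2" if "block_ordering V u r r1" for r r1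
    using that localized_coeffs_axioms unfolding block_ordering_def block_order_def block_order_axioms_def by blast
  show ?thesis
  proof (intro conjI allI impI)
    show "contracted_extension p V u I = Q" by (rule eq)
  next
    fix G r r1 assume b: "block_ordering V u r r1" and G: "strong_groebner_basis \<Z> V r I G"
    obtain r2 where "block_order p V u r r1 r2" using block[OF b] by blast
    then interpret block_order p V u r r1 r2 .
    show "strong_groebner_basis R (V - u) r1 (extended_ideal p V u I) (embed p u ` G)"
      using strong_groebner_localized[OF I' pN, of G] G II by simp
  next
    fix G r r1 and k :: nat and g \<nu> a \<beta> h
    assume b: "block_ordering V u r r1" and G: "strong_groebner_basis \<Z> V r I G" and Gk: "G = g ` {1..k}"
      and lt: "\<forall>i\<in>{1..k}. g i \<noteq> \<zero>\<^bsub>int_mpoly V\<^esub> \<and>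
          a i \<in> carrier (int_mpoly u) - p_ideal p u \<and>
          lead_term R r1 (embed p u (g i)) =
            (to_coeff_ring p u
               (int_const (int p) [^]\<^bsub>int_mpoly u\<^esub> (\<nu> i :: nat) \<otimes>\<^bsub>int_mpoly u\<^esub> a i), \<beta> i)"
      and lcm: "is_lcm_of (int_mpoly u) (a ` {1..k}) h"
    obtain r2 where "block_order p V u r r1 r2" using block[OF b] by blast
    then interpret block_order p V u r r1 r2 .
    have "\<exists>t. t \<in> S \<and> a i = lookup t" if "i \<in> {1..k}" for i
      using lt that unfolding S_eq by blast
    then obtain a' where a': "\<And>i. i \<in> {1..k} \<Longrightarrow> a' i \<in> S \<and> a i = lookup (a' i)" by metis
    obtain h' where h': "h' \<in> zpolys u" "h = lookup h'"
      using lcm unfolding is_lcm_of_def carrier_int_mpoly by blast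
    have dvd: "\<exists>t\<in>zpolys u. c = b * t" if "lookup b divides\<^bsub>int_mpoly u\<^esub> lookup c" for b c
      using that unfolding factor_def carrier_int_mpoly by (auto simp: lookup_inj)
    have prodS: "(\<Prod>i\<in>K. a' i) \<in> S" if "finite K" "K \<subseteq> {1..k}" for K
      using that
    proof (induction K rule: finite_induct)
      case (insert i K)
      then show ?case using S_mult[of "a' i" "\<Prod>i\<in>K. a' i"] a'[of i] by simp
    qed simp
    \<comment> \<open>\<open>h\<close> divides every common multiple of the \<open>a i\<close>, in
      particular their product, which lies in \<open>S\<close>; as \<open>pmult p u\<close> is an
      ideal, the divisor lies in \<open>S\<close> too. For \<open>k = 0\<close> the product is
      \<open>1\<close>.\<close>
    have prod: "(\<Prod>i=1..k. a' i) \<in> S" by (rule prodS) auto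
    have "lookup (a' i) divides\<^bsub>int_mpoly u\<^esub> lookup (\<Prod>i=1..k. a' i)" if i: "i \<in> {1..k}" for i
    proof -
      have "(\<Prod>j\<in>{1..k} - {i}. a' j) \<in> S"
        by (rule prodS) auto
      moreover have "(\<Prod>i=1..k. a' i) = a' i * (\<Prod>j\<in>{1..k} - {i}. a' j)"
        using i by (simp add: prod.remove)
      ultimately show ?thesis
        unfolding factor_def by (intro bexI[of _ "lookup (\<Prod>j\<in>{1..k} - {i}. a' j)"]) auto
    qed
    then have "h divides\<^bsub>int_mpoly u\<^esub> lookup (\<Prod>i=1..k. a' i)"
      using lcm a' S_u[OF prod] unfolding is_lcm_of_def by auto
    then obtain t where t: "t \<in> zpolys u" "(\<Prod>i=1..k. a' i) = h' * t" using dvd h'(2) by blast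
    have "h' \<notin> pmult p u"
    proof
      assume "h' \<in> pmult p u"
      then have "t * h' \<in> pmult p u"
        using ideal_in_mult[OF prime_in_ideal[OF pmult_prime[OF prime_p fin_u]] t(1)] by blast
      then show False using prod t(2) by (simp add: S_def mult.commute)
    qed
    then have h'S: "h' \<in> S" using h'(1) by (simp add: S_def)
    have "{f \<in> zpolys V. \<exists>s\<in>S. s * f \<in> pull I} = {f \<in> zpolys V. \<exists>m. h' ^ m * f \<in> pull I}"
    proof (rule contraction_eq_saturation[OF I' pN _ h'S])
      show "strong_groebner_basis \<Z> V r (lookup ` pull I) G" using G II by simp
      fix f assume "lookup f \<in> G"
      then obtain i where i: "i \<in> {1..k}" "lookup f = g i" unfolding Gk by blast
      have "a i divides\<^bsub>int_mpoly u\<^esub> h" using lcm i(1) unfolding is_lcm_of_def by blast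
      then have "lookup (a' i) divides\<^bsub>int_mpoly u\<^esub> lookup h'" using a'[OF i(1)] h'(2) by simp
      then obtain h2 where h2: "h2 \<in> zpolys u" "h' = a' i * h2" using dvd by blast
      have "int_const (int p) [^]\<^bsub>int_mpoly u\<^esub> (\<nu> i) \<otimes>\<^bsub>int_mpoly u\<^esub> a i = lookup (of_nat p ^ \<nu> i * a' i)"
        using a'[OF i(1)] by (simp add: int_const_of_nat)
      then have "lead_term R r1 (embed p u (lookup f)) = (frq (of_nat p ^ \<nu> i * a' i) 1, \<beta> i)"
        using lt i by (simp add: to_coeff_ring_lookup)
      then show "\<exists>\<nu> a \<beta> h2. a \<in> zpolys u \<and> h2 \<in> zpolys u \<and> h' = a * h2 \<and>
          lead_term R r1 (embed p u (lookup f)) = (frq (of_nat p ^ \<nu> * a) 1, \<beta>)"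
        using h2 S_u a'[OF i(1)] by blast
    qed
    moreover have "contracted_extension p V u I = lookup ` {f \<in> zpolys V. \<exists>s\<in>S. s * f \<in> pull I}"
      using contracted_extension_eq[OF I'] II by simp
    moreover have "saturation (int_mpoly V) I h = lookup ` {f \<in> zpolys V. \<exists>m. h' ^ m * f \<in> pull I}"
    proof -
      have "{y \<in> lookup ` zpolys V. L y} = lookup ` {t \<in> zpolys V. L (lookup t)}" for L by blast
      then show ?thesis unfolding saturation_def carrier_int_mpoly h'(2) by simp
    qed
    ultimately show "contracted_extension p V u I = saturation (int_mpoly V) I h" by simp
  qed
qed

end
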